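(* Let $\mathcal{C}$ be a monoidal 2-category admitting pie limits and suppose that the forgetful 2-functor $U_s:\text{Mon}(\mathcal{C})_s\to\mathcal{C}$ has a left 2-adjoint. Let $T$ be the induced 2-monad on $\mathcal{C}$. Then for each $w\in\{l,p,c\}$ there is an isomorphism of $\mathcal{F}$-categories $E_w:\mathbb{M}\text{on}(\mathcal{C})_w\to\text{T-}\mathbb{A}\text{lg}_w$ over $\mathcal{C}$ (i.e. commuting with the forgetful $\mathcal{F}$-functors to $\mathcal{C}$), and these are natural in $w$ (i.e. for $p\le l$ and for $p\le c$ they commute with the inclusions $\mathbb{M}\text{on}(\mathcal{C})_p\to\mathbb{M}\text{on}(\mathcal{C})_w$ and $\text{T-}\mathbb{A}\text{lg}_p\to\text{T-}\mathbb{A}\text{lg}_w$).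
   Context: **$\mathcal{F}$-categories.** An $\mathcal{F}$-category $\mathbb{A}$ is a pair of 2-categories $\mathcal{A}_\tau,\mathcal{A}_\lambda$ with a 2-functor $j:\mathcal{A}_\tau\to\mathcal{A}_\lambda$ that is the identity on objects, faithful (injective on 1-cells) and locally fully faithful. The 1-cells of $\mathcal{A}_\lambda$ are the loose morphisms; those coming from $\mathcal{A}_\tau$ are the tight ones. An $\mathcal{F}$-functor $F:\mathbb{A}\to\mathbb{B}$ is a 2-functor $F_\lambda:\mathcal{A}_\lambda\to\mathcal{B}_\lambda$ taking tight morphisms to tight morphisms. A 2-category is viewed as an $\mathcal{F}$-category in which all morphisms are tight. **Monoids.** A monoidal 2-category is a monoidal $\mathcal{V}$-category for $\mathcal{V}=\text{Cat}$ (the axioms of a monoidal category with all data 2-functorial and 2-natural). Pie limits are the 2-categorical limits constructible from products, inserters and equifiers. Associativity and unit isomorphisms are suppressed below and tensor is written $\otimes$, unit $I$. A monoid $(X,m_X:X\otimes X\to X,i_X:I\to X)$ in $\mathcal{C}$ is a monoid in the usual sense. A lax monoid morphism $(f,\bar f,f_0):X\to Y$ consists of $f:X\to Y$ and 2-cells $\bar f:m_Y(f\otimes f)\Rightarrow fm_X$ and $f_0:i_Y\Rightarrow fi_X$ such that $$\bigl(\bar f\,(1\otimes m_X)\bigr)\circ\bigl(m_Y(f\otimes 1_Y)(1_X\otimes\bar f)\bigr)=\bigl(\bar f\,(m_X\otimes1)\bigr)\circ\bigl(m_Y(\bar f\otimes1_Y)(1_X\otimes1_X\otimes f)\bigr),$$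 and such that $(\bar f(1\otimes i_X))\circ(m_Y(f\otimes1_Y)(1_X\otimes f_0))$ and $(\bar f(i_X\otimes1))\circ(m_Y(f_0\otimes1_Y)f)$ are both the identity 2-cell on $f$. It is pseudo if $\bar f,f_0$ are invertible, strict if they are identities; colax morphisms have $\bar f,f_0$ reversed, with the dual axioms. A monoid transformation $\alpha:(f,\bar f,f_0)\Rightarrow(g,\bar g,g_0)$ is a 2-cell $\alpha:f\Rightarrow g$ with $(\alpha m_X)\circ\bar f=\bar g\circ(m_Y(\alpha\otimes\alpha))$ and $(\alpha i_X)\circ f_0=g_0$ (dually for colax). For $w=s,p,l,c$ (strict, pseudo, lax, colax), $\text{Mon}(\mathcal{C})_w$ is the 2-category of monoids, $w$-monoid morphisms and monoid transformations; for $w\in\{l,p,c\}$ the $\mathcal{F}$-category $\mathbb{M}\text{on}(\mathcal{C})_w$ is given by the inclusion $\text{Mon}(\mathcal{C})_s\to\text{Mon}(\mathcal{C})_w$, with evident forgetful $\mathcal{F}$-functor to $\mathcal{C}$. **Algebras.** Let $T=(T,\mu,\eta)$ be a 2-monad on $\mathcal{C}$. Algebras are strict $T$-algebras $(A,a:TA\to A)$. A lax morphism $(f,\bar f):(A,a)\rightsquigarrow(B,b)$ is $f:A\to B$ with a 2-cell $\bar f:b\,Tf\Rightarrow fa$ satisfying $\bar f\mu_A=(\bar f\,Ta)\circ(b\,T\bar f)$ and $\bar f\eta_A=1_f$; it is a pseudo morphism if $\bar f$ is invertible and strict if $\bar f$ is an identity. A colax morphism has $\bar f:fa\Rightarrow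 b\,Tf$ satisfying the dual conditions. An algebra 2-cell $\alpha:(f,\bar f)\Rightarrow(g,\bar g)$ of lax morphisms is a 2-cell $\alpha:f\Rightarrow g$ with $(\alpha a)\circ\bar f=\bar g\circ(b\,T\alpha)$; dually for colax. $\text{T-Alg}_w$ is the 2-category of algebras, $w$-morphisms and algebra 2-cells. For $w\in\{l,p,c\}$, $\text{T-}\mathbb{A}\text{lg}_w$ is the $\mathcal{F}$-category given by the inclusion $\text{T-Alg}_s\to\text{T-Alg}_w$, with forgetful $\mathcal{F}$-functor to $\mathcal{C}$. Pseudo morphisms (of monoids or algebras) are regarded as colax by inverting their structure 2-cells. *)

theory Defs
  imports Main
begin

section \<open>2-categories, 2-functors and 2-natural transformations\<close>

text \<open>
  A 2-category is strict, that is, a Cat-enriched category. All operations are total functions, but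
  they are meaningful only on composable members of the carriers, and every notion of
  equality of 2-functors below is relative to the carriers. Both \<open>g \<cdot> f\<close> (1-cells) and
  \<open>\<beta> \<star> \<alpha>\<close> (horizontal composition of 2-cells) are written in the order of function composition,
  as is the vertical composite \<open>\<beta> \<bullet> \<alpha>\<close>. Whiskering is horizontal composition with an identity
  2-cell \<open>\<iota> f\<close>.
\<close>

record ('o, 'm, 'c) two_cat =
  Obj :: "'o set"
  Mor :: "'m set"
  Cell :: "'c set"
  dom1 :: "'m \<Rightarrow> 'o"
  cod1 :: "'m \<Rightarrow> 'o"
  dom2 :: "'c \<Rightarrow> 'm"
  cod2 :: "'c \<Rightarrow> 'm"
  id1 :: "'o \<Rightarrow> 'm" ("\<one>\<index>")
  id2 :: "'m \<Rightarrow> 'c" ("\<iota>\<index>")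
  comp1 :: "'m \<Rightarrow> 'm \<Rightarrow> 'm" (infixr "\<cdot>\<index>" 76)
  vcomp :: "'c \<Rightarrow> 'c \<Rightarrow> 'c" (infixr "\<bullet>\<index>" 70)
  hcomp :: "'c \<Rightarrow> 'c \<Rightarrow> 'c" (infixr "\<star>\<index>" 74)

definition hom :: "('o, 'm, 'c) two_cat \<Rightarrow> 'o \<Rightarrow> 'o \<Rightarrow> 'm set" where
  "hom C x y = {f \<in> Mor C. dom1 C f = x \<and> cod1 C f = y}"

definition cells :: "('o, 'm, 'c) two_cat \<Rightarrow> 'm \<Rightarrow> 'm \<Rightarrow> 'c set" where
  "cells C f g = {\<alpha> \<in> Cell C. dom2 C \<alpha> = f \<and> cod2 C \<alpha> = g}"

abbreviation whisker_left :: "('o, 'm, 'c) two_cat \<Rightarrow> 'm \<Rightarrow> 'c \<Rightarrow> 'c" where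
  "whisker_left C g \<alpha> \<equiv> hcomp C (id2 C g) \<alpha>"

abbreviation whisker_right :: "('o, 'm, 'c) two_cat \<Rightarrow> 'c \<Rightarrow> 'm \<Rightarrow> 'c" where
  "whisker_right C \<alpha> f \<equiv> hcomp C \<alpha> (id2 C f)"

locale two_category =
  fixes C :: "('o, 'm, 'c) two_cat" (structure)
  assumes dom1_in: "f \<in> Mor C \<Longrightarrow> dom1 C f \<in> Obj C"
    and cod1_in: "f \<in> Mor C \<Longrightarrow> cod1 C f \<in> Obj C"
    and dom2_in: "\<alpha> \<in> Cell C \<Longrightarrow> dom2 C \<alpha> \<in> Mor C"
    and cod2_in: "\<alpha> \<in> Cell C \<Longrightarrow> cod2 C \<alpha> \<in> Mor C"
    and globular_dom: "\<alpha> \<in> Cell C \<Longrightarrow> dom1 C (dom2 C \<alpha>) = dom1 C (cod2 C \<alpha>)"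
    and globular_cod: "\<alpha> \<in> Cell C \<Longrightarrow> cod1 C (dom2 C \<alpha>) = cod1 C (cod2 C \<alpha>)"
    and id1_hom: "x \<in> Obj C \<Longrightarrow> \<one> x \<in> hom C x x"
    and comp1_hom: "\<lbrakk>f \<in> hom C x y; g \<in> hom C y z\<rbrakk> \<Longrightarrow> g \<cdot> f \<in> hom C x z"
    and comp1_assoc: "\<lbrakk>f \<in> hom C w x; g \<in> hom C x y; h \<in> hom C y z\<rbrakk> \<Longrightarrow>
          (h \<cdot> g) \<cdot> f = h \<cdot> (g \<cdot> f)"
    and comp1_id_right: "f \<in> hom C x y \<Longrightarrow> f \<cdot> \<one> x = f"
    and comp1_id_left: "f \<in> hom C x y \<Longrightarrow> \<one> y \<cdot> f = f"
    and id2_cells: "f \<in> Mor C \<Longrightarrow> \<iota> f \<in> cells C f f"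
    and vcomp_cells: "\<lbrakk>\<alpha> \<in> cells C f g; \<beta> \<in> cells C g h\<rbrakk> \<Longrightarrow> \<beta> \<bullet> \<alpha> \<in> cells C f h"
    and vcomp_assoc: "\<lbrakk>\<alpha> \<in> cells C f g; \<beta> \<in> cells C g h; \<gamma> \<in> cells C h k\<rbrakk> \<Longrightarrow>
          (\<gamma> \<bullet> \<beta>) \<bullet> \<alpha> = \<gamma> \<bullet> (\<beta> \<bullet> \<alpha>)"
    and vcomp_id_right: "\<alpha> \<in> cells C f g \<Longrightarrow> \<alpha> \<bullet> \<iota> f = \<alpha>"
    and vcomp_id_left: "\<alpha> \<in> cells C f g \<Longrightarrow> \<iota> g \<bullet> \<alpha> = \<alpha>"
    and hcomp_cells: "\<lbrakk>f \<in> hom C x y; g \<in> hom C y z; \<alpha> \<in> cells C f f'; \<beta> \<in> cells C g g'\<rbrakk> \<Longrightarrow>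
          \<beta> \<star> \<alpha> \<in> cells C (g \<cdot> f) (g' \<cdot> f')"
    and hcomp_assoc: "\<lbrakk>f \<in> hom C w x; g \<in> hom C x y; h \<in> hom C y z;
          \<alpha> \<in> cells C f f'; \<beta> \<in> cells C g g'; \<gamma> \<in> cells C h h'\<rbrakk> \<Longrightarrow>
          (\<gamma> \<star> \<beta>) \<star> \<alpha> = \<gamma> \<star> (\<beta> \<star> \<alpha>)"
    and hcomp_id_right: "\<lbrakk>f \<in> hom C x y; \<alpha> \<in> cells C f f'\<rbrakk> \<Longrightarrow> \<alpha> \<star> \<iota> (\<one> x) = \<alpha>"
    and hcomp_id_left: "\<lbrakk>f \<in> hom C x y; \<alpha> \<in> cells C f f'\<rbrakk> \<Longrightarrow> \<iota> (\<one> y) \<star> \<alpha> = \<alpha>"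
    and hcomp_id2: "\<lbrakk>f \<in> hom C x y; g \<in> hom C y z\<rbrakk> \<Longrightarrow> \<iota> g \<star> \<iota> f = \<iota> (g \<cdot> f)"
    and interchange: "\<lbrakk>f \<in> hom C x y; g \<in> hom C y z; \<alpha> \<in> cells C f f'; \<alpha>' \<in> cells C f' f'';
          \<beta> \<in> cells C g g'; \<beta>' \<in> cells C g' g''\<rbrakk> \<Longrightarrow>
          (\<beta>' \<bullet> \<beta>) \<star> (\<alpha>' \<bullet> \<alpha>) = (\<beta>' \<star> \<alpha>') \<bullet> (\<beta> \<star> \<alpha>)"

definition iso1 :: "('o, 'm, 'c) two_cat \<Rightarrow> 'm \<Rightarrow> bool" where
  "iso1 C f \<longleftrightarrow> f \<in> Mor C \<and> (\<exists>g \<in> hom C (cod1 C f) (dom1 C f).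
     comp1 C g f = id1 C (dom1 C f) \<and> comp1 C f g = id1 C (cod1 C f))"

definition inverse2 :: "('o, 'm, 'c) two_cat \<Rightarrow> 'c \<Rightarrow> 'c \<Rightarrow> bool" where
  "inverse2 C \<alpha> \<beta> \<longleftrightarrow> \<alpha> \<in> Cell C \<and> \<beta> \<in> cells C (cod2 C \<alpha>) (dom2 C \<alpha>) \<and>
     vcomp C \<beta> \<alpha> = id2 C (dom2 C \<alpha>) \<and> vcomp C \<alpha> \<beta> = id2 C (cod2 C \<alpha>)"

definition iso2 :: "('o, 'm, 'c) two_cat \<Rightarrow> 'c \<Rightarrow> bool" where
  "iso2 C \<alpha> \<longleftrightarrow> (\<exists>\<beta>. inverse2 C \<alpha> \<beta>)"

definition inv2 :: "('o, 'm, 'c) two_cat \<Rightarrow> 'c \<Rightarrow> 'c" where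
  "inv2 C \<alpha> = (THE \<beta>. inverse2 C \<alpha> \<beta>)"

definition identity2 :: "('o, 'm, 'c) two_cat \<Rightarrow> 'c \<Rightarrow> bool" where
  "identity2 C \<alpha> \<longleftrightarrow> (\<exists>f \<in> Mor C. \<alpha> = id2 C f)"

definition prod_cat :: "('o1, 'm1, 'c1) two_cat \<Rightarrow> ('o2, 'm2, 'c2) two_cat \<Rightarrow>
    ('o1 \<times> 'o2, 'm1 \<times> 'm2, 'c1 \<times> 'c2) two_cat" where
  "prod_cat C D = \<lparr>
     Obj = Obj C \<times> Obj D, Mor = Mor C \<times> Mor D, Cell = Cell C \<times> Cell D,
     dom1 = map_prod (dom1 C) (dom1 D), cod1 = map_prod (cod1 C) (cod1 D),
     dom2 = map_prod (dom2 C) (dom2 D), cod2 = map_prod (cod2 C) (cod2 D),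
     id1 = map_prod (id1 C) (id1 D), id2 = map_prod (id2 C) (id2 D),
     comp1 = (\<lambda>g f. (comp1 C (fst g) (fst f), comp1 D (snd g) (snd f))),
     vcomp = (\<lambda>\<beta> \<alpha>. (vcomp C (fst \<beta>) (fst \<alpha>), vcomp D (snd \<beta>) (snd \<alpha>))),
     hcomp = (\<lambda>\<beta> \<alpha>. (hcomp C (fst \<beta>) (fst \<alpha>), hcomp D (snd \<beta>) (snd \<alpha>)))\<rparr>"

record ('o1, 'm1, 'c1, 'o2, 'm2, 'c2) two_fun =
  on_obj :: "'o1 \<Rightarrow> 'o2"
  on_mor :: "'m1 \<Rightarrow> 'm2"
  on_cell :: "'c1 \<Rightarrow> 'c2"

locale two_functor = A: two_category A + B: two_category B
  for A :: "('o1, 'm1, 'c1) two_cat" and B :: "('o2, 'm2, 'c2) two_cat" +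
  fixes F :: "('o1, 'm1, 'c1, 'o2, 'm2, 'c2) two_fun"
  assumes obj: "x \<in> Obj A \<Longrightarrow> on_obj F x \<in> Obj B"
    and mor: "f \<in> hom A x y \<Longrightarrow> on_mor F f \<in> hom B (on_obj F x) (on_obj F y)"
    and cell: "\<alpha> \<in> cells A f g \<Longrightarrow> on_cell F \<alpha> \<in> cells B (on_mor F f) (on_mor F g)"
    and pres_id1: "x \<in> Obj A \<Longrightarrow> on_mor F (id1 A x) = id1 B (on_obj F x)"
    and pres_comp1: "\<lbrakk>f \<in> hom A x y; g \<in> hom A y z\<rbrakk> \<Longrightarrow>
          on_mor F (comp1 A g f) = comp1 B (on_mor F g) (on_mor F f)"
    and pres_id2: "f \<in> Mor A \<Longrightarrow> on_cell F (id2 A f) = id2 B (on_mor F f)"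
    and pres_vcomp: "\<lbrakk>\<alpha> \<in> cells A f g; \<beta> \<in> cells A g h\<rbrakk> \<Longrightarrow>
          on_cell F (vcomp A \<beta> \<alpha>) = vcomp B (on_cell F \<beta>) (on_cell F \<alpha>)"
    and pres_hcomp: "\<lbrakk>f \<in> hom A x y; g \<in> hom A y z; \<alpha> \<in> cells A f f'; \<beta> \<in> cells A g g'\<rbrakk> \<Longrightarrow>
          on_cell F (hcomp A \<beta> \<alpha>) = hcomp B (on_cell F \<beta>) (on_cell F \<alpha>)"

definition id_fun :: "('o, 'm, 'c, 'o, 'm, 'c) two_fun" where
  "id_fun = \<lparr>on_obj = (\<lambda>x. x), on_mor = (\<lambda>f. f), on_cell = (\<lambda>\<alpha>. \<alpha>)\<rparr>"

definition comp_fun :: "('o2, 'm2, 'c2, 'o3, 'm3, 'c3) two_fun \<Rightarrow>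
    ('o1, 'm1, 'c1, 'o2, 'm2, 'c2) two_fun \<Rightarrow> ('o1, 'm1, 'c1, 'o3, 'm3, 'c3) two_fun" where
  "comp_fun G F = \<lparr>on_obj = on_obj G \<circ> on_obj F, on_mor = on_mor G \<circ> on_mor F,
     on_cell = on_cell G \<circ> on_cell F\<rparr>"

definition fun_eq_on :: "('o1, 'm1, 'c1) two_cat \<Rightarrow> ('o1, 'm1, 'c1, 'o2, 'm2, 'c2) two_fun \<Rightarrow>
    ('o1, 'm1, 'c1, 'o2, 'm2, 'c2) two_fun \<Rightarrow> bool" where
  "fun_eq_on A F G \<longleftrightarrow> (\<forall>x \<in> Obj A. on_obj F x = on_obj G x) \<and>
     (\<forall>f \<in> Mor A. on_mor F f = on_mor G f) \<and> (\<forall>\<alpha> \<in> Cell A. on_cell F \<alpha> = on_cell G \<alpha>)"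

locale two_natural = F: two_functor A B F + G: two_functor A B G
  for A :: "('o1, 'm1, 'c1) two_cat" and B :: "('o2, 'm2, 'c2) two_cat"
    and F :: "('o1, 'm1, 'c1, 'o2, 'm2, 'c2) two_fun"
    and G :: "('o1, 'm1, 'c1, 'o2, 'm2, 'c2) two_fun" +
  fixes \<eta> :: "'o1 \<Rightarrow> 'm2"
  assumes component: "x \<in> Obj A \<Longrightarrow> \<eta> x \<in> hom B (on_obj F x) (on_obj G x)"
    and natural1: "f \<in> hom A x y \<Longrightarrow> comp1 B (on_mor G f) (\<eta> x) = comp1 B (\<eta> y) (on_mor F f)"
    and natural2: "\<lbrakk>f \<in> hom A x y; \<alpha> \<in> cells A f g\<rbrakk> \<Longrightarrow>
          whisker_right B (on_cell G \<alpha>) (\<eta> x) = whisker_left B (\<eta> y) (on_cell F \<alpha>)"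

locale two_adjunction =
    two_functor A C U + F: two_functor C A F +
    unit: two_natural C C id_fun "comp_fun U F" \<eta> +
    counit: two_natural A A "comp_fun F U" id_fun \<epsilon>
  for C :: "('o1, 'm1, 'c1) two_cat" and A :: "('o2, 'm2, 'c2) two_cat"
    and F :: "('o1, 'm1, 'c1, 'o2, 'm2, 'c2) two_fun"
    and U :: "('o2, 'm2, 'c2, 'o1, 'm1, 'c1) two_fun"
    and \<eta> :: "'o1 \<Rightarrow> 'm1" and \<epsilon> :: "'o2 \<Rightarrow> 'm2" +
  assumes triangle_right: "a \<in> Obj A \<Longrightarrow>
            comp1 C (on_mor U (\<epsilon> a)) (\<eta> (on_obj U a)) = id1 C (on_obj U a)"
    and triangle_left: "c \<in> Obj C \<Longrightarrow>
            comp1 A (\<epsilon> (on_obj F c)) (on_mor F (\<eta> c)) = id1 A (on_obj F c)"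


section \<open>Pie limits\<close>

text \<open>
  The universal properties are the strict 2-categorical ones: the comparison is an isomorphism
  of categories, spelled out on objects (1-cells into the limit) and on morphisms (2-cells).
  Small sets are represented by the subsets of a type \<open>'i\<close>; a family indexed by \<open>J\<close> is a
  function on \<open>'i\<close> of which only the values on \<open>J\<close> matter.
\<close>

context two_category
begin

definition is_product :: "'i set \<Rightarrow> ('i \<Rightarrow> 'o) \<Rightarrow> 'o \<Rightarrow> ('i \<Rightarrow> 'm) \<Rightarrow> bool" where
  "is_product J A P p \<longleftrightarrow> P \<in> Obj C \<and> (\<forall>j \<in> J. p j \<in> hom C P (A j)) \<and>
     (\<forall>X \<in> Obj C. \<forall>f. (\<forall>j \<in> J. f j \<in> hom C X (A j)) \<longrightarrow>
        (\<exists>!u. u \<in> hom C X P \<and> (\<forall>j \<in> J. p j \<cdot> u = f j))) \<and>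
     (\<forall>X \<in> Obj C. \<forall>u \<in> hom C X P. \<forall>v \<in> hom C X P. \<forall>\<alpha>.
        (\<forall>j \<in> J. \<alpha> j \<in> cells C (p j \<cdot> u) (p j \<cdot> v)) \<longrightarrow>
        (\<exists>!\<beta>. \<beta> \<in> cells C u v \<and> (\<forall>j \<in> J. whisker_left C (p j) \<beta> = \<alpha> j)))"

definition is_inserter :: "'m \<Rightarrow> 'm \<Rightarrow> 'o \<Rightarrow> 'm \<Rightarrow> 'c \<Rightarrow> bool" where
  "is_inserter f g P p \<theta> \<longleftrightarrow> p \<in> hom C P (dom1 C f) \<and> \<theta> \<in> cells C (f \<cdot> p) (g \<cdot> p) \<and>
     (\<forall>X \<in> Obj C. \<forall>q \<in> hom C X (dom1 C f). \<forall>\<phi> \<in> cells C (f \<cdot> q) (g \<cdot> q).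
        (\<exists>!u. u \<in> hom C X P \<and> p \<cdot> u = q \<and> whisker_right C \<theta> u = \<phi>)) \<and>
     (\<forall>X \<in> Obj C. \<forall>u \<in> hom C X P. \<forall>v \<in> hom C X P. \<forall>\<alpha> \<in> cells C (p \<cdot> u) (p \<cdot> v).
        whisker_left C g \<alpha> \<bullet> whisker_right C \<theta> u = whisker_right C \<theta> v \<bullet> whisker_left C f \<alpha> \<longrightarrow>
        (\<exists>!\<beta>. \<beta> \<in> cells C u v \<and> whisker_left C p \<beta> = \<alpha>))"

definition is_equifier :: "'c \<Rightarrow> 'c \<Rightarrow> 'o \<Rightarrow> 'm \<Rightarrow> bool" where
  "is_equifier \<phi> \<psi> P p \<longleftrightarrow> p \<in> hom C P (dom1 C (dom2 C \<phi>)) \<and>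
     whisker_right C \<phi> p = whisker_right C \<psi> p \<and>
     (\<forall>X \<in> Obj C. \<forall>q \<in> hom C X (dom1 C (dom2 C \<phi>)).
        whisker_right C \<phi> q = whisker_right C \<psi> q \<longrightarrow> (\<exists>!u. u \<in> hom C X P \<and> p \<cdot> u = q)) \<and>
     (\<forall>X \<in> Obj C. \<forall>u \<in> hom C X P. \<forall>v \<in> hom C X P. \<forall>\<alpha> \<in> cells C (p \<cdot> u) (p \<cdot> v).
        (\<exists>!\<beta>. \<beta> \<in> cells C u v \<and> whisker_left C p \<beta> = \<alpha>))"

definition has_products :: "'i itself \<Rightarrow> bool" where
  "has_products _ \<longleftrightarrow> (\<forall>(J :: 'i set) A. (\<forall>j \<in> J. A j \<in> Obj C) \<longrightarrow> (\<exists>P p. is_product J A P p))"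

definition has_inserters :: bool where
  "has_inserters \<longleftrightarrow> (\<forall>A \<in> Obj C. \<forall>B \<in> Obj C. \<forall>f \<in> hom C A B. \<forall>g \<in> hom C A B.
     \<exists>P p \<theta>. is_inserter f g P p \<theta>)"

definition has_equifiers :: bool where
  "has_equifiers \<longleftrightarrow> (\<forall>A \<in> Obj C. \<forall>B \<in> Obj C. \<forall>f \<in> hom C A B. \<forall>g \<in> hom C A B.
     \<forall>\<phi> \<in> cells C f g. \<forall>\<psi> \<in> cells C f g. \<exists>P p. is_equifier \<phi> \<psi> P p)"

definition has_pie_limits :: "'i itself \<Rightarrow> bool" where
  "has_pie_limits I \<longleftrightarrow> has_products I \<and> has_inserters \<and> has_equifiers"

end


section \<open>\<open>\<F>\<close>-categories\<close>

record ('o, 'mt, 'ct, 'm, 'c) f_cat =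
  tight :: "('o, 'mt, 'ct) two_cat"
  loose :: "('o, 'm, 'c) two_cat"
  incl :: "('o, 'mt, 'ct, 'o, 'm, 'c) two_fun"

locale f_category = two_functor "tight A" "loose A" "incl A"
  for A :: "('o, 'mt, 'ct, 'm, 'c) f_cat" +
  assumes same_obj: "Obj (tight A) = Obj (loose A)"
    and incl_obj: "x \<in> Obj (tight A) \<Longrightarrow> on_obj (incl A) x = x"
    and faithful: "inj_on (on_mor (incl A)) (Mor (tight A))"
    and locally_fully_faithful: "\<lbrakk>f \<in> hom (tight A) x y; g \<in> hom (tight A) x y\<rbrakk> \<Longrightarrow>
          bij_betw (on_cell (incl A)) (cells (tight A) f g)
            (cells (loose A) (on_mor (incl A) f) (on_mor (incl A) g))"

definition tight_mors :: "('o, 'mt, 'ct, 'm, 'c) f_cat \<Rightarrow> 'm set" where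
  "tight_mors A = on_mor (incl A) ` Mor (tight A)"

definition all_tight :: "('o, 'm, 'c) two_cat \<Rightarrow> ('o, 'm, 'c, 'm, 'c) f_cat" where
  "all_tight C = \<lparr>tight = C, loose = C, incl = id_fun\<rparr>"

locale f_functor = A: f_category A + B: f_category B + two_functor "loose A" "loose B" F
  for A :: "('o1, 'mt1, 'ct1, 'm1, 'c1) f_cat" and B :: "('o2, 'mt2, 'ct2, 'm2, 'c2) f_cat"
    and F :: "('o1, 'm1, 'c1, 'o2, 'm2, 'c2) two_fun" +
  assumes preserves_tight: "f \<in> tight_mors A \<Longrightarrow> on_mor F f \<in> tight_mors B"

definition f_iso :: "('o1, 'mt1, 'ct1, 'm1, 'c1) f_cat \<Rightarrow> ('o2, 'mt2, 'ct2, 'm2, 'c2) f_cat \<Rightarrow>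
    ('o1, 'm1, 'c1, 'o2, 'm2, 'c2) two_fun \<Rightarrow> bool" where
  "f_iso A B E \<longleftrightarrow> f_functor A B E \<and> (\<exists>G. f_functor B A G \<and>
     fun_eq_on (loose A) (comp_fun G E) id_fun \<and> fun_eq_on (loose B) (comp_fun E G) id_fun)"

definition f_iso_over :: "('o3, 'mt3, 'ct3, 'm3, 'c3) f_cat \<Rightarrow>
    ('o1, 'mt1, 'ct1, 'm1, 'c1) f_cat \<Rightarrow> ('o1, 'm1, 'c1, 'o3, 'm3, 'c3) two_fun \<Rightarrow>
    ('o2, 'mt2, 'ct2, 'm2, 'c2) f_cat \<Rightarrow> ('o2, 'm2, 'c2, 'o3, 'm3, 'c3) two_fun \<Rightarrow>
    ('o1, 'm1, 'c1, 'o2, 'm2, 'c2) two_fun \<Rightarrow> bool" where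
  "f_iso_over K A P B Q E \<longleftrightarrow> f_functor A K P \<and> f_functor B K Q \<and> f_iso A B E \<and>
     fun_eq_on (loose A) (comp_fun Q E) P"

datatype weakness = Strict | Pseudo | Lax | Colax


section \<open>Monoids in a monoidal 2-category\<close>

text \<open>
  The monoidal structure is not assumed strict; the associativity and unit isomorphisms, which are
  often suppressed, are inserted explicitly.
\<close>

record ('o, 'm, 'c) monoidal_structure =
  tensor :: "('o \<times> 'o, 'm \<times> 'm, 'c \<times> 'c, 'o, 'm, 'c) two_fun"
  unit_obj :: 'o
  assoc_iso :: "'o \<Rightarrow> 'o \<Rightarrow> 'o \<Rightarrow> 'm"
  lunit_iso :: "'o \<Rightarrow> 'm"
  runit_iso :: "'o \<Rightarrow> 'm"

locale monoidal_notation =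
  fixes M :: "('o, 'm, 'c) monoidal_structure"
begin

abbreviation tensor_obj (infixr "\<boxtimes>" 80) where "x \<boxtimes> y \<equiv> on_obj (tensor M) (x, y)"
abbreviation tensor_mor (infixr "\<otimes>" 80) where "f \<otimes> g \<equiv> on_mor (tensor M) (f, g)"
abbreviation tensor_cell (infixr "\<circledast>" 80) where "\<alpha> \<circledast> \<beta> \<equiv> on_cell (tensor M) (\<alpha>, \<beta>)"
abbreviation unit_object ("\<I>") where "\<I> \<equiv> unit_obj M"
abbreviation associator ("\<a>") where "\<a> \<equiv> assoc_iso M"
abbreviation left_unitor ("\<l>") where "\<l> \<equiv> lunit_iso M"
abbreviation right_unitor ("\<r>") where "\<r> \<equiv> runit_iso M"

end

record ('o, 'm) mon =
  mcarr :: 'o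
  mmult :: 'm
  munit :: 'm

record ('o, 'm, 'c) mon_mor =
  mdom :: "('o, 'm) mon"
  mcod :: "('o, 'm) mon"
  mmap :: 'm
  mbar :: 'c
  mzero :: 'c

record ('o, 'm, 'c) mon_cell =
  mdom2 :: "('o, 'm, 'c) mon_mor"
  mcod2 :: "('o, 'm, 'c) mon_mor"
  mcell :: 'c

locale monoidal_two_category =
  two_category C + monoidal_notation M + ten: two_functor "prod_cat C C" C "tensor M"
  for C :: "('o, 'm, 'c) two_cat" (structure) and M :: "('o, 'm, 'c) monoidal_structure" +
  assumes unit_in: "\<I> \<in> Obj C"
    and assoc_hom: "\<lbrakk>x \<in> Obj C; y \<in> Obj C; z \<in> Obj C\<rbrakk> \<Longrightarrow>
          \<a> x y z \<in> hom C ((x \<boxtimes> y) \<boxtimes> z) (x \<boxtimes> (y \<boxtimes> z))"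
    and assoc_iso1: "\<lbrakk>x \<in> Obj C; y \<in> Obj C; z \<in> Obj C\<rbrakk> \<Longrightarrow> iso1 C (\<a> x y z)"
    and lunit_hom: "x \<in> Obj C \<Longrightarrow> \<l> x \<in> hom C (\<I> \<boxtimes> x) x"
    and lunit_iso1: "x \<in> Obj C \<Longrightarrow> iso1 C (\<l> x)"
    and runit_hom: "x \<in> Obj C \<Longrightarrow> \<r> x \<in> hom C (x \<boxtimes> \<I>) x"
    and runit_iso1: "x \<in> Obj C \<Longrightarrow> iso1 C (\<r> x)"
    and assoc_natural1: "\<lbrakk>f \<in> hom C x x'; g \<in> hom C y y'; h \<in> hom C z z'\<rbrakk> \<Longrightarrow>
          (f \<otimes> (g \<otimes> h)) \<cdot> \<a> x y z = \<a> x' y' z' \<cdot> ((f \<otimes> g) \<otimes> h)"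
    and assoc_natural2: "\<lbrakk>f \<in> hom C x x'; g \<in> hom C y y'; h \<in> hom C z z';
          \<alpha> \<in> cells C f f'; \<beta> \<in> cells C g g'; \<gamma> \<in> cells C h h'\<rbrakk> \<Longrightarrow>
          (\<alpha> \<circledast> (\<beta> \<circledast> \<gamma>)) \<star> \<iota> (\<a> x y z) = \<iota> (\<a> x' y' z') \<star> ((\<alpha> \<circledast> \<beta>) \<circledast> \<gamma>)"
    and lunit_natural1: "f \<in> hom C x y \<Longrightarrow> f \<cdot> \<l> x = \<l> y \<cdot> (\<one> \<I> \<otimes> f)"
    and lunit_natural2: "\<lbrakk>f \<in> hom C x y; \<alpha> \<in> cells C f f'\<rbrakk> \<Longrightarrow>
          \<alpha> \<star> \<iota> (\<l> x) = \<iota> (\<l> y) \<star> (\<iota> (\<one> \<I>) \<circledast> \<alpha>)"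
    and runit_natural1: "f \<in> hom C x y \<Longrightarrow> f \<cdot> \<r> x = \<r> y \<cdot> (f \<otimes> \<one> \<I>)"
    and runit_natural2: "\<lbrakk>f \<in> hom C x y; \<alpha> \<in> cells C f f'\<rbrakk> \<Longrightarrow>
          \<alpha> \<star> \<iota> (\<r> x) = \<iota> (\<r> y) \<star> (\<alpha> \<circledast> \<iota> (\<one> \<I>))"
    and pentagon: "\<lbrakk>w \<in> Obj C; x \<in> Obj C; y \<in> Obj C; z \<in> Obj C\<rbrakk> \<Longrightarrow>
          \<a> w x (y \<boxtimes> z) \<cdot> \<a> (w \<boxtimes> x) y z =
          (\<one> w \<otimes> \<a> x y z) \<cdot> \<a> w (x \<boxtimes> y) z \<cdot> (\<a> w x y \<otimes> \<one> z)"
    and triangle: "\<lbrakk>x \<in> Obj C; y \<in> Obj C\<rbrakk> \<Longrightarrow>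
          (\<one> x \<otimes> \<l> y) \<cdot> \<a> x \<I> y = \<r> x \<otimes> \<one> y"
begin

definition is_monoid :: "('o, 'm) mon \<Rightarrow> bool" where
  "is_monoid X \<longleftrightarrow> (let x = mcarr X; m = mmult X; i = munit X in
     x \<in> Obj C \<and> m \<in> hom C (x \<boxtimes> x) x \<and> i \<in> hom C \<I> x \<and>
     m \<cdot> (m \<otimes> \<one> x) = m \<cdot> (\<one> x \<otimes> m) \<cdot> \<a> x x x \<and>
     m \<cdot> (i \<otimes> \<one> x) = \<l> x \<and>
     m \<cdot> (\<one> x \<otimes> i) = \<r> x)"

text \<open>
  In the associativity axiom both sides are 2-cells between 1-cells out of \<open>(x \<boxtimes> x) \<boxtimes> x\<close>;
  the unit axioms live on \<open>x \<boxtimes> \<I>\<close> and \<open>\<I> \<boxtimes> x\<close>, where the identity 2-cell on \<open>f\<close> becomes the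
  identity 2-cell on \<open>f \<cdot> \<r> x\<close> and on \<open>f \<cdot> \<l> x\<close>, respectively.
\<close>

definition is_lax_mor :: "('o, 'm, 'c) mon_mor \<Rightarrow> bool" where
  "is_lax_mor \<phi> \<longleftrightarrow> is_monoid (mdom \<phi>) \<and> is_monoid (mcod \<phi>) \<and>
     (let x = mcarr (mdom \<phi>); m = mmult (mdom \<phi>); i = munit (mdom \<phi>);
          y = mcarr (mcod \<phi>); n = mmult (mcod \<phi>); j = munit (mcod \<phi>);
          f = mmap \<phi>; fb = mbar \<phi>; f0 = mzero \<phi> in
      f \<in> hom C x y \<and>
      fb \<in> cells C (n \<cdot> (f \<otimes> f)) (f \<cdot> m) \<and>
      f0 \<in> cells C j (f \<cdot> i) \<and>
      ((fb \<star> \<iota> (\<one> x \<otimes> m)) \<bullet> (\<iota> (n \<cdot> (f \<otimes> \<one> y)) \<star> (\<iota> (\<one> x) \<circledast> fb))) \<star> \<iota> (\<a> x x x)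
        = (fb \<star> \<iota> (m \<otimes> \<one> x)) \<bullet> (\<iota> n \<star> (fb \<circledast> \<iota> (\<one> y)) \<star> \<iota> ((\<one> x \<otimes> \<one> x) \<otimes> f)) \<and>
      (fb \<star> \<iota> (\<one> x \<otimes> i)) \<bullet> (\<iota> (n \<cdot> (f \<otimes> \<one> y)) \<star> (\<iota> (\<one> x) \<circledast> f0)) = \<iota> (f \<cdot> \<r> x) \<and>
      (fb \<star> \<iota> (i \<otimes> \<one> x)) \<bullet> (\<iota> n \<star> (f0 \<circledast> \<iota> (\<one> y)) \<star> \<iota> (\<one> \<I> \<otimes> f)) = \<iota> (f \<cdot> \<l> x))"

definition is_colax_mor :: "('o, 'm, 'c) mon_mor \<Rightarrow> bool" where
  "is_colax_mor \<phi> \<longleftrightarrow> is_monoid (mdom \<phi>) \<and> is_monoid (mcod \<phi>) \<and>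
     (let x = mcarr (mdom \<phi>); m = mmult (mdom \<phi>); i = munit (mdom \<phi>);
          y = mcarr (mcod \<phi>); n = mmult (mcod \<phi>); j = munit (mcod \<phi>);
          f = mmap \<phi>; fb = mbar \<phi>; f0 = mzero \<phi> in
      f \<in> hom C x y \<and>
      fb \<in> cells C (f \<cdot> m) (n \<cdot> (f \<otimes> f)) \<and>
      f0 \<in> cells C (f \<cdot> i) j \<and>
      ((\<iota> (n \<cdot> (f \<otimes> \<one> y)) \<star> (\<iota> (\<one> x) \<circledast> fb)) \<bullet> (fb \<star> \<iota> (\<one> x \<otimes> m))) \<star> \<iota> (\<a> x x x)
        = (\<iota> n \<star> (fb \<circledast> \<iota> (\<one> y)) \<star> \<iota> ((\<one> x \<otimes> \<one> x) \<otimes> f)) \<bullet> (fb \<star> \<iota> (m \<otimes> \<one> x)) \<and>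
      (\<iota> (n \<cdot> (f \<otimes> \<one> y)) \<star> (\<iota> (\<one> x) \<circledast> f0)) \<bullet> (fb \<star> \<iota> (\<one> x \<otimes> i)) = \<iota> (f \<cdot> \<r> x) \<and>
      (\<iota> n \<star> (f0 \<circledast> \<iota> (\<one> y)) \<star> \<iota> (\<one> \<I> \<otimes> f)) \<bullet> (fb \<star> \<iota> (i \<otimes> \<one> x)) = \<iota> (f \<cdot> \<l> x))"

fun is_mor :: "weakness \<Rightarrow> ('o, 'm, 'c) mon_mor \<Rightarrow> bool" where
  "is_mor Strict \<phi> \<longleftrightarrow> is_lax_mor \<phi> \<and> identity2 C (mbar \<phi>) \<and> identity2 C (mzero \<phi>)"
| "is_mor Pseudo \<phi> \<longleftrightarrow> is_lax_mor \<phi> \<and> iso2 C (mbar \<phi>) \<and> iso2 C (mzero \<phi>)"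
| "is_mor Lax \<phi> \<longleftrightarrow> is_lax_mor \<phi>"
| "is_mor Colax \<phi> \<longleftrightarrow> is_colax_mor \<phi>"

definition is_cell :: "weakness \<Rightarrow> ('o, 'm, 'c) mon_cell \<Rightarrow> bool" where
  "is_cell w \<theta> \<longleftrightarrow>
     (let \<phi> = mdom2 \<theta>; \<psi> = mcod2 \<theta>; \<alpha> = mcell \<theta>;
          m = mmult (mdom \<phi>); i = munit (mdom \<phi>); n = mmult (mcod \<phi>) in
      is_mor w \<phi> \<and> is_mor w \<psi> \<and> mdom \<psi> = mdom \<phi> \<and> mcod \<psi> = mcod \<phi> \<and>
      \<alpha> \<in> cells C (mmap \<phi>) (mmap \<psi>) \<and>
      (if w = Colax
       then (\<iota> n \<star> (\<alpha> \<circledast> \<alpha>)) \<bullet> mbar \<phi> = mbar \<psi> \<bullet> (\<alpha> \<star> \<iota> m) \<and> mzero \<phi> = mzero \<psi> \<bullet> (\<alpha> \<star> \<iota> i)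
       else (\<alpha> \<star> \<iota> m) \<bullet> mbar \<phi> = mbar \<psi> \<bullet> (\<iota> n \<star> (\<alpha> \<circledast> \<alpha>)) \<and> (\<alpha> \<star> \<iota> i) \<bullet> mzero \<phi> = mzero \<psi>))"

definition mon_id :: "('o, 'm) mon \<Rightarrow> ('o, 'm, 'c) mon_mor" where
  "mon_id X = \<lparr>mdom = X, mcod = X, mmap = \<one> (mcarr X), mbar = \<iota> (mmult X), mzero = \<iota> (munit X)\<rparr>"

definition mon_comp :: "weakness \<Rightarrow> ('o, 'm, 'c) mon_mor \<Rightarrow> ('o, 'm, 'c) mon_mor \<Rightarrow>
    ('o, 'm, 'c) mon_mor" where
  "mon_comp w \<psi> \<phi> =
     (let f = mmap \<phi>; g = mmap \<psi>;
          bar1 = mbar \<psi> \<star> \<iota> (f \<otimes> f); bar2 = \<iota> g \<star> mbar \<phi>;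
          zero1 = mzero \<psi>; zero2 = \<iota> g \<star> mzero \<phi> in
      \<lparr>mdom = mdom \<phi>, mcod = mcod \<psi>, mmap = g \<cdot> f,
       mbar = (if w = Colax then bar1 \<bullet> bar2 else bar2 \<bullet> bar1),
       mzero = (if w = Colax then zero1 \<bullet> zero2 else zero2 \<bullet> zero1)\<rparr>)"

definition Mon :: "weakness \<Rightarrow>
    (('o, 'm) mon, ('o, 'm, 'c) mon_mor, ('o, 'm, 'c) mon_cell) two_cat" where
  "Mon w = \<lparr>
     Obj = Collect is_monoid, Mor = Collect (is_mor w), Cell = Collect (is_cell w),
     dom1 = mdom, cod1 = mcod, dom2 = mdom2, cod2 = mcod2,
     id1 = mon_id,
     id2 = (\<lambda>\<phi>. \<lparr>mdom2 = \<phi>, mcod2 = \<phi>, mcell = \<iota> (mmap \<phi>)\<rparr>),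
     comp1 = mon_comp w,
     vcomp = (\<lambda>\<theta>' \<theta>. \<lparr>mdom2 = mdom2 \<theta>, mcod2 = mcod2 \<theta>', mcell = mcell \<theta>' \<bullet> mcell \<theta>\<rparr>),
     hcomp = (\<lambda>\<theta>' \<theta>. \<lparr>mdom2 = mon_comp w (mdom2 \<theta>') (mdom2 \<theta>),
                       mcod2 = mon_comp w (mcod2 \<theta>') (mcod2 \<theta>),
                       mcell = mcell \<theta>' \<star> mcell \<theta>\<rparr>)\<rparr>"

text \<open>
  Strict morphisms have identities as structure 2-cells, so they are literally \<open>w\<close>-morphisms for
  every \<open>w\<close> and the inclusion acts as the identity on data.
\<close>

definition MonF :: "weakness \<Rightarrow>
    (('o, 'm) mon, ('o, 'm, 'c) mon_mor, ('o, 'm, 'c) mon_cell,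
     ('o, 'm, 'c) mon_mor, ('o, 'm, 'c) mon_cell) f_cat" where
  "MonF w = \<lparr>tight = Mon Strict, loose = Mon w, incl = id_fun\<rparr>"

definition mon_forget ::
    "(('o, 'm) mon, ('o, 'm, 'c) mon_mor, ('o, 'm, 'c) mon_cell, 'o, 'm, 'c) two_fun" where
  "mon_forget = \<lparr>on_obj = mcarr, on_mor = mmap, on_cell = mcell\<rparr>"

text \<open>The inclusion of \<open>Mon Pseudo\<close> in \<open>Mon w\<close> inverts the structure 2-cells when \<open>w\<close> is \<open>Colax\<close>.\<close>

definition mon_incl_mor :: "weakness \<Rightarrow> ('o, 'm, 'c) mon_mor \<Rightarrow> ('o, 'm, 'c) mon_mor" where
  "mon_incl_mor w \<phi> = (if w = Colax
     then \<phi>\<lparr>mbar := inv2 C (mbar \<phi>), mzero := inv2 C (mzero \<phi>)\<rparr> else \<phi>)"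

definition mon_incl :: "weakness \<Rightarrow>
    (('o, 'm) mon, ('o, 'm, 'c) mon_mor, ('o, 'm, 'c) mon_cell,
     ('o, 'm) mon, ('o, 'm, 'c) mon_mor, ('o, 'm, 'c) mon_cell) two_fun" where
  "mon_incl w = \<lparr>on_obj = (\<lambda>X. X), on_mor = mon_incl_mor w,
     on_cell = (\<lambda>\<theta>. \<lparr>mdom2 = mon_incl_mor w (mdom2 \<theta>), mcod2 = mon_incl_mor w (mcod2 \<theta>),
                      mcell = mcell \<theta>\<rparr>)\<rparr>"

end


section \<open>Algebras for a 2-monad\<close>

record ('o, 'm, 'c) monad =
  endo :: "('o, 'm, 'c, 'o, 'm, 'c) two_fun"
  monad_mult :: "'o \<Rightarrow> 'm"
  monad_unit :: "'o \<Rightarrow> 'm"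

record ('o, 'm) alg =
  acarr :: 'o
  aact :: 'm

record ('o, 'm, 'c) alg_mor =
  adom :: "('o, 'm) alg"
  acod :: "('o, 'm) alg"
  amap :: 'm
  abar :: 'c

record ('o, 'm, 'c) alg_cell =
  adom2 :: "('o, 'm, 'c) alg_mor"
  acod2 :: "('o, 'm, 'c) alg_mor"
  acell :: 'c

locale monad_notation =
  fixes T :: "('o, 'm, 'c) monad"
begin

abbreviation T_obj ("T\<^sub>0") where "T\<^sub>0 \<equiv> on_obj (endo T)"
abbreviation T_mor ("T\<^sub>1") where "T\<^sub>1 \<equiv> on_mor (endo T)"
abbreviation T_cell ("T\<^sub>2") where "T\<^sub>2 \<equiv> on_cell (endo T)"
abbreviation T_mult ("\<mu>") where "\<mu> \<equiv> monad_mult T"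
abbreviation T_unit ("\<eta>") where "\<eta> \<equiv> monad_unit T"

end

locale two_monad =
  two_category C + monad_notation T +
  mult: two_natural C C "comp_fun (endo T) (endo T)" "endo T" "monad_mult T" +
  unit: two_natural C C id_fun "endo T" "monad_unit T"
  for C :: "('o, 'm, 'c) two_cat" (structure) and T :: "('o, 'm, 'c) monad" +
  assumes mult_assoc: "x \<in> Obj C \<Longrightarrow> \<mu> x \<cdot> T\<^sub>1 (\<mu> x) = \<mu> x \<cdot> \<mu> (T\<^sub>0 x)"
    and mult_unit_right: "x \<in> Obj C \<Longrightarrow> \<mu> x \<cdot> T\<^sub>1 (\<eta> x) = \<one> (T\<^sub>0 x)"
    and mult_unit_left: "x \<in> Obj C \<Longrightarrow> \<mu> x \<cdot> \<eta> (T\<^sub>0 x) = \<one> (T\<^sub>0 x)"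
begin

definition is_alg :: "('o, 'm) alg \<Rightarrow> bool" where
  "is_alg A \<longleftrightarrow> (let x = acarr A; a = aact A in
     x \<in> Obj C \<and> a \<in> hom C (T\<^sub>0 x) x \<and> a \<cdot> T\<^sub>1 a = a \<cdot> \<mu> x \<and> a \<cdot> \<eta> x = \<one> x)"

definition is_lax_mor :: "('o, 'm, 'c) alg_mor \<Rightarrow> bool" where
  "is_lax_mor \<phi> \<longleftrightarrow> is_alg (adom \<phi>) \<and> is_alg (acod \<phi>) \<and>
     (let x = acarr (adom \<phi>); a = aact (adom \<phi>); y = acarr (acod \<phi>); b = aact (acod \<phi>);
          f = amap \<phi>; fb = abar \<phi> in
      f \<in> hom C x y \<and>
      fb \<in> cells C (b \<cdot> T\<^sub>1 f) (f \<cdot> a) \<and>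
      fb \<star> \<iota> (\<mu> x) = (fb \<star> \<iota> (T\<^sub>1 a)) \<bullet> (\<iota> b \<star> T\<^sub>2 fb) \<and>
      fb \<star> \<iota> (\<eta> x) = \<iota> f)"

definition is_colax_mor :: "('o, 'm, 'c) alg_mor \<Rightarrow> bool" where
  "is_colax_mor \<phi> \<longleftrightarrow> is_alg (adom \<phi>) \<and> is_alg (acod \<phi>) \<and>
     (let x = acarr (adom \<phi>); a = aact (adom \<phi>); y = acarr (acod \<phi>); b = aact (acod \<phi>);
          f = amap \<phi>; fb = abar \<phi> in
      f \<in> hom C x y \<and>
      fb \<in> cells C (f \<cdot> a) (b \<cdot> T\<^sub>1 f) \<and>
      fb \<star> \<iota> (\<mu> x) = (\<iota> b \<star> T\<^sub>2 fb) \<bullet> (fb \<star> \<iota> (T\<^sub>1 a)) \<and>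
      fb \<star> \<iota> (\<eta> x) = \<iota> f)"

fun is_mor :: "weakness \<Rightarrow> ('o, 'm, 'c) alg_mor \<Rightarrow> bool" where
  "is_mor Strict \<phi> \<longleftrightarrow> is_lax_mor \<phi> \<and> identity2 C (abar \<phi>)"
| "is_mor Pseudo \<phi> \<longleftrightarrow> is_lax_mor \<phi> \<and> iso2 C (abar \<phi>)"
| "is_mor Lax \<phi> \<longleftrightarrow> is_lax_mor \<phi>"
| "is_mor Colax \<phi> \<longleftrightarrow> is_colax_mor \<phi>"

definition is_cell :: "weakness \<Rightarrow> ('o, 'm, 'c) alg_cell \<Rightarrow> bool" where
  "is_cell w \<theta> \<longleftrightarrow>
     (let \<phi> = adom2 \<theta>; \<psi> = acod2 \<theta>; \<alpha> = acell \<theta>; a = aact (adom \<phi>); b = aact (acod \<phi>) in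
      is_mor w \<phi> \<and> is_mor w \<psi> \<and> adom \<psi> = adom \<phi> \<and> acod \<psi> = acod \<phi> \<and>
      \<alpha> \<in> cells C (amap \<phi>) (amap \<psi>) \<and>
      (if w = Colax then (\<iota> b \<star> T\<^sub>2 \<alpha>) \<bullet> abar \<phi> = abar \<psi> \<bullet> (\<alpha> \<star> \<iota> a)
       else (\<alpha> \<star> \<iota> a) \<bullet> abar \<phi> = abar \<psi> \<bullet> (\<iota> b \<star> T\<^sub>2 \<alpha>)))"

definition alg_id :: "('o, 'm) alg \<Rightarrow> ('o, 'm, 'c) alg_mor" where
  "alg_id A = \<lparr>adom = A, acod = A, amap = \<one> (acarr A), abar = \<iota> (aact A)\<rparr>"

definition alg_comp :: "weakness \<Rightarrow> ('o, 'm, 'c) alg_mor \<Rightarrow> ('o, 'm, 'c) alg_mor \<Rightarrow>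
    ('o, 'm, 'c) alg_mor" where
  "alg_comp w \<psi> \<phi> =
     (let f = amap \<phi>; g = amap \<psi>; bar1 = abar \<psi> \<star> \<iota> (T\<^sub>1 f); bar2 = \<iota> g \<star> abar \<phi> in
      \<lparr>adom = adom \<phi>, acod = acod \<psi>, amap = g \<cdot> f,
       abar = (if w = Colax then bar1 \<bullet> bar2 else bar2 \<bullet> bar1)\<rparr>)"

definition Alg :: "weakness \<Rightarrow>
    (('o, 'm) alg, ('o, 'm, 'c) alg_mor, ('o, 'm, 'c) alg_cell) two_cat" where
  "Alg w = \<lparr>
     Obj = Collect is_alg, Mor = Collect (is_mor w), Cell = Collect (is_cell w),
     dom1 = adom, cod1 = acod, dom2 = adom2, cod2 = acod2,
     id1 = alg_id,
     id2 = (\<lambda>\<phi>. \<lparr>adom2 = \<phi>, acod2 = \<phi>, acell = \<iota> (amap \<phi>)\<rparr>),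
     comp1 = alg_comp w,
     vcomp = (\<lambda>\<theta>' \<theta>. \<lparr>adom2 = adom2 \<theta>, acod2 = acod2 \<theta>', acell = acell \<theta>' \<bullet> acell \<theta>\<rparr>),
     hcomp = (\<lambda>\<theta>' \<theta>. \<lparr>adom2 = alg_comp w (adom2 \<theta>') (adom2 \<theta>),
                       acod2 = alg_comp w (acod2 \<theta>') (acod2 \<theta>),
                       acell = acell \<theta>' \<star> acell \<theta>\<rparr>)\<rparr>"

definition AlgF :: "weakness \<Rightarrow>
    (('o, 'm) alg, ('o, 'm, 'c) alg_mor, ('o, 'm, 'c) alg_cell,
     ('o, 'm, 'c) alg_mor, ('o, 'm, 'c) alg_cell) f_cat" where
  "AlgF w = \<lparr>tight = Alg Strict, loose = Alg w, incl = id_fun\<rparr>"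

definition alg_forget ::
    "(('o, 'm) alg, ('o, 'm, 'c) alg_mor, ('o, 'm, 'c) alg_cell, 'o, 'm, 'c) two_fun" where
  "alg_forget = \<lparr>on_obj = acarr, on_mor = amap, on_cell = acell\<rparr>"

definition alg_incl_mor :: "weakness \<Rightarrow> ('o, 'm, 'c) alg_mor \<Rightarrow> ('o, 'm, 'c) alg_mor" where
  "alg_incl_mor w \<phi> = (if w = Colax then \<phi>\<lparr>abar := inv2 C (abar \<phi>)\<rparr> else \<phi>)"

definition alg_incl :: "weakness \<Rightarrow>
    (('o, 'm) alg, ('o, 'm, 'c) alg_mor, ('o, 'm, 'c) alg_cell,
     ('o, 'm) alg, ('o, 'm, 'c) alg_mor, ('o, 'm, 'c) alg_cell) two_fun" where
  "alg_incl w = \<lparr>on_obj = (\<lambda>A. A), on_mor = alg_incl_mor w,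
     on_cell = (\<lambda>\<theta>. \<lparr>adom2 = alg_incl_mor w (adom2 \<theta>), acod2 = alg_incl_mor w (acod2 \<theta>),
                      acell = acell \<theta>\<rparr>)\<rparr>"

end

definition induced_monad :: "('o1, 'm1, 'c1, 'o2, 'm2, 'c2) two_fun \<Rightarrow>
    ('o2, 'm2, 'c2, 'o1, 'm1, 'c1) two_fun \<Rightarrow> ('o1 \<Rightarrow> 'm1) \<Rightarrow> ('o2 \<Rightarrow> 'm2) \<Rightarrow>
    ('o1, 'm1, 'c1) monad" where
  "induced_monad F U \<eta> \<epsilon> = \<lparr>
     endo = comp_fun U F, monad_mult = (\<lambda>x. on_mor U (\<epsilon> (on_obj F x))), monad_unit = \<eta>\<rparr>"

end

theory Submission
  imports Defs
begin

text \<open>The idea is to read a lax morphism \<open>f : X \<rightarrow> Y\<close> of monoids as a multiplication on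
  generalised elements. An element of \<open>f\<close> over \<open>z\<close> consists of 1-cells
  \<open>a : z \<rightarrow> X\<close> and \<open>b : z \<rightarrow> Y\<close> and a 2-cell \<open>b \<Rightarrow> f a\<close>. The
  structure cells of \<open>f\<close> multiply elements over \<open>z\<close> and \<open>z'\<close> to an element over
  \<open>z \<boxtimes> z'\<close>, and the axioms of a lax morphism say that this multiplication is associative
  and unital. Elements are represented by the comma object of \<open>f\<close>, so by Yoneda the comma
  object is a monoid (\<open>representing_monoid\<close>), and the strict homomorphisms into it from a
  monoid \<open>Z\<close> are the elements over \<open>Z\<close> that are compatible with the multiplications, here
  called homomorphic. If \<open>Z\<close> is free on \<open>z\<close>, then every element over \<open>z\<close> extends
  uniquely to a homomorphic element over \<open>Z\<close> (\<open>free_elements\<close>).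

  From monoids to algebras, the generic element \<open>(1, f, 1)\<close> over \<open>X\<close> extends to a
  homomorphic element over \<open>T X\<close>. Its 1-cells are the action of \<open>X\<close> and the action of
  \<open>Y\<close> after \<open>T f\<close>, and its 2-cell is the structure cell of a lax algebra morphism.
  The unit axiom says that it extends the generic element. The two sides of the multiplication
  axiom are homomorphic elements over the free monoid on \<open>T X\<close> that agree on the generators,
  so they are equal by uniqueness (\<open>lax_mor_exists\<close>). From algebras to monoids, the structure is
  restricted to the words of length two and zero in the free monoid. This is given by explicit
  formulas (\<open>monoid_of\<close>, \<open>mor_of\<close>), and the multiplication law of an algebra makes
  the given structure cell homomorphic for the restricted data (\<open>mor_of_homomorphic\<close>);
  the monoid axioms then descend from the free monoid (\<open>mor_of_lax\<close>). On objects the same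
  computation is the classical argument that an algebra is an absolute coequaliser of free ones
  (\<open>alg_mult\<close>).

  All weaknesses are treated at once. Restricting the 2-cells of elements to the invertible
  ones or to the identities gives the pseudo and the strict case, with comma objects replaced by
  iso-comma objects or by the domain of \<open>f\<close>, and the colax case is the lax case in the
  2-category with reversed 2-cells. Comma objects come from products and inserters, and
  iso-comma objects from one more inserter and two equifiers.

  The formulas from algebras to monoids strictly preserve every operation, and they are bijective
  by the above. The 2-category axioms for monoids therefore follow from those for algebras by
  transport, and the required isomorphism is the inverse of this passage
  (\<open>to_mon_iso\<close>, \<open>f_iso_to_alg\<close>). It is natural in the weakness because whiskering
  preserves inverses of 2-cells (\<open>mor_of_incl\<close>).\<close>

section \<open>Computing in a 2-category\<close>

text \<open>The rules \<open>ty\<close> phrase membership in carriers, domains, codomains and the axioms as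
  conditional equations. The simplifier can then discharge composability conditions while it
  rewrites, without guessing intermediate objects. Composites are associated to the right and
  whiskerings are distributed over vertical composites.\<close>

named_theorems ty

context two_category
begin

lemma hom_iff: "f \<in> hom C x y \<longleftrightarrow> f \<in> Mor C \<and> dom1 C f = x \<and> cod1 C f = y"
  by (simp add: hom_def)

lemma cells_iff: "\<alpha> \<in> cells C f g \<longleftrightarrow> \<alpha> \<in> Cell C \<and> dom2 C \<alpha> = f \<and> cod2 C \<alpha> = g"
  by (simp add: cells_def)

lemma obj_ty [ty]: "f \<in> Mor C \<Longrightarrow> dom1 C f \<in> Obj C" "f \<in> Mor C \<Longrightarrow> cod1 C f \<in> Obj C"
  by (simp_all add: dom1_in cod1_in)

lemma mor_ty [ty]:
  "\<alpha> \<in> Cell C \<Longrightarrow> dom2 C \<alpha> \<in> Mor C" "\<alpha> \<in> Cell C \<Longrightarrow> cod2 C \<alpha> \<in> Mor C"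
  "\<alpha> \<in> Cell C \<Longrightarrow> dom1 C (cod2 C \<alpha>) = dom1 C (dom2 C \<alpha>)"
  "\<alpha> \<in> Cell C \<Longrightarrow> cod1 C (cod2 C \<alpha>) = cod1 C (dom2 C \<alpha>)"
  by (simp_all add: dom2_in cod2_in globular_dom globular_cod)

lemma id1_ty [ty]:
  assumes "x \<in> Obj C"
  shows "\<one> x \<in> Mor C" "dom1 C (\<one> x) = x" "cod1 C (\<one> x) = x"
  using id1_hom[OF assms] by (simp_all add: hom_iff)

lemma comp1_ty [ty]:
  assumes "f \<in> Mor C" "g \<in> Mor C" "dom1 C g = cod1 C f"
  shows "g \<cdot> f \<in> Mor C" "dom1 C (g \<cdot> f) = dom1 C f" "cod1 C (g \<cdot> f) = cod1 C g"
  using comp1_hom[of f "dom1 C f" "cod1 C f" g "cod1 C g"] assms by (simp_all add: hom_iff)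

lemma comp1_eq [ty]:
  "\<lbrakk>f \<in> Mor C; g \<in> Mor C; h \<in> Mor C; dom1 C g = cod1 C f; dom1 C h = cod1 C g\<rbrakk> \<Longrightarrow>
     (h \<cdot> g) \<cdot> f = h \<cdot> (g \<cdot> f)"
  "\<lbrakk>f \<in> Mor C; dom1 C f = x\<rbrakk> \<Longrightarrow> f \<cdot> \<one> x = f"
  "\<lbrakk>f \<in> Mor C; cod1 C f = x\<rbrakk> \<Longrightarrow> \<one> x \<cdot> f = f"
  using comp1_assoc[of f _ _ g _ h] comp1_id_right comp1_id_left by (auto simp: hom_iff)

lemma id2_ty [ty]:
  assumes "f \<in> Mor C"
  shows "\<iota> f \<in> Cell C" "dom2 C (\<iota> f) = f" "cod2 C (\<iota> f) = f"
  using id2_cells[OF assms] by (simp_all add: cells_iff)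

lemma vcomp_ty [ty]:
  assumes "\<alpha> \<in> Cell C" "\<beta> \<in> Cell C" "dom2 C \<beta> = cod2 C \<alpha>"
  shows "\<beta> \<bullet> \<alpha> \<in> Cell C" "dom2 C (\<beta> \<bullet> \<alpha>) = dom2 C \<alpha>" "cod2 C (\<beta> \<bullet> \<alpha>) = cod2 C \<beta>"
  using vcomp_cells[of \<alpha> _ _ \<beta>] assms by (simp_all add: cells_iff)

lemma vcomp_eq [ty]:
  "\<lbrakk>\<alpha> \<in> Cell C; \<beta> \<in> Cell C; \<gamma> \<in> Cell C; dom2 C \<beta> = cod2 C \<alpha>; dom2 C \<gamma> = cod2 C \<beta>\<rbrakk> \<Longrightarrow>
     (\<gamma> \<bullet> \<beta>) \<bullet> \<alpha> = \<gamma> \<bullet> (\<beta> \<bullet> \<alpha>)"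
  "\<lbrakk>\<alpha> \<in> Cell C; dom2 C \<alpha> = f\<rbrakk> \<Longrightarrow> \<alpha> \<bullet> \<iota> f = \<alpha>"
  "\<lbrakk>\<alpha> \<in> Cell C; cod2 C \<alpha> = f\<rbrakk> \<Longrightarrow> \<iota> f \<bullet> \<alpha> = \<alpha>"
  using vcomp_assoc vcomp_id_right vcomp_id_left by (auto simp: cells_iff)

lemma hcomp_ty [ty]:
  assumes "\<alpha> \<in> Cell C" "\<beta> \<in> Cell C" "dom1 C (dom2 C \<beta>) = cod1 C (dom2 C \<alpha>)"
  shows "\<beta> \<star> \<alpha> \<in> Cell C" "dom2 C (\<beta> \<star> \<alpha>) = dom2 C \<beta> \<cdot> dom2 C \<alpha>"
    "cod2 C (\<beta> \<star> \<alpha>) = cod2 C \<beta> \<cdot> cod2 C \<alpha>"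
  using hcomp_cells[of "dom2 C \<alpha>" _ _ "dom2 C \<beta>" _ \<alpha> "cod2 C \<alpha>" \<beta> "cod2 C \<beta>"] assms
  by (simp_all add: cells_iff hom_iff ty)

lemma hcomp_eq [ty]:
  "\<lbrakk>\<alpha> \<in> Cell C; \<beta> \<in> Cell C; \<gamma> \<in> Cell C; dom1 C (dom2 C \<beta>) = cod1 C (dom2 C \<alpha>);
      dom1 C (dom2 C \<gamma>) = cod1 C (dom2 C \<beta>)\<rbrakk> \<Longrightarrow> (\<gamma> \<star> \<beta>) \<star> \<alpha> = \<gamma> \<star> (\<beta> \<star> \<alpha>)"
  "\<lbrakk>\<alpha> \<in> Cell C; dom1 C (dom2 C \<alpha>) = x\<rbrakk> \<Longrightarrow> \<alpha> \<star> \<iota> (\<one> x) = \<alpha>"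
  "\<lbrakk>\<alpha> \<in> Cell C; cod1 C (dom2 C \<alpha>) = x\<rbrakk> \<Longrightarrow> \<iota> (\<one> x) \<star> \<alpha> = \<alpha>"
  "\<lbrakk>f \<in> Mor C; g \<in> Mor C; dom1 C g = cod1 C f\<rbrakk> \<Longrightarrow> \<iota> g \<star> \<iota> f = \<iota> (g \<cdot> f)"
  using hcomp_assoc[of "dom2 C \<alpha>" _ _ "dom2 C \<beta>" _ "dom2 C \<gamma>" _ \<alpha> "cod2 C \<alpha>" \<beta> _ \<gamma>]
    hcomp_id_right[of "dom2 C \<alpha>" _ _ \<alpha>] hcomp_id_left[of "dom2 C \<alpha>" _ _ \<alpha>] hcomp_id2
  by (simp_all add: cells_iff hom_iff ty)

text \<open>In the right-associated form, the identities in \<open>\<iota> g \<star> (\<iota> f \<star> \<alpha>)\<close> are not adjacent; these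
  rules merge them.\<close>

lemma whisker_comp [ty]:
  "\<lbrakk>f \<in> Mor C; g \<in> Mor C; \<alpha> \<in> Cell C; dom1 C g = cod1 C f; dom1 C (dom2 C \<alpha>) = cod1 C g\<rbrakk> \<Longrightarrow>
     (\<alpha> \<star> \<iota> g) \<star> \<iota> f = \<alpha> \<star> \<iota> (g \<cdot> f)"
  "\<lbrakk>f \<in> Mor C; g \<in> Mor C; \<alpha> \<in> Cell C; dom1 C g = cod1 C f; dom1 C f = cod1 C (dom2 C \<alpha>)\<rbrakk> \<Longrightarrow>
     \<iota> g \<star> (\<iota> f \<star> \<alpha>) = \<iota> (g \<cdot> f) \<star> \<alpha>"
  by (simp_all add: ty hcomp_eq(1)[symmetric])

lemma interchange':
  assumes "\<alpha> \<in> Cell C" "\<alpha>' \<in> Cell C" "\<beta> \<in> Cell C" "\<beta>' \<in> Cell C" "dom2 C \<alpha>' = cod2 C \<alpha>"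
    "dom2 C \<beta>' = cod2 C \<beta>" "dom1 C (dom2 C \<beta>) = cod1 C (dom2 C \<alpha>)"
  shows "(\<beta>' \<bullet> \<beta>) \<star> (\<alpha>' \<bullet> \<alpha>) = (\<beta>' \<star> \<alpha>') \<bullet> (\<beta> \<star> \<alpha>)"
  using interchange[of "dom2 C \<alpha>" _ _ "dom2 C \<beta>" _ \<alpha> "cod2 C \<alpha>" \<alpha>' "cod2 C \<alpha>'" \<beta> "cod2 C \<beta>" \<beta>' "cod2 C \<beta>'"]
    assms by (simp add: cells_iff hom_iff ty)

lemma whisker_vcomp [ty]:
  "\<lbrakk>f \<in> Mor C; \<alpha> \<in> Cell C; \<beta> \<in> Cell C; dom2 C \<beta> = cod2 C \<alpha>; dom1 C (dom2 C \<alpha>) = cod1 C f\<rbrakk> \<Longrightarrow>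
     (\<beta> \<bullet> \<alpha>) \<star> \<iota> f = (\<beta> \<star> \<iota> f) \<bullet> (\<alpha> \<star> \<iota> f)"
  "\<lbrakk>f \<in> Mor C; \<alpha> \<in> Cell C; \<beta> \<in> Cell C; dom2 C \<beta> = cod2 C \<alpha>; dom1 C f = cod1 C (dom2 C \<alpha>)\<rbrakk> \<Longrightarrow>
     \<iota> f \<star> (\<beta> \<bullet> \<alpha>) = (\<iota> f \<star> \<beta>) \<bullet> (\<iota> f \<star> \<alpha>)"
  using interchange'[of "\<iota> f" "\<iota> f" \<alpha> \<beta>] interchange'[of \<alpha> \<beta> "\<iota> f" "\<iota> f"] by (simp_all add: ty)

lemma hcomp_whisker:
  assumes "\<alpha> \<in> Cell C" "\<beta> \<in> Cell C" "dom1 C (dom2 C \<beta>) = cod1 C (dom2 C \<alpha>)"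
  shows "(\<beta> \<star> \<iota> (cod2 C \<alpha>)) \<bullet> (\<iota> (dom2 C \<beta>) \<star> \<alpha>) = \<beta> \<star> \<alpha>"
    "(\<iota> (cod2 C \<beta>) \<star> \<alpha>) \<bullet> (\<beta> \<star> \<iota> (dom2 C \<alpha>)) = \<beta> \<star> \<alpha>"
  using interchange'[of \<alpha> "\<iota> (cod2 C \<alpha>)" "\<iota> (dom2 C \<beta>)" \<beta>]
    interchange'[of "\<iota> (dom2 C \<alpha>)" \<alpha> \<beta> "\<iota> (cod2 C \<beta>)"] assms by (simp_all add: ty)

lemma inverse2_unique:
  assumes "inverse2 C \<alpha> \<beta>" "inverse2 C \<alpha> \<gamma>"
  shows "\<beta> = \<gamma>"
proof -
  have "\<beta> = (\<gamma> \<bullet> \<alpha>) \<bullet> \<beta>" using assms by (auto simp: inverse2_def cells_iff ty)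
  also have "\<dots> = \<gamma> \<bullet> (\<alpha> \<bullet> \<beta>)"
    using assms unfolding inverse2_def cells_iff by (intro vcomp_eq) auto
  also have "\<dots> = \<gamma>" using assms by (auto simp: inverse2_def cells_iff ty)
  finally show ?thesis .
qed

lemma inv2_eq: "inverse2 C \<alpha> \<beta> \<Longrightarrow> inv2 C \<alpha> = \<beta>"
  unfolding inv2_def by (blast intro: inverse2_unique)

lemma iso2_inv2: "iso2 C \<alpha> \<Longrightarrow> inverse2 C \<alpha> (inv2 C \<alpha>)"
  unfolding iso2_def using inv2_eq by auto

lemma inverse2_id2: "f \<in> Mor C \<Longrightarrow> inverse2 C (\<iota> f) (\<iota> f)"
  by (simp add: inverse2_def cells_iff ty)

lemma inverse2_vcomp:
  assumes "inverse2 C \<alpha> \<alpha>'" "inverse2 C \<beta> \<beta>'" "dom2 C \<beta> = cod2 C \<alpha>"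
  shows "inverse2 C (\<beta> \<bullet> \<alpha>) (\<alpha>' \<bullet> \<beta>')"
proof -
  have t: "\<alpha> \<in> Cell C" "\<alpha>' \<in> Cell C" "\<beta> \<in> Cell C" "\<beta>' \<in> Cell C"
    "dom2 C \<alpha>' = cod2 C \<alpha>" "cod2 C \<alpha>' = dom2 C \<alpha>" "dom2 C \<beta>' = cod2 C \<beta>" "cod2 C \<beta>' = cod2 C \<alpha>"
    "dom2 C \<beta> = cod2 C \<alpha>" using assms by (auto simp: inverse2_def cells_iff)
  have "(\<alpha>' \<bullet> \<beta>') \<bullet> (\<beta> \<bullet> \<alpha>) = \<alpha>' \<bullet> (\<beta>' \<bullet> \<beta>) \<bullet> \<alpha>" using t by (simp add: ty)
  also have "\<dots> = \<iota> (dom2 C \<alpha>)" using assms t by (simp add: inverse2_def ty)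
  finally have 1: "(\<alpha>' \<bullet> \<beta>') \<bullet> (\<beta> \<bullet> \<alpha>) = \<iota> (dom2 C \<alpha>)" .
  have "(\<beta> \<bullet> \<alpha>) \<bullet> (\<alpha>' \<bullet> \<beta>') = \<beta> \<bullet> (\<alpha> \<bullet> \<alpha>') \<bullet> \<beta>'" using t by (simp add: ty)
  also have "\<dots> = \<iota> (cod2 C \<beta>)" using assms t by (simp add: inverse2_def ty)
  finally show ?thesis using 1 t by (simp add: inverse2_def cells_iff ty)
qed

lemma inverse2_hcomp:
  assumes "inverse2 C \<alpha> \<alpha>'" "inverse2 C \<beta> \<beta>'" "dom1 C (dom2 C \<beta>) = cod1 C (dom2 C \<alpha>)"
  shows "inverse2 C (\<beta> \<star> \<alpha>) (\<beta>' \<star> \<alpha>')"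
  using assms interchange'[of \<alpha> \<alpha>' \<beta> \<beta>', symmetric] interchange'[of \<alpha>' \<alpha> \<beta>' \<beta>, symmetric]
  by (auto simp: inverse2_def cells_iff ty)

end

section \<open>Reversal of the 2-cells\<close>

text \<open>Reversing the 2-cells exchanges lax and colax structure, so each result on lax morphisms below
  has a colax version. The composition of 1-cells, the horizontal composition and the tensor
  product are literally the same operations.\<close>

definition co :: "('o, 'm, 'c) two_cat \<Rightarrow> ('o, 'm, 'c) two_cat" where
  "co C = C\<lparr>dom2 := cod2 C, cod2 := dom2 C, vcomp := (\<lambda>\<beta> \<alpha>. vcomp C \<alpha> \<beta>)\<rparr>"

lemma co_simps [simp]:
  "Obj (co C) = Obj C" "Mor (co C) = Mor C" "Cell (co C) = Cell C"
  "dom1 (co C) = dom1 C" "cod1 (co C) = cod1 C" "dom2 (co C) = cod2 C" "cod2 (co C) = dom2 C"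
  "id1 (co C) = id1 C" "id2 (co C) = id2 C" "comp1 (co C) = comp1 C" "hcomp (co C) = hcomp C"
  "vcomp (co C) \<beta> \<alpha> = vcomp C \<alpha> \<beta>" "hom (co C) = hom C" "cells (co C) f g = cells C g f"
  by (auto simp: co_def hom_def cells_def fun_eq_iff)

lemma co_prod_cat: "co (prod_cat C D) = prod_cat (co C) (co D)"
  by (simp add: co_def prod_cat_def)

lemma (in two_category) co: "two_category (co C)"
proof -
  have "(\<beta> \<bullet> \<beta>') \<star> (\<alpha> \<bullet> \<alpha>') = (\<beta> \<star> \<alpha>) \<bullet> (\<beta>' \<star> \<alpha>')"
    if "\<alpha> \<in> cells C f' f" "\<alpha>' \<in> cells C f'' f'" "\<beta> \<in> cells C g' g" "\<beta>' \<in> cells C g'' g'"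
      "f \<in> hom C x y" "g \<in> hom C y z" for \<alpha> \<alpha>' \<beta> \<beta>' f f' f'' g g' g'' x y z
    using that mor_ty(3)[of \<beta>] mor_ty(3)[of \<beta>'] mor_ty(4)[of \<alpha>] mor_ty(4)[of \<alpha>']
    by (intro interchange') (auto simp: hom_iff cells_iff)
  then show ?thesis
    by unfold_locales (auto simp: hom_iff cells_iff ty)
qed

lemma co_two_functor:
  assumes "two_functor A B F"
  shows "two_functor (co A) (co B) F"
proof -
  interpret two_functor A B F by fact
  interpret A': two_category "co A" by (rule A.co)
  interpret B': two_category "co B" by (rule B.co)
  have h: "on_cell F (hcomp A \<beta> \<alpha>) = hcomp B (on_cell F \<beta>) (on_cell F \<alpha>)"
    if "f \<in> hom A x y" "g \<in> hom A y z" "\<alpha> \<in> cells A f' f" "\<beta> \<in> cells A g' g" for f g x y z \<alpha> \<beta> f' g'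
    using that by (intro pres_hcomp[of f' x y g' z]) (auto simp: A.hom_iff A.cells_iff ty)
  show ?thesis
    by unfold_locales (auto intro: obj mor cell pres_id1 pres_comp1 pres_id2 pres_vcomp h)
qed

lemma co_two_natural:
  assumes "two_natural A B F G \<eta>"
  shows "two_natural (co A) (co B) F G \<eta>"
proof -
  interpret two_natural A B F G \<eta> by fact
  interpret F': two_functor "co A" "co B" F by (rule co_two_functor) unfold_locales
  interpret G': two_functor "co A" "co B" G by (rule co_two_functor) unfold_locales
  have "whisker_right B (on_cell G \<alpha>) (\<eta> x) = whisker_left B (\<eta> y) (on_cell F \<alpha>)"
    if "f \<in> hom A x y" "\<alpha> \<in> cells A g f" for f x y \<alpha> g
    using that by (intro natural2[of g]) (auto simp: F.A.hom_iff F.A.cells_iff ty)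
  then show ?thesis
    by unfold_locales (auto intro: component natural1)
qed

section \<open>Computing in a monoidal 2-category\<close>

context monoidal_two_category
begin

lemma tensor_obj_ty [ty]: "\<lbrakk>x \<in> Obj C; y \<in> Obj C\<rbrakk> \<Longrightarrow> x \<boxtimes> y \<in> Obj C"
  using ten.obj[of "(x, y)"] by (simp add: prod_cat_def)

lemma tensor_mor_ty [ty]:
  assumes "f \<in> Mor C" "g \<in> Mor C"
  shows "f \<otimes> g \<in> Mor C" "dom1 C (f \<otimes> g) = dom1 C f \<boxtimes> dom1 C g"
    "cod1 C (f \<otimes> g) = cod1 C f \<boxtimes> cod1 C g"
  using ten.mor[of "(f, g)" "(dom1 C f, dom1 C g)" "(cod1 C f, cod1 C g)"] assms
  by (simp_all add: prod_cat_def hom_def)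

lemma tensor_cell_ty [ty]:
  assumes "\<alpha> \<in> Cell C" "\<beta> \<in> Cell C"
  shows "\<alpha> \<circledast> \<beta> \<in> Cell C" "dom2 C (\<alpha> \<circledast> \<beta>) = dom2 C \<alpha> \<otimes> dom2 C \<beta>"
    "cod2 C (\<alpha> \<circledast> \<beta>) = cod2 C \<alpha> \<otimes> cod2 C \<beta>"
  using ten.cell[of "(\<alpha>, \<beta>)" "(dom2 C \<alpha>, dom2 C \<beta>)" "(cod2 C \<alpha>, cod2 C \<beta>)"] assms
  by (simp_all add: prod_cat_def cells_def)

lemma tensor_id [ty]:
  "\<lbrakk>x \<in> Obj C; y \<in> Obj C\<rbrakk> \<Longrightarrow> \<one> x \<otimes> \<one> y = \<one> (x \<boxtimes> y)"
  "\<lbrakk>f \<in> Mor C; g \<in> Mor C\<rbrakk> \<Longrightarrow> \<iota> f \<circledast> \<iota> g = \<iota> (f \<otimes> g)"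
  using ten.pres_id1[of "(x, y)"] ten.pres_id2[of "(f, g)"] by (simp_all add: prod_cat_def)

lemma tensor_comp1:
  assumes "f \<in> Mor C" "g \<in> Mor C" "f' \<in> Mor C" "g' \<in> Mor C"
    "dom1 C g = cod1 C f" "dom1 C g' = cod1 C f'"
  shows "(g \<otimes> g') \<cdot> (f \<otimes> f') = (g \<cdot> f) \<otimes> (g' \<cdot> f')"
  using ten.pres_comp1[of "(f, f')" "(dom1 C f, dom1 C f')" "(cod1 C f, cod1 C f')"
      "(g, g')" "(cod1 C g, cod1 C g')"] assms
  by (simp add: prod_cat_def hom_def)

lemma tensor_hcomp:
  assumes "\<alpha> \<in> Cell C" "\<beta> \<in> Cell C" "\<alpha>' \<in> Cell C" "\<beta>' \<in> Cell C"
    "dom1 C (dom2 C \<beta>) = cod1 C (dom2 C \<alpha>)" "dom1 C (dom2 C \<beta>') = cod1 C (dom2 C \<alpha>')"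
  shows "(\<beta> \<circledast> \<beta>') \<star> (\<alpha> \<circledast> \<alpha>') = (\<beta> \<star> \<alpha>) \<circledast> (\<beta>' \<star> \<alpha>')"
  using ten.pres_hcomp[of "(dom2 C \<alpha>, dom2 C \<alpha>')" _ "(cod1 C (dom2 C \<alpha>), cod1 C (dom2 C \<alpha>'))"
      "(dom2 C \<beta>, dom2 C \<beta>')" _ "(\<alpha>, \<alpha>')" "(cod2 C \<alpha>, cod2 C \<alpha>')" "(\<beta>, \<beta>')" "(cod2 C \<beta>, cod2 C \<beta>')"]
    assms by (simp add: prod_cat_def hom_def cells_def ty)

lemma tensor_vcomp:
  assumes "\<alpha> \<in> Cell C" "\<beta> \<in> Cell C" "\<alpha>' \<in> Cell C" "\<beta>' \<in> Cell C"
    "dom2 C \<beta> = cod2 C \<alpha>" "dom2 C \<beta>' = cod2 C \<alpha>'"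
  shows "(\<beta> \<bullet> \<alpha>) \<circledast> (\<beta>' \<bullet> \<alpha>') = (\<beta> \<circledast> \<beta>') \<bullet> (\<alpha> \<circledast> \<alpha>')"
  using ten.pres_vcomp[of "(\<alpha>, \<alpha>')" "(dom2 C \<alpha>, dom2 C \<alpha>')" "(cod2 C \<alpha>, cod2 C \<alpha>')"
      "(\<beta>, \<beta>')" "(cod2 C \<beta>, cod2 C \<beta>')"] assms
  by (simp add: prod_cat_def cells_def)

lemma inverse2_tensor:
  assumes "inverse2 C \<alpha> \<alpha>'" "inverse2 C \<beta> \<beta>'"
  shows "inverse2 C (\<alpha> \<circledast> \<beta>) (\<alpha>' \<circledast> \<beta>')"
  using assms tensor_vcomp[of \<alpha> \<alpha>' \<beta> \<beta>', symmetric] tensor_vcomp[of \<alpha>' \<alpha> \<beta>' \<beta>, symmetric]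
  by (auto simp: inverse2_def cells_iff ty)

lemma constraint_ty [ty]:
  "\<I> \<in> Obj C"
  "\<lbrakk>x \<in> Obj C; y \<in> Obj C; z \<in> Obj C\<rbrakk> \<Longrightarrow> \<a> x y z \<in> Mor C"
  "\<lbrakk>x \<in> Obj C; y \<in> Obj C; z \<in> Obj C\<rbrakk> \<Longrightarrow> dom1 C (\<a> x y z) = (x \<boxtimes> y) \<boxtimes> z"
  "\<lbrakk>x \<in> Obj C; y \<in> Obj C; z \<in> Obj C\<rbrakk> \<Longrightarrow> cod1 C (\<a> x y z) = x \<boxtimes> (y \<boxtimes> z)"
  "x \<in> Obj C \<Longrightarrow> \<l> x \<in> Mor C" "x \<in> Obj C \<Longrightarrow> dom1 C (\<l> x) = \<I> \<boxtimes> x" "x \<in> Obj C \<Longrightarrow> cod1 C (\<l> x) = x"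
  "x \<in> Obj C \<Longrightarrow> \<r> x \<in> Mor C" "x \<in> Obj C \<Longrightarrow> dom1 C (\<r> x) = x \<boxtimes> \<I>" "x \<in> Obj C \<Longrightarrow> cod1 C (\<r> x) = x"
  using unit_in assoc_hom lunit_hom runit_hom by (simp_all add: hom_iff)

lemma assoc_nat:
  "\<lbrakk>f \<in> Mor C; g \<in> Mor C; h \<in> Mor C; dom1 C f = x; dom1 C g = y; dom1 C h = z\<rbrakk> \<Longrightarrow>
     (f \<otimes> (g \<otimes> h)) \<cdot> \<a> x y z = \<a> (cod1 C f) (cod1 C g) (cod1 C h) \<cdot> ((f \<otimes> g) \<otimes> h)"
  "\<lbrakk>\<alpha> \<in> Cell C; \<beta> \<in> Cell C; \<gamma> \<in> Cell C;
      dom1 C (dom2 C \<alpha>) = x; dom1 C (dom2 C \<beta>) = y; dom1 C (dom2 C \<gamma>) = z\<rbrakk> \<Longrightarrow>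
     (\<alpha> \<circledast> (\<beta> \<circledast> \<gamma>)) \<star> \<iota> (\<a> x y z)
      = \<iota> (\<a> (cod1 C (dom2 C \<alpha>)) (cod1 C (dom2 C \<beta>)) (cod1 C (dom2 C \<gamma>))) \<star> ((\<alpha> \<circledast> \<beta>) \<circledast> \<gamma>)"
  by (rule assoc_natural1; simp add: hom_iff)
     (rule assoc_natural2[of "dom2 C \<alpha>" _ _ "dom2 C \<beta>" _ _ "dom2 C \<gamma>"]; simp add: hom_iff cells_iff ty)

lemma unit_nat:
  "\<lbrakk>f \<in> Mor C; dom1 C f = x\<rbrakk> \<Longrightarrow> f \<cdot> \<l> x = \<l> (cod1 C f) \<cdot> (\<one> \<I> \<otimes> f)"
  "\<lbrakk>f \<in> Mor C; dom1 C f = x\<rbrakk> \<Longrightarrow> f \<cdot> \<r> x = \<r> (cod1 C f) \<cdot> (f \<otimes> \<one> \<I>)"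
  "\<lbrakk>\<alpha> \<in> Cell C; dom1 C (dom2 C \<alpha>) = x\<rbrakk> \<Longrightarrow>
     \<alpha> \<star> \<iota> (\<l> x) = \<iota> (\<l> (cod1 C (dom2 C \<alpha>))) \<star> (\<iota> (\<one> \<I>) \<circledast> \<alpha>)"
  "\<lbrakk>\<alpha> \<in> Cell C; dom1 C (dom2 C \<alpha>) = x\<rbrakk> \<Longrightarrow>
     \<alpha> \<star> \<iota> (\<r> x) = \<iota> (\<r> (cod1 C (dom2 C \<alpha>))) \<star> (\<alpha> \<circledast> \<iota> (\<one> \<I>))"
  using lunit_natural1[of f x] runit_natural1[of f x] lunit_natural2[of "dom2 C \<alpha>" x _ \<alpha>]
    runit_natural2[of "dom2 C \<alpha>" x _ \<alpha>]
  by (auto simp: hom_iff cells_iff ty)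

lemma co_monoidal: "monoidal_two_category (co C) M"
proof -
  interpret co: two_category "co C" by (rule co)
  interpret cot: two_functor "prod_cat (co C) (co C)" "co C" "tensor M"
    using co_two_functor[OF ten.two_functor_axioms] by (simp add: co_prod_cat)
  have "iso1 (co C) f \<longleftrightarrow> iso1 C f" for f by (simp add: iso1_def)
  then show ?thesis
    by unfold_locales
      (auto simp: unit_in assoc_iso1 lunit_iso1 runit_iso1 pentagon triangle hom_iff cells_iff ty
         assoc_nat unit_nat)
qed

end

section \<open>Elements of a lax morphism\<close>

context monoidal_two_category
begin

lemma tensor_whisker:
  "\<lbrakk>\<alpha> \<in> Cell C; \<alpha>' \<in> Cell C; f \<in> Mor C; f' \<in> Mor C; dom1 C (dom2 C \<alpha>) = cod1 C f;
     dom1 C (dom2 C \<alpha>') = cod1 C f'\<rbrakk> \<Longrightarrow> (\<alpha> \<circledast> \<alpha>') \<star> \<iota> (f \<otimes> f') = (\<alpha> \<star> \<iota> f) \<circledast> (\<alpha>' \<star> \<iota> f')"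
  "\<lbrakk>\<alpha> \<in> Cell C; \<alpha>' \<in> Cell C; f \<in> Mor C; f' \<in> Mor C; dom1 C f = cod1 C (dom2 C \<alpha>);
     dom1 C f' = cod1 C (dom2 C \<alpha>')\<rbrakk> \<Longrightarrow> \<iota> (f \<otimes> f') \<star> (\<alpha> \<circledast> \<alpha>') = (\<iota> f \<star> \<alpha>) \<circledast> (\<iota> f' \<star> \<alpha>')"
  using tensor_hcomp[of "\<iota> f" \<alpha> "\<iota> f'" \<alpha>'] tensor_hcomp[of \<alpha> "\<iota> f" \<alpha>' "\<iota> f'"]
  by (simp_all add: ty)

lemma monoid_ty:
  assumes "is_monoid X"
  shows "mcarr X \<in> Obj C" "mmult X \<in> Mor C" "dom1 C (mmult X) = mcarr X \<boxtimes> mcarr X"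
    "cod1 C (mmult X) = mcarr X" "munit X \<in> Mor C" "dom1 C (munit X) = \<I>" "cod1 C (munit X) = mcarr X"
  using assms by (auto simp: is_monoid_def Let_def hom_iff)

lemma monoid_laws:
  assumes "is_monoid X"
  shows "mmult X \<cdot> (mmult X \<otimes> \<one> (mcarr X))
       = mmult X \<cdot> (\<one> (mcarr X) \<otimes> mmult X) \<cdot> \<a> (mcarr X) (mcarr X) (mcarr X)"
    "mmult X \<cdot> (munit X \<otimes> \<one> (mcarr X)) = \<l> (mcarr X)"
    "mmult X \<cdot> (\<one> (mcarr X) \<otimes> munit X) = \<r> (mcarr X)"
  using assms by (auto simp: is_monoid_def Let_def)

lemma mult_assoc_mor:
  assumes X: "is_monoid X"
    and "a \<in> Mor C" "b \<in> Mor C" "c \<in> Mor C"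
      "cod1 C a = mcarr X" "cod1 C b = mcarr X" "cod1 C c = mcarr X"
  shows "mmult X \<cdot> ((mmult X \<cdot> (a \<otimes> b)) \<otimes> c)
    = (mmult X \<cdot> (a \<otimes> (mmult X \<cdot> (b \<otimes> c)))) \<cdot> \<a> (dom1 C a) (dom1 C b) (dom1 C c)"
proof -
  let ?m = "mmult X" and ?x = "mcarr X"
  note t = assms(2-) monoid_ty[OF X]
  have "?m \<cdot> ((?m \<cdot> (a \<otimes> b)) \<otimes> c) = (?m \<cdot> (?m \<otimes> \<one> ?x)) \<cdot> ((a \<otimes> b) \<otimes> c)"
    using t by (simp add: ty tensor_comp1)
  also have "\<dots> = ?m \<cdot> (\<one> ?x \<otimes> ?m) \<cdot> (\<a> ?x ?x ?x \<cdot> ((a \<otimes> b) \<otimes> c))"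
    using t by (simp add: monoid_laws(1)[OF X] ty)
  also have "\<a> ?x ?x ?x \<cdot> ((a \<otimes> b) \<otimes> c) = (a \<otimes> (b \<otimes> c)) \<cdot> \<a> (dom1 C a) (dom1 C b) (dom1 C c)"
    using t by (simp add: assoc_nat)
  also have "?m \<cdot> (\<one> ?x \<otimes> ?m) \<cdot> \<dots> = ?m \<cdot> ((\<one> ?x \<otimes> ?m) \<cdot> (a \<otimes> (b \<otimes> c))) \<cdot> \<a> (dom1 C a) (dom1 C b) (dom1 C c)"
    using t by (simp add: ty)
  also have "\<dots> = (?m \<cdot> (a \<otimes> (?m \<cdot> (b \<otimes> c)))) \<cdot> \<a> (dom1 C a) (dom1 C b) (dom1 C c)"
    using t by (simp add: ty tensor_comp1)
  finally show ?thesis .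
qed

lemma mult_unit_mor:
  assumes X: "is_monoid X" and "a \<in> Mor C" "cod1 C a = mcarr X"
  shows "mmult X \<cdot> (a \<otimes> munit X) = a \<cdot> \<r> (dom1 C a)" "mmult X \<cdot> (munit X \<otimes> a) = a \<cdot> \<l> (dom1 C a)"
proof -
  let ?m = "mmult X" and ?x = "mcarr X"
  note t = assms(2-) monoid_ty[OF X]
  have "?m \<cdot> (a \<otimes> munit X) = (?m \<cdot> (\<one> ?x \<otimes> munit X)) \<cdot> (a \<otimes> \<one> \<I>)"
    using t by (simp add: ty tensor_comp1)
  then show "?m \<cdot> (a \<otimes> munit X) = a \<cdot> \<r> (dom1 C a)"
    using t by (simp add: monoid_laws[OF X] unit_nat)
  have "?m \<cdot> (munit X \<otimes> a) = (?m \<cdot> (munit X \<otimes> \<one> ?x)) \<cdot> (\<one> \<I> \<otimes> a)"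
    using t by (simp add: ty tensor_comp1)
  then show "?m \<cdot> (munit X \<otimes> a) = a \<cdot> \<l> (dom1 C a)"
    using t by (simp add: monoid_laws[OF X] unit_nat)
qed

lemma mult_assoc_cell:
  assumes X: "is_monoid X"
    and "\<alpha> \<in> Cell C" "\<beta> \<in> Cell C" "\<gamma> \<in> Cell C" "cod1 C (dom2 C \<alpha>) = mcarr X"
      "cod1 C (dom2 C \<beta>) = mcarr X" "cod1 C (dom2 C \<gamma>) = mcarr X"
  shows "\<iota> (mmult X) \<star> ((\<iota> (mmult X) \<star> (\<alpha> \<circledast> \<beta>)) \<circledast> \<gamma>)
    = (\<iota> (mmult X) \<star> (\<alpha> \<circledast> (\<iota> (mmult X) \<star> (\<beta> \<circledast> \<gamma>))))
        \<star> \<iota> (\<a> (dom1 C (dom2 C \<alpha>)) (dom1 C (dom2 C \<beta>)) (dom1 C (dom2 C \<gamma>)))"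
proof -
  let ?m = "mmult X" and ?x = "mcarr X"
  let ?d = "\<a> (dom1 C (dom2 C \<alpha>)) (dom1 C (dom2 C \<beta>)) (dom1 C (dom2 C \<gamma>))"
  note t = assms(2-) monoid_ty[OF X]
  have "\<iota> ?m \<star> ((\<iota> ?m \<star> (\<alpha> \<circledast> \<beta>)) \<circledast> \<gamma>) = \<iota> (?m \<cdot> (?m \<otimes> \<one> ?x)) \<star> ((\<alpha> \<circledast> \<beta>) \<circledast> \<gamma>)"
    using t tensor_whisker(2)[of "\<alpha> \<circledast> \<beta>" \<gamma> ?m "\<one> ?x"] by (simp add: ty whisker_comp(2)[symmetric])
  also have "\<dots> = \<iota> (?m \<cdot> (\<one> ?x \<otimes> ?m)) \<star> (\<iota> (\<a> ?x ?x ?x) \<star> ((\<alpha> \<circledast> \<beta>) \<circledast> \<gamma>))"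
    using t by (simp add: monoid_laws(1)[OF X] ty)
  also have "\<iota> (\<a> ?x ?x ?x) \<star> ((\<alpha> \<circledast> \<beta>) \<circledast> \<gamma>) = (\<alpha> \<circledast> (\<beta> \<circledast> \<gamma>)) \<star> \<iota> ?d"
    using t by (simp add: assoc_nat)
  also have "\<iota> (?m \<cdot> (\<one> ?x \<otimes> ?m)) \<star> \<dots> = (\<iota> ?m \<star> (\<iota> (\<one> ?x \<otimes> ?m) \<star> (\<alpha> \<circledast> (\<beta> \<circledast> \<gamma>)))) \<star> \<iota> ?d"
    using t by (simp add: ty)
  also have "\<dots> = (\<iota> ?m \<star> (\<alpha> \<circledast> (\<iota> ?m \<star> (\<beta> \<circledast> \<gamma>)))) \<star> \<iota> ?d"
    using t tensor_whisker(2)[of \<alpha> "\<beta> \<circledast> \<gamma>" "\<one> ?x" ?m] by (simp add: ty del: whisker_comp)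
  finally show ?thesis .
qed

lemma mult_unit_cell:
  assumes X: "is_monoid X" and "\<alpha> \<in> Cell C" "cod1 C (dom2 C \<alpha>) = mcarr X"
  shows "\<iota> (mmult X) \<star> (\<alpha> \<circledast> \<iota> (munit X)) = \<alpha> \<star> \<iota> (\<r> (dom1 C (dom2 C \<alpha>)))"
    "\<iota> (mmult X) \<star> (\<iota> (munit X) \<circledast> \<alpha>) = \<alpha> \<star> \<iota> (\<l> (dom1 C (dom2 C \<alpha>)))"
proof -
  let ?m = "mmult X" and ?x = "mcarr X"
  note t = assms(2-) monoid_ty[OF X]
  have "\<iota> ?m \<star> (\<alpha> \<circledast> \<iota> (munit X)) = \<iota> (?m \<cdot> (\<one> ?x \<otimes> munit X)) \<star> (\<alpha> \<circledast> \<iota> (\<one> \<I>))"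
    using t tensor_whisker(2)[of \<alpha> "\<iota> (\<one> \<I>)" "\<one> ?x" "munit X"]
    by (simp add: ty whisker_comp(2)[symmetric])
  then show "\<iota> ?m \<star> (\<alpha> \<circledast> \<iota> (munit X)) = \<alpha> \<star> \<iota> (\<r> (dom1 C (dom2 C \<alpha>)))"
    using t by (simp add: monoid_laws[OF X] unit_nat)
  have "\<iota> ?m \<star> (\<iota> (munit X) \<circledast> \<alpha>) = \<iota> (?m \<cdot> (munit X \<otimes> \<one> ?x)) \<star> (\<iota> (\<one> \<I>) \<circledast> \<alpha>)"
    using t tensor_whisker(2)[of "\<iota> (\<one> \<I>)" \<alpha> "munit X" "\<one> ?x"]
    by (simp add: ty whisker_comp(2)[symmetric])
  then show "\<iota> ?m \<star> (\<iota> (munit X) \<circledast> \<alpha>) = \<alpha> \<star> \<iota> (\<l> (dom1 C (dom2 C \<alpha>)))"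
    using t by (simp add: monoid_laws[OF X] unit_nat)
qed

text \<open>The typing conditions of a lax morphism. They suffice to multiply elements, and the axioms of
  the lax morphism obtained from an algebra morphism are derived by such multiplications.\<close>

definition pre_lax :: "('o, 'm, 'c) mon_mor \<Rightarrow> bool" where
  "pre_lax \<phi> \<longleftrightarrow> is_monoid (mdom \<phi>) \<and> is_monoid (mcod \<phi>) \<and>
     mmap \<phi> \<in> hom C (mcarr (mdom \<phi>)) (mcarr (mcod \<phi>)) \<and>
     mbar \<phi> \<in> cells C (mmult (mcod \<phi>) \<cdot> (mmap \<phi> \<otimes> mmap \<phi>)) (mmap \<phi> \<cdot> mmult (mdom \<phi>)) \<and>
     mzero \<phi> \<in> cells C (munit (mcod \<phi>)) (mmap \<phi> \<cdot> munit (mdom \<phi>))"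

lemma pre_lax_ty:
  assumes "pre_lax \<phi>"
  shows "mmap \<phi> \<in> Mor C" "dom1 C (mmap \<phi>) = mcarr (mdom \<phi>)" "cod1 C (mmap \<phi>) = mcarr (mcod \<phi>)"
    "mbar \<phi> \<in> Cell C" "dom2 C (mbar \<phi>) = mmult (mcod \<phi>) \<cdot> (mmap \<phi> \<otimes> mmap \<phi>)"
    "cod2 C (mbar \<phi>) = mmap \<phi> \<cdot> mmult (mdom \<phi>)"
    "mzero \<phi> \<in> Cell C" "dom2 C (mzero \<phi>) = munit (mcod \<phi>)" "cod2 C (mzero \<phi>) = mmap \<phi> \<cdot> munit (mdom \<phi>)"
    "is_monoid (mdom \<phi>)" "is_monoid (mcod \<phi>)"
  using assms by (auto simp: pre_lax_def hom_iff cells_iff)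

lemmas lax_ty = pre_lax_ty pre_lax_ty(10)[THEN monoid_ty(1)] pre_lax_ty(10)[THEN monoid_ty(2)]
  pre_lax_ty(10)[THEN monoid_ty(3)] pre_lax_ty(10)[THEN monoid_ty(4)] pre_lax_ty(10)[THEN monoid_ty(5)]
  pre_lax_ty(10)[THEN monoid_ty(6)] pre_lax_ty(10)[THEN monoid_ty(7)]
  pre_lax_ty(11)[THEN monoid_ty(1)] pre_lax_ty(11)[THEN monoid_ty(2)]
  pre_lax_ty(11)[THEN monoid_ty(3)] pre_lax_ty(11)[THEN monoid_ty(4)] pre_lax_ty(11)[THEN monoid_ty(5)]
  pre_lax_ty(11)[THEN monoid_ty(6)] pre_lax_ty(11)[THEN monoid_ty(7)]

text \<open>The whiskerings in the axioms combine to tensor products with \<open>\<iota> f\<close>. In this form the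
  axioms are associativity and unitality for products of the generic element.\<close>

lemma is_lax_mor_iff:
  "is_lax_mor \<phi> \<longleftrightarrow> pre_lax \<phi> \<and>
     (let x = mcarr (mdom \<phi>); m = mmult (mdom \<phi>); i = munit (mdom \<phi>); n = mmult (mcod \<phi>);
          f = mmap \<phi>; fb = mbar \<phi>; f0 = mzero \<phi> in
      ((fb \<star> \<iota> (\<one> x \<otimes> m)) \<bullet> (\<iota> n \<star> (\<iota> f \<circledast> fb))) \<star> \<iota> (\<a> x x x)
        = (fb \<star> \<iota> (m \<otimes> \<one> x)) \<bullet> (\<iota> n \<star> (fb \<circledast> \<iota> f)) \<and>
      (fb \<star> \<iota> (\<one> x \<otimes> i)) \<bullet> (\<iota> n \<star> (\<iota> f \<circledast> f0)) = \<iota> (f \<cdot> \<r> x) \<and>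
      (fb \<star> \<iota> (i \<otimes> \<one> x)) \<bullet> (\<iota> n \<star> (f0 \<circledast> \<iota> f)) = \<iota> (f \<cdot> \<l> x))"
proof (cases "pre_lax \<phi>")
  case True
  define x m i y n j f fb f0 where d: "x = mcarr (mdom \<phi>)" "m = mmult (mdom \<phi>)" "i = munit (mdom \<phi>)"
    "y = mcarr (mcod \<phi>)" "n = mmult (mcod \<phi>)" "j = munit (mcod \<phi>)" "f = mmap \<phi>" "fb = mbar \<phi>" "f0 = mzero \<phi>"
  note t = lax_ty[OF True, folded d]
  have 1: "\<iota> (n \<cdot> (f \<otimes> \<one> y)) \<star> (\<iota> (\<one> x) \<circledast> k) = \<iota> n \<star> (\<iota> f \<circledast> k)"
    if "k \<in> Cell C" "cod1 C (dom2 C k) = y" for k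
    using that t tensor_whisker(2)[of "\<iota> (\<one> x)" k f "\<one> y"] by (simp add: ty whisker_comp(2)[symmetric])
  have 2: "\<iota> n \<star> (k \<circledast> \<iota> (\<one> y)) \<star> \<iota> (\<one> z \<otimes> f) = \<iota> n \<star> (k \<circledast> \<iota> f)"
    if "k \<in> Cell C" "dom1 C (dom2 C k) = z" "z \<in> Obj C" "cod1 C (dom2 C k) = y" for k z
    using that t tensor_whisker(1)[of k "\<iota> (\<one> y)" "\<one> z" f] by (simp add: ty)
  show ?thesis
    using True t unfolding is_lax_mor_def Let_def d[symmetric]
    by (simp add: ty 1 2 pre_lax_def d[symmetric] hom_iff cells_iff)
next
  case False
  then show ?thesis by (auto simp: is_lax_mor_def pre_lax_def Let_def)
qed

text \<open>Elements over \<open>z\<close> are the 1-cells from \<open>z\<close> to the comma object of \<open>mmap \<phi>\<close>,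
  described before such an object is known to exist. The set \<open>W\<close> restricts the 2-cells:
  all cells for lax morphisms, invertible ones for pseudo morphisms, identities for strict ones.\<close>

definition elt :: "'c set \<Rightarrow> ('o, 'm, 'c) mon_mor \<Rightarrow> 'o \<Rightarrow> ('m \<times> 'm \<times> 'c) set" where
  "elt W \<phi> z = {(a, b, h). a \<in> hom C z (mcarr (mdom \<phi>)) \<and> b \<in> hom C z (mcarr (mcod \<phi>)) \<and>
     h \<in> cells C b (mmap \<phi> \<cdot> a) \<and> h \<in> W}"

fun act :: "'m \<times> 'm \<times> 'c \<Rightarrow> 'm \<Rightarrow> 'm \<times> 'm \<times> 'c" where
  "act (a, b, h) u = (a \<cdot> u, b \<cdot> u, h \<star> \<iota> u)"

text \<open>Together with \<open>eunit\<close>, this product makes the presheaf of elements a monoid for Day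
  convolution if \<open>\<phi>\<close> is lax.\<close>

fun eprod :: "('o, 'm, 'c) mon_mor \<Rightarrow> 'm \<times> 'm \<times> 'c \<Rightarrow> 'm \<times> 'm \<times> 'c \<Rightarrow> 'm \<times> 'm \<times> 'c" where
  "eprod \<phi> (a, b, h) (a', b', h') = (mmult (mdom \<phi>) \<cdot> (a \<otimes> a'), mmult (mcod \<phi>) \<cdot> (b \<otimes> b'),
     (mbar \<phi> \<star> \<iota> (a \<otimes> a')) \<bullet> (\<iota> (mmult (mcod \<phi>)) \<star> (h \<circledast> h')))"

definition eunit :: "('o, 'm, 'c) mon_mor \<Rightarrow> 'm \<times> 'm \<times> 'c" where
  "eunit \<phi> = (munit (mdom \<phi>), munit (mcod \<phi>), mzero \<phi>)"

definition closed_cells :: "'c set \<Rightarrow> bool" where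
  "closed_cells W \<longleftrightarrow> (\<forall>f \<in> Mor C. \<iota> f \<in> W) \<and>
     (\<forall>\<alpha> \<in> Cell C \<inter> W. \<forall>\<beta> \<in> Cell C \<inter> W. \<alpha> \<circledast> \<beta> \<in> W \<and>
        (dom2 C \<beta> = cod2 C \<alpha> \<longrightarrow> \<beta> \<bullet> \<alpha> \<in> W) \<and>
        (dom1 C (dom2 C \<beta>) = cod1 C (dom2 C \<alpha>) \<longrightarrow> \<beta> \<star> \<alpha> \<in> W))"

lemma closed_cells_UNIV: "closed_cells UNIV"
  by (simp add: closed_cells_def)

lemma closed_cells_iso2: "closed_cells (Collect (iso2 C))"
  unfolding closed_cells_def iso2_def
  using inverse2_id2 inverse2_vcomp inverse2_hcomp inverse2_tensor by blast

lemma act_elt: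
  assumes "closed_cells W" "pre_lax \<phi>" "t \<in> elt W \<phi> z" "u \<in> hom C z' z"
  shows "act t u \<in> elt W \<phi> z'"
  using assms by (auto simp: elt_def closed_cells_def hom_iff cells_iff ty lax_ty)

lemma act_act:
  assumes "t \<in> elt W \<phi> z" "u \<in> hom C z' z" "v \<in> hom C z'' z'"
  shows "act (act t u) v = act t (u \<cdot> v)"
  using assms by (auto simp: elt_def hom_iff cells_iff ty)

lemma act_id:
  assumes "t \<in> elt W \<phi> z"
  shows "act t (\<one> z) = t"
  using assms by (auto simp: elt_def hom_iff cells_iff ty)

lemma eprod_elt:
  assumes W: "closed_cells W" and L: "pre_lax \<phi>" "mbar \<phi> \<in> W" and t: "t \<in> elt W \<phi> z" "t' \<in> elt W \<phi> z'"
  shows "eprod \<phi> t t' \<in> elt W \<phi> (z \<boxtimes> z')"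
proof -
  obtain a b h a' b' h' where [simp]: "t = (a, b, h)" "t' = (a', b', h')" by (metis prod.exhaust)
  have h: "a \<in> Mor C" "dom1 C a = z" "cod1 C a = mcarr (mdom \<phi>)" "b \<in> Mor C" "dom1 C b = z"
    "cod1 C b = mcarr (mcod \<phi>)" "h \<in> Cell C" "dom2 C h = b" "cod2 C h = mmap \<phi> \<cdot> a" "h \<in> W"
    "a' \<in> Mor C" "dom1 C a' = z'" "cod1 C a' = mcarr (mdom \<phi>)" "b' \<in> Mor C" "dom1 C b' = z'"
    "cod1 C b' = mcarr (mcod \<phi>)" "h' \<in> Cell C" "dom2 C h' = b'" "cod2 C h' = mmap \<phi> \<cdot> a'" "h' \<in> W"
    using t by (auto simp: elt_def hom_iff cells_iff)
  then have "(mbar \<phi> \<star> \<iota> (a \<otimes> a')) \<bullet> (\<iota> (mmult (mcod \<phi>)) \<star> (h \<circledast> h')) \<in> W"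
    using W L by (simp add: closed_cells_def ty lax_ty tensor_comp1)
  then show ?thesis
    using h L by (simp add: elt_def hom_iff cells_iff ty lax_ty tensor_comp1)
qed

lemma eprod_act:
  assumes L: "pre_lax \<phi>" and t: "t \<in> elt W \<phi> z" "t' \<in> elt W \<phi> z'"
    and u: "u \<in> hom C y z" "u' \<in> hom C y' z'"
  shows "eprod \<phi> (act t u) (act t' u') = act (eprod \<phi> t t') (u \<otimes> u')"
proof -
  obtain a b h a' b' h' where [simp]: "t = (a, b, h)" "t' = (a', b', h')" by (metis prod.exhaust)
  have h: "a \<in> Mor C" "dom1 C a = z" "cod1 C a = mcarr (mdom \<phi>)" "b \<in> Mor C" "dom1 C b = z"
    "cod1 C b = mcarr (mcod \<phi>)" "h \<in> Cell C" "dom2 C h = b" "cod2 C h = mmap \<phi> \<cdot> a"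
    "a' \<in> Mor C" "dom1 C a' = z'" "cod1 C a' = mcarr (mdom \<phi>)" "b' \<in> Mor C" "dom1 C b' = z'"
    "cod1 C b' = mcarr (mcod \<phi>)" "h' \<in> Cell C" "dom2 C h' = b'" "cod2 C h' = mmap \<phi> \<cdot> a'"
    "u \<in> Mor C" "dom1 C u = y" "cod1 C u = z" "u' \<in> Mor C" "dom1 C u' = y'" "cod1 C u' = z'"
    using t u by (auto simp: elt_def hom_iff cells_iff)
  show ?thesis
    using h L by (simp add: ty lax_ty tensor_comp1 tensor_whisker)
qed

lemma eunit_elt:
  assumes "pre_lax \<phi>" "mzero \<phi> \<in> W"
  shows "eunit \<phi> \<in> elt W \<phi> \<I>"
  using assms by (simp add: eunit_def elt_def hom_iff cells_iff lax_ty)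

text \<open>Every element arises from the generic element \<open>(1, f, \<iota> f)\<close> by restricting along
  \<open>a\<close> and composing vertically with \<open>h\<close>, and the product respects both. So the law
  splits into the axiom of \<open>\<phi>\<close>, whiskered by \<open>(a \<otimes> a') \<otimes> a''\<close>, and the associativity of
  the codomain, applied to the cells \<open>h\<close>, \<open>h'\<close> and \<open>h''\<close>.\<close>

lemma eprod_assoc:
  assumes L: "is_lax_mor \<phi>" and t: "t \<in> elt W \<phi> z" "t' \<in> elt W \<phi> z'" "t'' \<in> elt W \<phi> z''"
  shows "eprod \<phi> (eprod \<phi> t t') t'' = act (eprod \<phi> t (eprod \<phi> t' t'')) (\<a> z z' z'')"
proof -
  obtain a b h a' b' h' a'' b'' h'' where tt [simp]: "t = (a, b, h)" "t' = (a', b', h')" "t'' = (a'', b'', h'')"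
    by (metis prod.exhaust)
  have P: "pre_lax \<phi>" using L by (simp add: is_lax_mor_iff)
  define x m y n f fb where d: "x = mcarr (mdom \<phi>)" "m = mmult (mdom \<phi>)"
    "y = mcarr (mcod \<phi>)" "n = mmult (mcod \<phi>)" "f = mmap \<phi>" "fb = mbar \<phi>"
  note T = lax_ty[OF P, folded d]
  have h: "a \<in> Mor C" "dom1 C a = z" "cod1 C a = x" "b \<in> Mor C" "dom1 C b = z" "cod1 C b = y"
    "h \<in> Cell C" "dom2 C h = b" "cod2 C h = f \<cdot> a"
    "a' \<in> Mor C" "dom1 C a' = z'" "cod1 C a' = x" "b' \<in> Mor C" "dom1 C b' = z'" "cod1 C b' = y"
    "h' \<in> Cell C" "dom2 C h' = b'" "cod2 C h' = f \<cdot> a'"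
    "a'' \<in> Mor C" "dom1 C a'' = z''" "cod1 C a'' = x" "b'' \<in> Mor C" "dom1 C b'' = z''" "cod1 C b'' = y"
    "h'' \<in> Cell C" "dom2 C h'' = b''" "cod2 C h'' = f \<cdot> a''"
    "z \<in> Obj C" "z' \<in> Obj C" "z'' \<in> Obj C"
    using t by (auto simp: elt_def hom_iff cells_iff ty d)
  let ?al = "\<a> z z' z''" and ?u = "(a \<otimes> a') \<otimes> a''"
  let ?X = "\<iota> n \<star> ((\<iota> n \<star> (h \<circledast> h')) \<circledast> h'')" and ?X' = "\<iota> n \<star> (h \<circledast> (\<iota> n \<star> (h' \<circledast> h'')))"
  have X: "?X = ?X' \<star> \<iota> ?al"
    using mult_assoc_cell[OF T(11)[unfolded d], of h h' h''] h T unfolding d by simp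
  have law: "((fb \<star> \<iota> (\<one> x \<otimes> m)) \<bullet> (\<iota> n \<star> (\<iota> f \<circledast> fb))) \<star> \<iota> (\<a> x x x)
        = (fb \<star> \<iota> (m \<otimes> \<one> x)) \<bullet> (\<iota> n \<star> (fb \<circledast> \<iota> f))"
    using L by (simp add: is_lax_mor_iff Let_def d)
  have "((fb \<star> \<iota> (a \<otimes> a')) \<bullet> (\<iota> n \<star> (h \<circledast> h'))) \<circledast> h''
      = ((fb \<star> \<iota> (a \<otimes> a')) \<circledast> \<iota> (f \<cdot> a'')) \<bullet> ((\<iota> n \<star> (h \<circledast> h')) \<circledast> h'')"
    using h T tensor_vcomp[of "\<iota> n \<star> (h \<circledast> h')" "fb \<star> \<iota> (a \<otimes> a')" h'' "\<iota> (f \<cdot> a'')"]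
    by (simp add: ty tensor_comp1)
  also have "(fb \<star> \<iota> (a \<otimes> a')) \<circledast> \<iota> (f \<cdot> a'') = (fb \<circledast> \<iota> f) \<star> \<iota> ?u"
    using h T by (simp add: ty tensor_whisker)
  finally have 1: "(fb \<star> \<iota> ((m \<cdot> (a \<otimes> a')) \<otimes> a'')) \<bullet>
        (\<iota> n \<star> (((fb \<star> \<iota> (a \<otimes> a')) \<bullet> (\<iota> n \<star> (h \<circledast> h'))) \<circledast> h''))
      = (((fb \<star> \<iota> (m \<otimes> \<one> x)) \<bullet> (\<iota> n \<star> (fb \<circledast> \<iota> f))) \<star> \<iota> ?u) \<bullet> ?X"
    using h T by (simp add: ty tensor_comp1)
  have "h \<circledast> ((fb \<star> \<iota> (a' \<otimes> a'')) \<bullet> (\<iota> n \<star> (h' \<circledast> h'')))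
      = (\<iota> (f \<cdot> a) \<circledast> (fb \<star> \<iota> (a' \<otimes> a''))) \<bullet> (h \<circledast> (\<iota> n \<star> (h' \<circledast> h'')))"
    using h T tensor_vcomp[of h "\<iota> (f \<cdot> a)" "\<iota> n \<star> (h' \<circledast> h'')" "fb \<star> \<iota> (a' \<otimes> a'')"]
    by (simp add: ty tensor_comp1)
  also have "\<iota> (f \<cdot> a) \<circledast> (fb \<star> \<iota> (a' \<otimes> a'')) = (\<iota> f \<circledast> fb) \<star> \<iota> (a \<otimes> (a' \<otimes> a''))"
    using h T by (simp add: ty tensor_whisker)
  finally have 2: "(fb \<star> \<iota> (a \<otimes> (m \<cdot> (a' \<otimes> a'')))) \<bullet>
        (\<iota> n \<star> (h \<circledast> ((fb \<star> \<iota> (a' \<otimes> a'')) \<bullet> (\<iota> n \<star> (h' \<circledast> h'')))))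
      = (((fb \<star> \<iota> (\<one> x \<otimes> m)) \<bullet> (\<iota> n \<star> (\<iota> f \<circledast> fb))) \<star> \<iota> (a \<otimes> (a' \<otimes> a''))) \<bullet> ?X'"
    using h T by (simp add: ty tensor_comp1)
  let ?L = "(fb \<star> \<iota> (\<one> x \<otimes> m)) \<bullet> (\<iota> n \<star> (\<iota> f \<circledast> fb))"
  have L: "?L \<in> Cell C" "dom2 C ?L = n \<cdot> (f \<otimes> (n \<cdot> (f \<otimes> f)))"
    using T by (simp_all add: ty tensor_comp1)
  have X': "?X' \<in> Cell C" "cod2 C ?X' = n \<cdot> ((f \<cdot> a) \<otimes> (n \<cdot> ((f \<cdot> a') \<otimes> (f \<cdot> a''))))"
    "dom1 C (dom2 C ?X') = z \<boxtimes> (z' \<boxtimes> z'')"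
    using T h by (simp_all add: ty)
  have "((?L \<star> \<iota> (a \<otimes> (a' \<otimes> a''))) \<bullet> ?X') \<star> \<iota> ?al = ((?L \<star> \<iota> (a \<otimes> (a' \<otimes> a''))) \<star> \<iota> ?al) \<bullet> (?X' \<star> \<iota> ?al)"
    using T h L X' by (intro whisker_vcomp) (simp_all add: ty tensor_comp1)
  also have "(?L \<star> \<iota> (a \<otimes> (a' \<otimes> a''))) \<star> \<iota> ?al = ?L \<star> \<iota> ((a \<otimes> (a' \<otimes> a'')) \<cdot> ?al)"
    using T h L by (intro whisker_comp) (simp_all add: ty)
  also have "(a \<otimes> (a' \<otimes> a'')) \<cdot> ?al = \<a> x x x \<cdot> ?u"
    using h T by (simp add: assoc_nat)
  also have "?L \<star> \<iota> (\<a> x x x \<cdot> ?u) = (?L \<star> \<iota> (\<a> x x x)) \<star> \<iota> ?u"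
    using T h L by (intro whisker_comp(1)[symmetric]) (simp_all add: ty)
  finally have 3: "((?L \<star> \<iota> (a \<otimes> (a' \<otimes> a''))) \<bullet> ?X') \<star> \<iota> ?al = ((?L \<star> \<iota> (\<a> x x x)) \<star> \<iota> ?u) \<bullet> ?X"
    by (simp only: X)
  have c1: "m \<cdot> ((m \<cdot> (a \<otimes> a')) \<otimes> a'') = (m \<cdot> (a \<otimes> (m \<cdot> (a' \<otimes> a'')))) \<cdot> ?al"
    using mult_assoc_mor[OF T(10)[unfolded d], of a a' a''] h T unfolding d by simp
  have c2: "n \<cdot> ((n \<cdot> (b \<otimes> b')) \<otimes> b'') = (n \<cdot> (b \<otimes> (n \<cdot> (b' \<otimes> b'')))) \<cdot> ?al"
    using mult_assoc_mor[OF T(11)[unfolded d], of b b' b''] h T unfolding d by simp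
  show ?thesis
    unfolding tt eprod.simps act.simps d[symmetric] 1 2 3 law c1 c2 by simp
qed

lemma eprod_eunit:
  assumes L: "is_lax_mor \<phi>" and t: "t \<in> elt W \<phi> z"
  shows "eprod \<phi> t (eunit \<phi>) = act t (\<r> z)" "eprod \<phi> (eunit \<phi>) t = act t (\<l> z)"
proof -
  obtain a b h where tt [simp]: "t = (a, b, h)" by (metis prod.exhaust)
  have P: "pre_lax \<phi>" using L by (simp add: is_lax_mor_iff)
  define x m y n f fb i j f0 where d: "x = mcarr (mdom \<phi>)" "m = mmult (mdom \<phi>)"
    "y = mcarr (mcod \<phi>)" "n = mmult (mcod \<phi>)" "f = mmap \<phi>" "fb = mbar \<phi>"
    "i = munit (mdom \<phi>)" "j = munit (mcod \<phi>)" "f0 = mzero \<phi>"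
  note T = lax_ty[OF P, folded d]
  have h: "a \<in> Mor C" "dom1 C a = z" "cod1 C a = x" "b \<in> Mor C" "dom1 C b = z" "cod1 C b = y"
    "h \<in> Cell C" "dom2 C h = b" "cod2 C h = f \<cdot> a" "z \<in> Obj C"
    using t by (auto simp: elt_def hom_iff cells_iff ty d)
  have law: "(fb \<star> \<iota> (\<one> x \<otimes> i)) \<bullet> (\<iota> n \<star> (\<iota> f \<circledast> f0)) = \<iota> (f \<cdot> \<r> x)"
    "(fb \<star> \<iota> (i \<otimes> \<one> x)) \<bullet> (\<iota> n \<star> (f0 \<circledast> \<iota> f)) = \<iota> (f \<cdot> \<l> x)"
    using L by (simp_all add: is_lax_mor_iff Let_def d)
  have "h \<circledast> f0 = ((\<iota> f \<star> \<iota> a) \<circledast> f0) \<bullet> (h \<circledast> \<iota> j)" "f0 \<circledast> h = (f0 \<circledast> (\<iota> f \<star> \<iota> a)) \<bullet> (\<iota> j \<circledast> h)"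
    using h T tensor_vcomp[of h "\<iota> (f \<cdot> a)" "\<iota> j" f0] tensor_vcomp[of "\<iota> j" f0 h "\<iota> (f \<cdot> a)"]
    by (simp_all add: ty)
  moreover have "(\<iota> f \<star> \<iota> a) \<circledast> f0 = (\<iota> f \<circledast> f0) \<star> \<iota> (a \<otimes> \<one> \<I>)" "f0 \<circledast> (\<iota> f \<star> \<iota> a) = (f0 \<circledast> \<iota> f) \<star> \<iota> (\<one> \<I> \<otimes> a)"
    using h T by (simp_all add: ty tensor_whisker)
  ultimately have "(fb \<star> \<iota> (a \<otimes> i)) \<bullet> (\<iota> n \<star> (h \<circledast> f0))
      = (((fb \<star> \<iota> (\<one> x \<otimes> i)) \<bullet> (\<iota> n \<star> (\<iota> f \<circledast> f0))) \<star> \<iota> (a \<otimes> \<one> \<I>)) \<bullet> (\<iota> n \<star> (h \<circledast> \<iota> j))"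
    "(fb \<star> \<iota> (i \<otimes> a)) \<bullet> (\<iota> n \<star> (f0 \<circledast> h))
      = (((fb \<star> \<iota> (i \<otimes> \<one> x)) \<bullet> (\<iota> n \<star> (f0 \<circledast> \<iota> f))) \<star> \<iota> (\<one> \<I> \<otimes> a)) \<bullet> (\<iota> n \<star> (\<iota> j \<circledast> h))"
    using h T by (simp_all add: ty tensor_comp1)
  moreover have "\<iota> n \<star> (h \<circledast> \<iota> j) = h \<star> \<iota> (\<r> z)" "\<iota> n \<star> (\<iota> j \<circledast> h) = h \<star> \<iota> (\<l> z)"
    using mult_unit_cell[OF T(11)[unfolded d], of h] h T unfolding d by simp_all
  moreover have "a \<cdot> \<r> z = \<r> x \<cdot> (a \<otimes> \<one> \<I>)" "a \<cdot> \<l> z = \<l> x \<cdot> (\<one> \<I> \<otimes> a)"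
    using h by (simp_all add: unit_nat)
  ultimately have "(fb \<star> \<iota> (a \<otimes> i)) \<bullet> (\<iota> n \<star> (h \<circledast> f0)) = h \<star> \<iota> (\<r> z)"
    "(fb \<star> \<iota> (i \<otimes> a)) \<bullet> (\<iota> n \<star> (f0 \<circledast> h)) = h \<star> \<iota> (\<l> z)"
    using h T by (simp_all add: law ty)
  moreover have "m \<cdot> (a \<otimes> i) = a \<cdot> \<r> z" "m \<cdot> (i \<otimes> a) = a \<cdot> \<l> z" "n \<cdot> (b \<otimes> j) = b \<cdot> \<r> z" "n \<cdot> (j \<otimes> b) = b \<cdot> \<l> z"
    using mult_unit_mor[OF T(10)[unfolded d], of a] mult_unit_mor[OF T(11)[unfolded d], of b] h T
    unfolding d by simp_all
  ultimately show "eprod \<phi> t (eunit \<phi>) = act t (\<r> z)" "eprod \<phi> (eunit \<phi>) t = act t (\<l> z)"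
    unfolding tt eprod.simps act.simps eunit_def d[symmetric] by simp_all
qed

end

section \<open>Comma objects and homomorphic elements\<close>

text \<open>The universal property of a comma object of \<open>f\<close> and the identity, for 1-cells, with all
  2-cells restricted to \<open>W\<close>. The invertible cells give iso-comma objects.\<close>

definition (in two_category) has_commas :: "'c set \<Rightarrow> bool" where
  "has_commas W \<longleftrightarrow> (\<forall>x y. \<forall>f \<in> hom C x y. \<exists>P \<in> Obj C. \<exists>p \<in> hom C P x. \<exists>q \<in> hom C P y.
     \<exists>l \<in> cells C q (f \<cdot> p) \<inter> W.
       \<forall>z \<in> Obj C. \<forall>a \<in> hom C z x. \<forall>b \<in> hom C z y. \<forall>h \<in> cells C b (f \<cdot> a) \<inter> W.
         \<exists>!u. u \<in> hom C z P \<and> p \<cdot> u = a \<and> q \<cdot> u = b \<and> l \<star> \<iota> u = h)"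

context monoidal_two_category
begin

text \<open>Strict monoid morphisms without the identity cells that \<open>Mon Strict\<close> records with them.\<close>

definition strict_hom :: "('o, 'm) mon \<Rightarrow> ('o, 'm) mon \<Rightarrow> 'm \<Rightarrow> bool" where
  "strict_hom X Y u \<longleftrightarrow> is_monoid X \<and> is_monoid Y \<and> u \<in> hom C (mcarr X) (mcarr Y) \<and>
     u \<cdot> mmult X = mmult Y \<cdot> (u \<otimes> u) \<and> u \<cdot> munit X = munit Y"

lemma strict_hom_ty:
  assumes "strict_hom X Y u"
  shows "u \<in> Mor C" "dom1 C u = mcarr X" "cod1 C u = mcarr Y" "is_monoid X" "is_monoid Y"
  using assms by (auto simp: strict_hom_def hom_iff)

lemma strict_hom_comp:
  assumes "strict_hom X Y u" "strict_hom Y Z v"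
  shows "strict_hom X Z (v \<cdot> u)"
proof -
  note t = strict_hom_ty[OF assms(1)] strict_hom_ty[OF assms(2)]
  note m = t(4)[THEN monoid_ty(1)] t(4)[THEN monoid_ty(2)] t(4)[THEN monoid_ty(3)] t(4)[THEN monoid_ty(4)]
    t(4)[THEN monoid_ty(5)] t(4)[THEN monoid_ty(6)] t(4)[THEN monoid_ty(7)]
    t(5)[THEN monoid_ty(1)] t(5)[THEN monoid_ty(2)] t(5)[THEN monoid_ty(3)] t(5)[THEN monoid_ty(4)]
    t(5)[THEN monoid_ty(5)] t(5)[THEN monoid_ty(6)] t(5)[THEN monoid_ty(7)]
    t(10)[THEN monoid_ty(1)] t(10)[THEN monoid_ty(2)] t(10)[THEN monoid_ty(3)] t(10)[THEN monoid_ty(4)]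
    t(10)[THEN monoid_ty(5)] t(10)[THEN monoid_ty(6)] t(10)[THEN monoid_ty(7)]
  have "(v \<cdot> u) \<cdot> mmult X = v \<cdot> (mmult Y \<cdot> (u \<otimes> u))"
    using assms(1) t m by (simp add: strict_hom_def ty)
  also have "\<dots> = (v \<cdot> mmult Y) \<cdot> (u \<otimes> u)" using t m by (simp add: ty)
  also have "\<dots> = (mmult Z \<cdot> (v \<otimes> v)) \<cdot> (u \<otimes> u)" using assms(2) by (simp add: strict_hom_def)
  also have "\<dots> = mmult Z \<cdot> ((v \<cdot> u) \<otimes> (v \<cdot> u))" using t m by (simp add: ty tensor_comp1)
  finally have 1: "(v \<cdot> u) \<cdot> mmult X = mmult Z \<cdot> ((v \<cdot> u) \<otimes> (v \<cdot> u))" .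
  have "(v \<cdot> u) \<cdot> munit X = munit Z" using assms t m by (simp add: strict_hom_def ty)
  then show ?thesis using 1 t by (simp add: strict_hom_def hom_iff ty)
qed

text \<open>A homomorphic element \<open>(a, b, h)\<close> is a monoid 2-cell from a strict homomorphism \<open>b\<close> to
  the composite of \<open>\<phi>\<close> with a strict homomorphism \<open>a\<close>.\<close>

definition homomorphic :: "'c set \<Rightarrow> ('o, 'm, 'c) mon_mor \<Rightarrow> ('o, 'm) mon \<Rightarrow> 'm \<times> 'm \<times> 'c \<Rightarrow> bool" where
  "homomorphic W \<phi> Z t \<longleftrightarrow> t \<in> elt W \<phi> (mcarr Z) \<and>
     act t (mmult Z) = eprod \<phi> t t \<and> act t (munit Z) = eunit \<phi>"

lemma homomorphic_strict_homs:
  assumes "homomorphic W \<phi> Z (a, b, h)" "pre_lax \<phi>" "is_monoid Z"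
  shows "strict_hom Z (mdom \<phi>) a" "strict_hom Z (mcod \<phi>) b"
  using assms by (auto simp: homomorphic_def strict_hom_def elt_def eunit_def pre_lax_ty)

lemma homomorphic_act:
  assumes t: "homomorphic W \<phi> Z t" and L: "pre_lax \<phi>" "closed_cells W" and u: "strict_hom Y Z u"
  shows "homomorphic W \<phi> Y (act t u)"
proof -
  have e: "t \<in> elt W \<phi> (mcarr Z)" using t by (simp add: homomorphic_def)
  have uh: "u \<in> hom C (mcarr Y) (mcarr Z)" using u by (simp add: strict_hom_def)
  note Y = monoid_ty[OF strict_hom_ty(4)[OF u]] and Z = monoid_ty[OF strict_hom_ty(5)[OF u]]
  have uu: "u \<otimes> u \<in> hom C (mcarr Y \<boxtimes> mcarr Y) (mcarr Z \<boxtimes> mcarr Z)" using uh by (simp add: hom_iff ty)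
  have m: "mmult Y \<in> hom C (mcarr Y \<boxtimes> mcarr Y) (mcarr Y)" "munit Y \<in> hom C \<I> (mcarr Y)"
    "mmult Z \<in> hom C (mcarr Z \<boxtimes> mcarr Z) (mcarr Z)"
    using Y Z by (simp_all add: hom_iff)
  have "act (act t u) (mmult Y) = act t (mmult Z \<cdot> (u \<otimes> u))"
    using act_act[OF e uh m(1)] u by (simp add: strict_hom_def)
  also have "\<dots> = act (eprod \<phi> t t) (u \<otimes> u)"
    using act_act[OF e m(3) uu] t by (simp add: homomorphic_def)
  also have "\<dots> = eprod \<phi> (act t u) (act t u)"
    using eprod_act[OF L(1) e e uh uh] by simp
  finally have 1: "act (act t u) (mmult Y) = eprod \<phi> (act t u) (act t u)" .
  have "act (act t u) (munit Y) = eunit \<phi>"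
    using act_act[OF e uh m(2)] u t by (simp add: strict_hom_def homomorphic_def)
  then show ?thesis using 1 act_elt[OF L(2,1) e uh] by (simp add: homomorphic_def)
qed

definition represents :: "'c set \<Rightarrow> ('o, 'm, 'c) mon_mor \<Rightarrow> 'o \<Rightarrow> 'm \<times> 'm \<times> 'c \<Rightarrow> bool" where
  "represents W \<phi> P g \<longleftrightarrow> g \<in> elt W \<phi> P \<and>
     (\<forall>z. \<forall>t \<in> elt W \<phi> z. \<exists>!u. u \<in> hom C z P \<and> act g u = t)"

lemma commas_represent:
  assumes "has_commas W" "pre_lax \<phi>"
  shows "\<exists>P g. represents W \<phi> P g"
proof -
  have f: "mmap \<phi> \<in> hom C (mcarr (mdom \<phi>)) (mcarr (mcod \<phi>))" using assms(2) by (simp add: pre_lax_def)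
  obtain P p q l where P: "P \<in> Obj C" "p \<in> hom C P (mcarr (mdom \<phi>))" "q \<in> hom C P (mcarr (mcod \<phi>))"
    "l \<in> cells C q (mmap \<phi> \<cdot> p)" "l \<in> W"
    and u: "\<forall>z \<in> Obj C. \<forall>a \<in> hom C z (mcarr (mdom \<phi>)). \<forall>b \<in> hom C z (mcarr (mcod \<phi>)).
        \<forall>h \<in> cells C b (mmap \<phi> \<cdot> a) \<inter> W.
          \<exists>!u. u \<in> hom C z P \<and> p \<cdot> u = a \<and> q \<cdot> u = b \<and> l \<star> \<iota> u = h"
    using assms(1)[unfolded has_commas_def, rule_format, OF f] by (elim bexE) auto
  have "\<exists>!u. u \<in> hom C z P \<and> act (p, q, l) u = t" if "t \<in> elt W \<phi> z" for z t
  proof -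
    obtain a b h where [simp]: "t = (a, b, h)" by (metis prod.exhaust)
    have h: "a \<in> hom C z (mcarr (mdom \<phi>))" "b \<in> hom C z (mcarr (mcod \<phi>))"
        "h \<in> cells C b (mmap \<phi> \<cdot> a)" "h \<in> W"
      using that by (auto simp: elt_def)
    then have "z \<in> Obj C" by (auto simp: hom_iff ty)
    then show ?thesis using u[rule_format, of z a b h] h by simp
  qed
  moreover have "(p, q, l) \<in> elt W \<phi> P" using P by (simp add: elt_def)
  ultimately show ?thesis unfolding represents_def by blast
qed

text \<open>By Yoneda, the product of elements induces a multiplication on the representing object; the
  generic element \<open>g\<close> detects equality of 1-cells into it.\<close>

lemma representing_monoid:
  assumes L: "is_lax_mor \<phi>" "mbar \<phi> \<in> W" "mzero \<phi> \<in> W" and W: "closed_cells W"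
    and P: "represents W \<phi> P g"
  obtains X where "is_monoid X" "mcarr X = P" "homomorphic W \<phi> X g"
proof -
  have pl: "pre_lax \<phi>" using L by (simp add: is_lax_mor_iff)
  have g: "g \<in> elt W \<phi> P" and ex: "\<And>z t. t \<in> elt W \<phi> z \<Longrightarrow> \<exists>u. u \<in> hom C z P \<and> act g u = t"
    using P unfolding represents_def by blast+
  have eq: "u = v" if "u \<in> hom C z P" "v \<in> hom C z P" "act g u = act g v" for u v z
    using P that act_elt[OF W pl g that(1)] unfolding represents_def by metis
  have PO: "P \<in> Obj C" using g by (auto simp: elt_def hom_iff ty)
  obtain m where m: "m \<in> hom C (P \<boxtimes> P) P" "act g m = eprod \<phi> g g"
    using ex[OF eprod_elt[OF W pl L(2) g g]] by blast
  obtain i where i: "i \<in> hom C \<I> P" "act g i = eunit \<phi>"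
    using ex[OF eunit_elt[OF pl L(3)]] by blast
  \<comment> \<open>Multiplying two elements is composing with \<open>m\<close>, so the laws of \<open>m\<close> are those of elements.\<close>
  have mult: "act g (m \<cdot> (u \<otimes> v)) = eprod \<phi> (act g u) (act g v)"
    if "u \<in> hom C z P" "v \<in> hom C z' P" for u v z z'
  proof -
    have "u \<otimes> v \<in> hom C (z \<boxtimes> z') (P \<boxtimes> P)" using that by (auto simp: hom_iff ty)
    then show ?thesis
      using eprod_act[OF pl g g that] act_act[OF g m(1), of "u \<otimes> v"] m(2) by simp
  qed
  have one: "\<one> P \<in> hom C P P" using PO by (simp add: hom_iff ty)
  have t: "m \<in> Mor C" "dom1 C m = P \<boxtimes> P" "cod1 C m = P" "i \<in> Mor C" "dom1 C i = \<I>" "cod1 C i = P"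
    using m i by (simp_all add: hom_iff)
  have gg: "act g (\<one> P) = g" by (rule act_id[OF g])
  have "m \<cdot> (m \<otimes> \<one> P) = (m \<cdot> (\<one> P \<otimes> m)) \<cdot> \<a> P P P"
  proof (rule eq)
    show "act g (m \<cdot> (m \<otimes> \<one> P)) = act g ((m \<cdot> (\<one> P \<otimes> m)) \<cdot> \<a> P P P)"
      using act_act[OF g, of "m \<cdot> (\<one> P \<otimes> m)" _ "\<a> P P P"] eprod_assoc[OF L(1) g g g] t PO
      by (simp add: mult[OF m(1) one] mult[OF one m(1)] gg m(2) hom_iff ty)
  qed (use t PO in \<open>simp_all add: hom_iff ty\<close>)
  moreover have "m \<cdot> (i \<otimes> \<one> P) = \<l> P"
  proof (rule eq)
    show "act g (m \<cdot> (i \<otimes> \<one> P)) = act g (\<l> P)"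
      using eprod_eunit[OF L(1) g] by (simp add: mult[OF i(1) one] gg i(2))
  qed (use t PO in \<open>simp_all add: hom_iff ty\<close>)
  moreover have "m \<cdot> (\<one> P \<otimes> i) = \<r> P"
  proof (rule eq)
    show "act g (m \<cdot> (\<one> P \<otimes> i)) = act g (\<r> P)"
      using eprod_eunit[OF L(1) g] by (simp add: mult[OF one i(1)] gg i(2))
  qed (use t PO in \<open>simp_all add: hom_iff ty\<close>)
  ultimately have "is_monoid \<lparr>mcarr = P, mmult = m, munit = i\<rparr>"
    using m i t PO by (simp add: is_monoid_def ty)
  then show thesis
    using that m i g by (auto simp: homomorphic_def)
qed

text \<open>Both homomorphism equations for \<open>u\<close> become the conditions on \<open>act g u\<close> when \<open>g\<close>
  is restricted along their two sides.\<close>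

lemma strict_hom_if_homomorphic:
  assumes L: "pre_lax \<phi>" "closed_cells W" and P: "represents W \<phi> (mcarr X) g"
    and X: "is_monoid X" "homomorphic W \<phi> X g" and Z: "is_monoid Z" "u \<in> hom C (mcarr Z) (mcarr X)"
    and t: "homomorphic W \<phi> Z (act g u)"
  shows "strict_hom Z X u"
proof -
  have g: "g \<in> elt W \<phi> (mcarr X)" using P unfolding represents_def by blast
  have eq: "u = v" if "u \<in> hom C z (mcarr X)" "v \<in> hom C z (mcarr X)" "act g u = act g v" for u v z
    using P that act_elt[OF L(2,1) g that(1)] unfolding represents_def by metis
  note ZT = monoid_ty[OF Z(1)] and XT = monoid_ty[OF X(1)]
  have m: "mmult Z \<in> hom C (mcarr Z \<boxtimes> mcarr Z) (mcarr Z)" "munit Z \<in> hom C \<I> (mcarr Z)"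
    "mmult X \<in> hom C (mcarr X \<boxtimes> mcarr X) (mcarr X)" "munit X \<in> hom C \<I> (mcarr X)"
    using ZT XT by (simp_all add: hom_iff)
  have uu: "u \<otimes> u \<in> hom C (mcarr Z \<boxtimes> mcarr Z) (mcarr X \<boxtimes> mcarr X)" using Z by (simp add: hom_iff ty)
  have "act g (u \<cdot> mmult Z) = act g (mmult X \<cdot> (u \<otimes> u))"
    using act_act[OF g Z(2) m(1)] act_act[OF g m(3) uu] t X(2) eprod_act[OF L(1) g g Z(2) Z(2)]
    by (simp add: homomorphic_def)
  then have "u \<cdot> mmult Z = mmult X \<cdot> (u \<otimes> u)"
    by (rule eq[rotated 2]) (use Z ZT XT in \<open>auto simp: hom_iff ty\<close>)
  moreover have "act g (u \<cdot> munit Z) = act g (munit X)"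
    using act_act[OF g Z(2) m(2)] t X(2) by (simp add: homomorphic_def)
  then have "u \<cdot> munit Z = munit X"
    by (rule eq[rotated 2]) (use Z ZT XT in \<open>auto simp: hom_iff ty\<close>)
  ultimately show ?thesis using X Z by (simp add: strict_hom_def)
qed

definition free_on :: "'o \<Rightarrow> ('o, 'm) mon \<Rightarrow> 'm \<Rightarrow> bool" where
  "free_on z Z e \<longleftrightarrow> is_monoid Z \<and> e \<in> hom C z (mcarr Z) \<and>
     (\<forall>X. is_monoid X \<longrightarrow> (\<forall>v \<in> hom C z (mcarr X). \<exists>!u. strict_hom Z X u \<and> u \<cdot> e = v))"

text \<open>The universal property of the free monoid, applied to the monoid that represents the elements.\<close>

lemma free_elements:
  assumes L: "is_lax_mor \<phi>" "mbar \<phi> \<in> W" "mzero \<phi> \<in> W" and W: "closed_cells W" "has_commas W"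
    and Z: "free_on z Z e" and t0: "t0 \<in> elt W \<phi> z"
  shows "\<exists>!t. homomorphic W \<phi> Z t \<and> act t e = t0"
proof -
  have pl: "pre_lax \<phi>" using L by (simp add: is_lax_mor_iff)
  obtain P g where P: "represents W \<phi> P g" using commas_represent[OF W(2) pl] by blast
  obtain X where X: "is_monoid X" "mcarr X = P" "homomorphic W \<phi> X g"
    using representing_monoid[OF L W(1) P] by blast
  have g: "g \<in> elt W \<phi> P" and ex: "\<And>z t. t \<in> elt W \<phi> z \<Longrightarrow> \<exists>!u. u \<in> hom C z P \<and> act g u = t"
    using P unfolding represents_def by blast+
  obtain v where v: "v \<in> hom C z P" "act g v = t0" using ex[OF t0] by blast
  have e: "e \<in> hom C z (mcarr Z)" "is_monoid Z" using Z by (simp_all add: free_on_def)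
  obtain u where u: "strict_hom Z X u" "u \<cdot> e = v"
    using Z X v unfolding free_on_def by blast
  have uh: "u \<in> hom C (mcarr Z) P" using u X by (simp add: strict_hom_def)
  show ?thesis
  proof (intro ex1I[of _ "act g u"] conjI)
    show "homomorphic W \<phi> Z (act g u)" by (rule homomorphic_act[OF X(3) pl W(1) u(1)])
    show "act (act g u) e = t0" using act_act[OF g uh e(1)] u v by simp
  next
    fix t assume t: "homomorphic W \<phi> Z t \<and> act t e = t0"
    then obtain w where w: "w \<in> hom C (mcarr Z) P" "act g w = t"
      using ex[of t "mcarr Z"] by (auto simp: homomorphic_def)
    have "strict_hom Z X w"
      using strict_hom_if_homomorphic[OF pl W(1) _ X(1,3) e(2)] w t P X(2) by simp
    moreover have "act g (w \<cdot> e) = t0" using act_act[OF g w(1) e(1)] w t by simp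
    then have "w \<cdot> e = v" using ex[OF t0] v w(1) e(1) comp1_hom by blast
    ultimately have "w = u" using Z X(1,2) u v(1) unfolding free_on_def by blast
    then show "t = act g u" using w by simp
  qed
qed

text \<open>Homomorphic elements are monoid 2-cells, and these compose vertically on either side.\<close>

lemma homomorphic_precell:
  assumes t: "homomorphic UNIV \<phi> Z (a, b, h)" and L: "pre_lax \<phi>" and Z: "is_monoid Z"
    and k: "k \<in> Cell C" "dom1 C (dom2 C k) = mcarr Z" "cod2 C k = b"
      "k \<star> \<iota> (mmult Z) = \<iota> (mmult (mcod \<phi>)) \<star> (k \<circledast> k)" "k \<star> \<iota> (munit Z) = \<iota> (munit (mcod \<phi>))"
  shows "homomorphic UNIV \<phi> Z (a, dom2 C k, h \<bullet> k)"
proof -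
  define m n f fb where d: "m = mmult Z" "n = mmult (mcod \<phi>)" "f = mmap \<phi>" "fb = mbar \<phi>"
  note T = lax_ty[OF L, folded d] monoid_ty[OF Z, folded d]
  have h: "a \<in> Mor C" "dom1 C a = mcarr Z" "cod1 C a = mcarr (mdom \<phi>)"
    "b \<in> Mor C" "dom1 C b = mcarr Z" "cod1 C b = mcarr (mcod \<phi>)"
    "h \<in> Cell C" "dom2 C h = b" "cod2 C h = f \<cdot> a"
    using t by (auto simp: homomorphic_def elt_def hom_iff cells_iff d)
  have e: "a \<cdot> m = mmult (mdom \<phi>) \<cdot> (a \<otimes> a)" "b \<cdot> m = n \<cdot> (b \<otimes> b)"
    "h \<star> \<iota> m = (fb \<star> \<iota> (a \<otimes> a)) \<bullet> (\<iota> n \<star> (h \<circledast> h))"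
    "a \<cdot> munit Z = munit (mdom \<phi>)" "b \<cdot> munit Z = munit (mcod \<phi>)" "h \<star> \<iota> (munit Z) = mzero \<phi>"
    using t by (simp_all add: homomorphic_def eunit_def d)
  have k': "cod1 C (dom2 C k) = mcarr (mcod \<phi>)" using k h(6) mor_ty(4)[of k] by simp
  note K = k[folded d] k'
  have "dom2 C (k \<star> \<iota> m) = dom2 C (\<iota> n \<star> (k \<circledast> k))" "dom2 C (k \<star> \<iota> (munit Z)) = dom2 C (\<iota> (munit (mcod \<phi>)))"
    using K by simp_all
  then have dk: "dom2 C k \<cdot> m = n \<cdot> (dom2 C k \<otimes> dom2 C k)" "dom2 C k \<cdot> munit Z = munit (mcod \<phi>)"
    using K(1-3,6) T by (simp_all add: ty)
  have "(h \<bullet> k) \<star> \<iota> m = (h \<star> \<iota> m) \<bullet> (k \<star> \<iota> m)" using K T h by (simp add: ty)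
  also have "\<dots> = (fb \<star> \<iota> (a \<otimes> a)) \<bullet> (\<iota> n \<star> ((h \<bullet> k) \<circledast> (h \<bullet> k)))"
    using K T h by (simp add: e ty tensor_vcomp tensor_comp1)
  finally have 1: "(h \<bullet> k) \<star> \<iota> m = (fb \<star> \<iota> (a \<otimes> a)) \<bullet> (\<iota> n \<star> ((h \<bullet> k) \<circledast> (h \<bullet> k)))" .
  have 2: "(h \<bullet> k) \<star> \<iota> (munit Z) = mzero \<phi>" using K T h e by (simp add: ty)
  have "(a, dom2 C k, h \<bullet> k) \<in> elt UNIV \<phi> (mcarr Z)"
    using K h by (simp add: elt_def hom_iff cells_iff ty d)
  then show ?thesis using 1 2 e dk by (simp add: homomorphic_def eunit_def d)
qed

lemma homomorphic_postcell:
  assumes t: "homomorphic UNIV \<phi> Z (a, b, h)" and L: "pre_lax \<phi>" "pre_lax \<psi>" and Z: "is_monoid Z"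
    and same: "mdom \<psi> = mdom \<phi>" "mcod \<psi> = mcod \<phi>"
    and \<alpha>: "\<alpha> \<in> cells C (mmap \<phi>) (mmap \<psi>)"
      "(\<alpha> \<star> \<iota> (mmult (mdom \<phi>))) \<bullet> mbar \<phi> = mbar \<psi> \<bullet> (\<iota> (mmult (mcod \<phi>)) \<star> (\<alpha> \<circledast> \<alpha>))"
      "(\<alpha> \<star> \<iota> (munit (mdom \<phi>))) \<bullet> mzero \<phi> = mzero \<psi>"
  shows "homomorphic UNIV \<psi> Z (a, b, (\<alpha> \<star> \<iota> a) \<bullet> h)"
proof -
  define m l n f fb g gb i j where d: "m = mmult Z" "l = mmult (mdom \<phi>)" "n = mmult (mcod \<phi>)" "f = mmap \<phi>"
    "fb = mbar \<phi>" "g = mmap \<psi>" "gb = mbar \<psi>" "i = munit (mdom \<phi>)" "j = munit (mcod \<phi>)"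
  note T = lax_ty[OF L(1), folded d] lax_ty[OF L(2), unfolded same, folded d] monoid_ty[OF Z, folded d]
  have h: "a \<in> Mor C" "dom1 C a = mcarr Z" "cod1 C a = mcarr (mdom \<phi>)"
    "b \<in> Mor C" "dom1 C b = mcarr Z" "cod1 C b = mcarr (mcod \<phi>)"
    "h \<in> Cell C" "dom2 C h = b" "cod2 C h = f \<cdot> a"
    using t by (auto simp: homomorphic_def elt_def hom_iff cells_iff d)
  have e: "a \<cdot> m = l \<cdot> (a \<otimes> a)" "b \<cdot> m = n \<cdot> (b \<otimes> b)"
    "h \<star> \<iota> m = (fb \<star> \<iota> (a \<otimes> a)) \<bullet> (\<iota> n \<star> (h \<circledast> h))"
    "a \<cdot> munit Z = i" "b \<cdot> munit Z = j" "h \<star> \<iota> (munit Z) = mzero \<phi>"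
    using t by (simp_all add: homomorphic_def eunit_def d)
  have k: "\<alpha> \<in> Cell C" "dom2 C \<alpha> = f" "cod2 C \<alpha> = g" using \<alpha>(1) by (simp_all add: cells_iff d)
  have "((\<alpha> \<star> \<iota> a) \<bullet> h) \<star> \<iota> m = (\<alpha> \<star> \<iota> (a \<cdot> m)) \<bullet> (h \<star> \<iota> m)"
    using k T h by (simp add: ty)
  also have "\<dots> = ((\<alpha> \<star> \<iota> l) \<star> \<iota> (a \<otimes> a)) \<bullet> (fb \<star> \<iota> (a \<otimes> a)) \<bullet> (\<iota> n \<star> (h \<circledast> h))"
    using k T h by (simp add: ty e)
  also have "\<dots> = (((\<alpha> \<star> \<iota> l) \<bullet> fb) \<star> \<iota> (a \<otimes> a)) \<bullet> (\<iota> n \<star> (h \<circledast> h))"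
    using k T h by (simp add: ty tensor_comp1)
  also have "\<dots> = ((gb \<star> \<iota> (a \<otimes> a)) \<bullet> ((\<iota> n \<star> (\<alpha> \<circledast> \<alpha>)) \<star> \<iota> (a \<otimes> a))) \<bullet> (\<iota> n \<star> (h \<circledast> h))"
    using k T h by (simp add: \<alpha>(2)[folded d] whisker_vcomp(1) ty tensor_comp1)
  also have "\<dots> = (gb \<star> \<iota> (a \<otimes> a)) \<bullet> (\<iota> n \<star> (((\<alpha> \<star> \<iota> a) \<bullet> h) \<circledast> ((\<alpha> \<star> \<iota> a) \<bullet> h)))"
    using k T h by (simp add: ty tensor_comp1 tensor_vcomp tensor_whisker)
  finally have 1: "((\<alpha> \<star> \<iota> a) \<bullet> h) \<star> \<iota> m
      = (gb \<star> \<iota> (a \<otimes> a)) \<bullet> (\<iota> n \<star> (((\<alpha> \<star> \<iota> a) \<bullet> h) \<circledast> ((\<alpha> \<star> \<iota> a) \<bullet> h)))" .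
  have 2: "((\<alpha> \<star> \<iota> a) \<bullet> h) \<star> \<iota> (munit Z) = mzero \<psi>"
    using k T h e \<alpha>(3)[folded d] by (simp add: ty)
  have "(a, b, (\<alpha> \<star> \<iota> a) \<bullet> h) \<in> elt UNIV \<psi> (mcarr Z)"
    using k T h by (simp add: elt_def hom_iff cells_iff ty same d[symmetric])
  then show ?thesis using 1 2 e by (simp add: homomorphic_def eunit_def same d)
qed

end

section \<open>Transport of 2-category structure along a bijection\<close>

text \<open>A bijection that respects the operations carries the 2-category axioms from \<open>B\<close> to
  \<open>A\<close>, so they need not be verified for \<open>A\<close> separately.\<close>

locale two_cat_iso = B: two_category B
  for B :: "('o1, 'm1, 'c1) two_cat" and A :: "('o2, 'm2, 'c2) two_cat"
    and G :: "('o1, 'm1, 'c1, 'o2, 'm2, 'c2) two_fun" +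
  assumes bij_obj: "bij_betw (on_obj G) (Obj B) (Obj A)"
    and bij_mor: "bij_betw (on_mor G) (Mor B) (Mor A)"
    and bij_cell: "bij_betw (on_cell G) (Cell B) (Cell A)"
    and G_dom1: "f \<in> Mor B \<Longrightarrow> dom1 A (on_mor G f) = on_obj G (dom1 B f)"
    and G_cod1: "f \<in> Mor B \<Longrightarrow> cod1 A (on_mor G f) = on_obj G (cod1 B f)"
    and G_dom2: "\<alpha> \<in> Cell B \<Longrightarrow> dom2 A (on_cell G \<alpha>) = on_mor G (dom2 B \<alpha>)"
    and G_cod2: "\<alpha> \<in> Cell B \<Longrightarrow> cod2 A (on_cell G \<alpha>) = on_mor G (cod2 B \<alpha>)"
    and G_id1: "x \<in> Obj B \<Longrightarrow> id1 A (on_obj G x) = on_mor G (id1 B x)"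
    and G_id2: "f \<in> Mor B \<Longrightarrow> id2 A (on_mor G f) = on_cell G (id2 B f)"
    and G_comp1: "\<lbrakk>f \<in> Mor B; g \<in> Mor B; dom1 B g = cod1 B f\<rbrakk> \<Longrightarrow>
          comp1 A (on_mor G g) (on_mor G f) = on_mor G (comp1 B g f)"
    and G_vcomp: "\<lbrakk>\<alpha> \<in> Cell B; \<beta> \<in> Cell B; dom2 B \<beta> = cod2 B \<alpha>\<rbrakk> \<Longrightarrow>
          vcomp A (on_cell G \<beta>) (on_cell G \<alpha>) = on_cell G (vcomp B \<beta> \<alpha>)"
    and G_hcomp: "\<lbrakk>\<alpha> \<in> Cell B; \<beta> \<in> Cell B; dom1 B (dom2 B \<beta>) = cod1 B (dom2 B \<alpha>)\<rbrakk> \<Longrightarrow>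
          hcomp A (on_cell G \<beta>) (on_cell G \<alpha>) = on_cell G (hcomp B \<beta> \<alpha>)"
begin

lemma carriers: "Obj A = on_obj G ` Obj B" "Mor A = on_mor G ` Mor B" "Cell A = on_cell G ` Cell B"
  using bij_obj bij_mor bij_cell by (simp_all add: bij_betw_def)

lemma inj_simps:
  "\<lbrakk>x \<in> Obj B; y \<in> Obj B\<rbrakk> \<Longrightarrow> on_obj G x = on_obj G y \<longleftrightarrow> x = y"
  "\<lbrakk>f \<in> Mor B; g \<in> Mor B\<rbrakk> \<Longrightarrow> on_mor G f = on_mor G g \<longleftrightarrow> f = g"
  "\<lbrakk>\<alpha> \<in> Cell B; \<beta> \<in> Cell B\<rbrakk> \<Longrightarrow> on_cell G \<alpha> = on_cell G \<beta> \<longleftrightarrow> \<alpha> = \<beta>"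
  using bij_obj bij_mor bij_cell by (auto simp: bij_betw_def dest: inj_onD)

lemmas G_simps = G_dom1 G_cod1 G_dom2 G_cod2 G_id1 G_id2 G_comp1 G_vcomp G_hcomp inj_simps

lemma cells_G:
  assumes "f \<in> Mor B" "g \<in> Mor B"
  shows "cells A (on_mor G f) (on_mor G g) = on_cell G ` cells B f g"
  using assms by (auto simp: carriers cells_def G_simps ty)

lemma two_category_A: "two_category A"
proof
  have globular: "dom1 B (dom2 B \<beta>) = dom1 B (dom2 B \<alpha>)" "cod1 B (dom2 B \<beta>) = cod1 B (dom2 B \<alpha>)"
    if "\<alpha> \<in> Cell B" "\<beta> \<in> Cell B" "dom2 B \<beta> = cod2 B \<alpha>" for \<alpha> \<beta>
    using that by (simp_all add: ty)
  show "hcomp A (vcomp A \<beta>' \<beta>) (vcomp A \<alpha>' \<alpha>) = vcomp A (hcomp A \<beta>' \<alpha>') (hcomp A \<beta> \<alpha>)"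
    if "f \<in> hom A x y" "g \<in> hom A y z" "\<alpha> \<in> cells A f f'" "\<alpha>' \<in> cells A f' f''"
      "\<beta> \<in> cells A g g'" "\<beta>' \<in> cells A g' g''" for f g x y z \<alpha> \<alpha>' \<beta> \<beta>' f' f'' g' g''
    using that
    by (auto simp: carriers hom_def cells_def G_simps ty B.interchange' intro!: inj_simps[THEN iffD2])
qed (auto simp: carriers hom_def cells_def G_simps ty)

interpretation A: two_category A by (rule two_category_A)

lemma two_functor_G: "two_functor B A G"
  by unfold_locales (auto simp: carriers hom_def cells_def G_simps ty)

definition inverse_functor :: "('o2, 'm2, 'c2, 'o1, 'm1, 'c1) two_fun" where
  "inverse_functor = \<lparr>on_obj = the_inv_into (Obj B) (on_obj G), on_mor = the_inv_into (Mor B) (on_mor G),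
     on_cell = the_inv_into (Cell B) (on_cell G)\<rparr>"

lemma inverse_functor_G:
  "x \<in> Obj B \<Longrightarrow> on_obj inverse_functor (on_obj G x) = x"
  "f \<in> Mor B \<Longrightarrow> on_mor inverse_functor (on_mor G f) = f"
  "\<alpha> \<in> Cell B \<Longrightarrow> on_cell inverse_functor (on_cell G \<alpha>) = \<alpha>"
  using bij_obj bij_mor bij_cell
  by (simp_all add: inverse_functor_def bij_betw_def the_inv_into_f_f)

lemma two_functor_inverse: "two_functor A B inverse_functor"
  by unfold_locales (auto simp: carriers hom_def cells_def G_simps ty inverse_functor_G)

end

lemma two_functor_cong:
  assumes "two_functor A B F" "fun_eq_on A F G"
  shows "two_functor A B G"
proof -
  interpret two_functor A B F by fact
  have e: "x \<in> Obj A \<Longrightarrow> on_obj G x = on_obj F x" "f \<in> Mor A \<Longrightarrow> on_mor G f = on_mor F f"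
    "\<alpha> \<in> Cell A \<Longrightarrow> on_cell G \<alpha> = on_cell F \<alpha>" for x f \<alpha>
    using assms(2) by (auto simp: fun_eq_on_def)
  show ?thesis
  proof
    show "on_cell G (hcomp A \<beta> \<alpha>) = hcomp B (on_cell G \<beta>) (on_cell G \<alpha>)"
      if "f \<in> hom A x y" "g \<in> hom A y z" "\<alpha> \<in> cells A f f'" "\<beta> \<in> cells A g g'" for f g x y z \<alpha> \<beta> f' g'
      using that A.hcomp_cells[OF that] pres_hcomp[OF that] by (auto simp: cells_def e)
    show "on_cell G (vcomp A \<beta> \<alpha>) = vcomp B (on_cell G \<beta>) (on_cell G \<alpha>)"
      if "\<alpha> \<in> cells A f g" "\<beta> \<in> cells A g h" for \<alpha> \<beta> f g h
      using that A.vcomp_cells[OF that] pres_vcomp[OF that] by (auto simp: cells_def e)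
    show "on_mor G (comp1 A g f) = comp1 B (on_mor G g) (on_mor G f)"
      if "f \<in> hom A x y" "g \<in> hom A y z" for f g x y z
      using that A.comp1_hom[OF that] pres_comp1[OF that] by (auto simp: hom_def e)
    show "on_mor G f \<in> hom B (on_obj G x) (on_obj G y)" if "f \<in> hom A x y" for f x y
      using that mor[OF that] by (auto simp: A.hom_iff e ty)
    show "on_cell G \<alpha> \<in> cells B (on_mor G f) (on_mor G g)" if "\<alpha> \<in> cells A f g" for \<alpha> f g
      using that cell[OF that] by (auto simp: A.cells_iff e ty)
  qed (auto simp: e obj pres_id1 pres_id2 ty)
qed

lemma two_functor_comp:
  assumes "two_functor A B F" "two_functor B D G"
  shows "two_functor A D (comp_fun G F)"
proof -
  interpret F: two_functor A B F by fact
  interpret G: two_functor B D G by fact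
  show ?thesis
  proof
    show "on_cell (comp_fun G F) (hcomp A \<beta> \<alpha>) = hcomp D (on_cell (comp_fun G F) \<beta>) (on_cell (comp_fun G F) \<alpha>)"
      if "f \<in> hom A x y" "g \<in> hom A y z" "\<alpha> \<in> cells A f f'" "\<beta> \<in> cells A g g'" for f g x y z \<alpha> \<beta> f' g'
      using F.pres_hcomp[OF that] G.pres_hcomp[OF F.mor[OF that(1)] F.mor[OF that(2)] F.cell[OF that(3)] F.cell[OF that(4)]]
      by (simp add: comp_fun_def)
    show "on_cell (comp_fun G F) (vcomp A \<beta> \<alpha>) = vcomp D (on_cell (comp_fun G F) \<beta>) (on_cell (comp_fun G F) \<alpha>)"
      if "\<alpha> \<in> cells A f g" "\<beta> \<in> cells A g h" for \<alpha> \<beta> f g h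
      using F.pres_vcomp[OF that] G.pres_vcomp[OF F.cell[OF that(1)] F.cell[OF that(2)]] by (simp add: comp_fun_def)
    show "on_mor (comp_fun G F) (comp1 A g f) = comp1 D (on_mor (comp_fun G F) g) (on_mor (comp_fun G F) f)"
      if "f \<in> hom A x y" "g \<in> hom A y z" for f g x y z
      using F.pres_comp1[OF that] G.pres_comp1[OF F.mor[OF that(1)] F.mor[OF that(2)]] by (simp add: comp_fun_def)
    show "on_cell (comp_fun G F) (id2 A f) = id2 D (on_mor (comp_fun G F) f)" if "f \<in> Mor A" for f
      using F.pres_id2[OF that] G.pres_id2[of "on_mor F f"] F.mor[of f "dom1 A f" "cod1 A f"] that
      by (simp add: comp_fun_def hom_def)
  qed (auto simp: comp_fun_def F.obj G.obj F.pres_id1 G.pres_id1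
      intro: F.mor G.mor F.cell G.cell)
qed

lemma two_functor_id_fun:
  assumes "two_category C"
  shows "two_functor C C id_fun"
proof -
  interpret two_category C by fact
  show ?thesis by unfold_locales (auto simp: id_fun_def)
qed

lemma f_category_all_tight:
  assumes "two_category C"
  shows "f_category (all_tight C)"
  using two_functor_id_fun[OF assms]
  by (intro f_category.intro f_category_axioms.intro) (simp_all add: all_tight_def id_fun_def bij_betw_def)

section \<open>The 2-category of algebras\<close>

context two_monad
begin

lemma T_ty [ty]:
  "x \<in> Obj C \<Longrightarrow> T\<^sub>0 x \<in> Obj C"
  "f \<in> Mor C \<Longrightarrow> T\<^sub>1 f \<in> Mor C" "f \<in> Mor C \<Longrightarrow> dom1 C (T\<^sub>1 f) = T\<^sub>0 (dom1 C f)"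
  "f \<in> Mor C \<Longrightarrow> cod1 C (T\<^sub>1 f) = T\<^sub>0 (cod1 C f)"
  "\<alpha> \<in> Cell C \<Longrightarrow> T\<^sub>2 \<alpha> \<in> Cell C" "\<alpha> \<in> Cell C \<Longrightarrow> dom2 C (T\<^sub>2 \<alpha>) = T\<^sub>1 (dom2 C \<alpha>)"
  "\<alpha> \<in> Cell C \<Longrightarrow> cod2 C (T\<^sub>2 \<alpha>) = T\<^sub>1 (cod2 C \<alpha>)"
  using mult.G.obj mult.G.mor[of f "dom1 C f" "cod1 C f"] mult.G.cell[of \<alpha> "dom2 C \<alpha>" "cod2 C \<alpha>"]
  by (simp_all add: hom_iff cells_iff)

lemma T_pres [ty]:
  "x \<in> Obj C \<Longrightarrow> T\<^sub>1 (\<one> x) = \<one> (T\<^sub>0 x)"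
  "\<lbrakk>f \<in> Mor C; g \<in> Mor C; dom1 C g = cod1 C f\<rbrakk> \<Longrightarrow> T\<^sub>1 (g \<cdot> f) = T\<^sub>1 g \<cdot> T\<^sub>1 f"
  "f \<in> Mor C \<Longrightarrow> T\<^sub>2 (\<iota> f) = \<iota> (T\<^sub>1 f)"
  "\<lbrakk>\<alpha> \<in> Cell C; \<beta> \<in> Cell C; dom2 C \<beta> = cod2 C \<alpha>\<rbrakk> \<Longrightarrow> T\<^sub>2 (\<beta> \<bullet> \<alpha>) = T\<^sub>2 \<beta> \<bullet> T\<^sub>2 \<alpha>"
  "\<lbrakk>\<alpha> \<in> Cell C; \<beta> \<in> Cell C; dom1 C (dom2 C \<beta>) = cod1 C (dom2 C \<alpha>)\<rbrakk> \<Longrightarrow> T\<^sub>2 (\<beta> \<star> \<alpha>) = T\<^sub>2 \<beta> \<star> T\<^sub>2 \<alpha>"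
  using mult.G.pres_id1 mult.G.pres_comp1[of f _ _ g] mult.G.pres_id2 mult.G.pres_vcomp[of \<alpha> _ _ \<beta>]
    mult.G.pres_hcomp[of "dom2 C \<alpha>" _ _ "dom2 C \<beta>" _ \<alpha> _ \<beta>]
  by (simp_all add: hom_iff cells_iff ty)

lemma monad_ty [ty]:
  "x \<in> Obj C \<Longrightarrow> \<eta> x \<in> Mor C" "x \<in> Obj C \<Longrightarrow> dom1 C (\<eta> x) = x" "x \<in> Obj C \<Longrightarrow> cod1 C (\<eta> x) = T\<^sub>0 x"
  "x \<in> Obj C \<Longrightarrow> \<mu> x \<in> Mor C" "x \<in> Obj C \<Longrightarrow> dom1 C (\<mu> x) = T\<^sub>0 (T\<^sub>0 x)" "x \<in> Obj C \<Longrightarrow> cod1 C (\<mu> x) = T\<^sub>0 x"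
  using unit.component[of x] mult.component[of x] by (simp_all add: hom_iff id_fun_def comp_fun_def)

lemma unit_nat:
  "\<lbrakk>f \<in> Mor C; dom1 C f = x\<rbrakk> \<Longrightarrow> T\<^sub>1 f \<cdot> \<eta> x = \<eta> (cod1 C f) \<cdot> f"
  "\<lbrakk>\<alpha> \<in> Cell C; dom1 C (dom2 C \<alpha>) = x\<rbrakk> \<Longrightarrow> T\<^sub>2 \<alpha> \<star> \<iota> (\<eta> x) = \<iota> (\<eta> (cod1 C (dom2 C \<alpha>))) \<star> \<alpha>"
  using unit.natural1[of f x "cod1 C f"] unit.natural2[of "dom2 C \<alpha>" x "cod1 C (dom2 C \<alpha>)" \<alpha> "cod2 C \<alpha>"]
  by (simp_all add: hom_iff cells_iff ty id_fun_def)

lemma mult_nat: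
  "\<lbrakk>f \<in> Mor C; dom1 C f = x\<rbrakk> \<Longrightarrow> T\<^sub>1 f \<cdot> \<mu> x = \<mu> (cod1 C f) \<cdot> T\<^sub>1 (T\<^sub>1 f)"
  "\<lbrakk>\<alpha> \<in> Cell C; dom1 C (dom2 C \<alpha>) = x\<rbrakk> \<Longrightarrow> T\<^sub>2 \<alpha> \<star> \<iota> (\<mu> x) = \<iota> (\<mu> (cod1 C (dom2 C \<alpha>))) \<star> T\<^sub>2 (T\<^sub>2 \<alpha>)"
  using mult.natural1[of f x "cod1 C f"] mult.natural2[of "dom2 C \<alpha>" x "cod1 C (dom2 C \<alpha>)" \<alpha> "cod2 C \<alpha>"]
  by (simp_all add: hom_iff cells_iff ty comp_fun_def)

lemma co_two_monad: "two_monad (co C) T"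
proof -
  interpret co: two_category "co C" by (rule co)
  interpret m: two_natural "co C" "co C" "comp_fun (endo T) (endo T)" "endo T" \<mu>
    by (rule co_two_natural) (rule mult.two_natural_axioms)
  interpret u: two_natural "co C" "co C" id_fun "endo T" \<eta>
    by (rule co_two_natural) (rule unit.two_natural_axioms)
  show ?thesis
    by unfold_locales (auto simp: mult_assoc mult_unit_right mult_unit_left)
qed

lemma colax_is_co_lax: "is_colax_mor \<phi> \<longleftrightarrow> two_monad.is_lax_mor (co C) T \<phi>"
  unfolding is_colax_mor_def two_monad.is_lax_mor_def[OF co_two_monad] is_alg_def
    two_monad.is_alg_def[OF co_two_monad] Let_def by simp

lemma co_is_alg: "two_monad.is_alg (co C) T = is_alg"
  unfolding is_alg_def two_monad.is_alg_def[OF co_two_monad] Let_def by simp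

lemma alg_ty:
  assumes "is_alg A"
  shows "acarr A \<in> Obj C" "aact A \<in> Mor C" "dom1 C (aact A) = T\<^sub>0 (acarr A)" "cod1 C (aact A) = acarr A"
  using assms by (auto simp: is_alg_def Let_def hom_iff)

lemma alg_laws:
  assumes "is_alg A"
  shows "aact A \<cdot> \<mu> (acarr A) = aact A \<cdot> T\<^sub>1 (aact A)" "aact A \<cdot> \<eta> (acarr A) = \<one> (acarr A)"
  using assms by (auto simp: is_alg_def Let_def)

lemma lax_mor_ty:
  assumes "is_lax_mor \<phi>"
  shows "is_alg (adom \<phi>)" "is_alg (acod \<phi>)"
    "acarr (adom \<phi>) \<in> Obj C" "aact (adom \<phi>) \<in> Mor C" "dom1 C (aact (adom \<phi>)) = T\<^sub>0 (acarr (adom \<phi>))"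
    "cod1 C (aact (adom \<phi>)) = acarr (adom \<phi>)"
    "acarr (acod \<phi>) \<in> Obj C" "aact (acod \<phi>) \<in> Mor C" "dom1 C (aact (acod \<phi>)) = T\<^sub>0 (acarr (acod \<phi>))"
    "cod1 C (aact (acod \<phi>)) = acarr (acod \<phi>)"
    "amap \<phi> \<in> Mor C" "dom1 C (amap \<phi>) = acarr (adom \<phi>)" "cod1 C (amap \<phi>) = acarr (acod \<phi>)"
    "abar \<phi> \<in> Cell C" "dom2 C (abar \<phi>) = aact (acod \<phi>) \<cdot> T\<^sub>1 (amap \<phi>)"
    "cod2 C (abar \<phi>) = amap \<phi> \<cdot> aact (adom \<phi>)"
proof -
  show *: "is_alg (adom \<phi>)" "is_alg (acod \<phi>)" using assms by (simp_all add: is_lax_mor_def)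
  show "acarr (adom \<phi>) \<in> Obj C" "aact (adom \<phi>) \<in> Mor C" "dom1 C (aact (adom \<phi>)) = T\<^sub>0 (acarr (adom \<phi>))"
    "cod1 C (aact (adom \<phi>)) = acarr (adom \<phi>)"
    "acarr (acod \<phi>) \<in> Obj C" "aact (acod \<phi>) \<in> Mor C" "dom1 C (aact (acod \<phi>)) = T\<^sub>0 (acarr (acod \<phi>))"
    "cod1 C (aact (acod \<phi>)) = acarr (acod \<phi>)"
    using alg_ty[OF *(1)] alg_ty[OF *(2)] by simp_all
qed (use assms in \<open>auto simp: is_lax_mor_def Let_def hom_iff cells_iff\<close>)

lemma lax_mor_laws:
  assumes "is_lax_mor \<phi>"
  shows "abar \<phi> \<star> \<iota> (\<mu> (acarr (adom \<phi>)))
      = (abar \<phi> \<star> \<iota> (T\<^sub>1 (aact (adom \<phi>)))) \<bullet> (\<iota> (aact (acod \<phi>)) \<star> T\<^sub>2 (abar \<phi>))"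
    "abar \<phi> \<star> \<iota> (\<eta> (acarr (adom \<phi>))) = \<iota> (amap \<phi>)"
  using assms by (simp_all add: is_lax_mor_def Let_def)

text \<open>The compatibility condition on algebra 2-cells between lax morphisms; the colax one is its
  instance in the 2-category with reversed 2-cells, with \<open>\<phi>\<close> and \<open>\<psi>\<close> exchanged.\<close>

definition cell_law :: "('o, 'm, 'c) alg_mor \<Rightarrow> ('o, 'm, 'c) alg_mor \<Rightarrow> 'c \<Rightarrow> bool" where
  "cell_law \<phi> \<psi> \<alpha> \<longleftrightarrow>
     (\<alpha> \<star> \<iota> (aact (adom \<phi>))) \<bullet> abar \<phi> = abar \<psi> \<bullet> (\<iota> (aact (acod \<phi>)) \<star> T\<^sub>2 \<alpha>)"

lemma is_cell_iff:
  "w \<noteq> Colax \<Longrightarrow> is_cell w \<theta> \<longleftrightarrow> is_mor w (adom2 \<theta>) \<and> is_mor w (acod2 \<theta>) \<and>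
     adom (acod2 \<theta>) = adom (adom2 \<theta>) \<and> acod (acod2 \<theta>) = acod (adom2 \<theta>) \<and>
     acell \<theta> \<in> cells C (amap (adom2 \<theta>)) (amap (acod2 \<theta>)) \<and> cell_law (adom2 \<theta>) (acod2 \<theta>) (acell \<theta>)"
  by (simp add: is_cell_def Let_def cell_law_def)

lemma comp_lax:
  assumes f: "is_lax_mor \<phi>" and g: "is_lax_mor \<psi>" and c: "adom \<psi> = acod \<phi>" and w: "w \<noteq> Colax"
  shows "is_lax_mor (alg_comp w \<psi> \<phi>)"
proof -
  define x a y b z c' f g fb gb where d: "x = acarr (adom \<phi>)" "a = aact (adom \<phi>)" "y = acarr (acod \<phi>)"
    "b = aact (acod \<phi>)" "z = acarr (acod \<psi>)" "c' = aact (acod \<psi>)" "f = amap \<phi>" "g = amap \<psi>"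
    "fb = abar \<phi>" "gb = abar \<psi>"
  note T = lax_mor_ty[OF f, folded d] lax_mor_ty[OF g, unfolded c, folded d]
  note F = lax_mor_laws[OF f, folded d] and G = lax_mor_laws[OF g, unfolded c, folded d]
  define hb where "hb = (\<iota> g \<star> fb) \<bullet> (gb \<star> \<iota> (T\<^sub>1 f))"
  have "hb \<star> \<iota> (\<mu> x) = (\<iota> g \<star> (fb \<star> \<iota> (\<mu> x))) \<bullet> (gb \<star> \<iota> (T\<^sub>1 f \<cdot> \<mu> x))"
    using T by (simp add: hb_def ty)
  also have "gb \<star> \<iota> (T\<^sub>1 f \<cdot> \<mu> x) = (gb \<star> \<iota> (\<mu> y)) \<star> \<iota> (T\<^sub>1 (T\<^sub>1 f))"
    using T by (simp add: ty mult_nat)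
  also have "(\<iota> g \<star> (fb \<star> \<iota> (\<mu> x))) \<bullet> \<dots>
      = (\<iota> g \<star> fb \<star> \<iota> (T\<^sub>1 a)) \<bullet> ((\<iota> (g \<cdot> b) \<star> T\<^sub>2 fb) \<bullet> (gb \<star> \<iota> (T\<^sub>1 b \<cdot> T\<^sub>1 (T\<^sub>1 f)))) \<bullet> (\<iota> c' \<star> T\<^sub>2 gb \<star> \<iota> (T\<^sub>1 (T\<^sub>1 f)))"
    unfolding F G using T by (simp add: ty)
  also have "(\<iota> (g \<cdot> b) \<star> T\<^sub>2 fb) \<bullet> (gb \<star> \<iota> (T\<^sub>1 b \<cdot> T\<^sub>1 (T\<^sub>1 f))) = gb \<star> T\<^sub>2 fb"
    using T hcomp_whisker(2)[of "T\<^sub>2 fb" gb] by (simp add: ty)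
  also have "\<dots> = (gb \<star> \<iota> (T\<^sub>1 f \<cdot> T\<^sub>1 a)) \<bullet> (\<iota> (c' \<cdot> T\<^sub>1 g) \<star> T\<^sub>2 fb)"
    using T hcomp_whisker(1)[of "T\<^sub>2 fb" gb] by (simp add: ty)
  also have "(\<iota> g \<star> fb \<star> \<iota> (T\<^sub>1 a)) \<bullet> \<dots> \<bullet> (\<iota> c' \<star> T\<^sub>2 gb \<star> \<iota> (T\<^sub>1 (T\<^sub>1 f)))
      = (hb \<star> \<iota> (T\<^sub>1 a)) \<bullet> (\<iota> c' \<star> T\<^sub>2 hb)"
    using T by (simp add: hb_def ty)
  finally have mu: "hb \<star> \<iota> (\<mu> x) = (hb \<star> \<iota> (T\<^sub>1 a)) \<bullet> (\<iota> c' \<star> T\<^sub>2 hb)" .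
  have "hb \<star> \<iota> (\<eta> x) = (\<iota> g \<star> (fb \<star> \<iota> (\<eta> x))) \<bullet> ((gb \<star> \<iota> (\<eta> y)) \<star> \<iota> f)"
    using T by (simp add: hb_def ty unit_nat)
  also have "\<dots> = \<iota> (g \<cdot> f)" unfolding F G using T by (simp add: ty)
  finally have eta: "hb \<star> \<iota> (\<eta> x) = \<iota> (g \<cdot> f)" .
  show ?thesis
    using mu eta T w unfolding is_lax_mor_def alg_comp_def Let_def
    by (simp add: d[symmetric] hb_def[symmetric] hom_iff cells_iff ty) (simp add: hb_def ty)
qed

lemma comp_assoc:
  assumes "is_lax_mor \<phi>" "is_lax_mor \<psi>" "is_lax_mor \<chi>" "adom \<psi> = acod \<phi>" "adom \<chi> = acod \<psi>" "w \<noteq> Colax"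
  shows "alg_comp w (alg_comp w \<chi> \<psi>) \<phi> = alg_comp w \<chi> (alg_comp w \<psi> \<phi>)"
  using assms(4-) lax_mor_ty[OF assms(1)] lax_mor_ty[OF assms(2)] lax_mor_ty[OF assms(3)]
  by (simp add: alg_comp_def Let_def ty)

lemma comp_id:
  assumes "is_lax_mor \<phi>" "w \<noteq> Colax"
  shows "alg_comp w \<phi> (alg_id (adom \<phi>)) = \<phi>" "alg_comp w (alg_id (acod \<phi>)) \<phi> = \<phi>"
  using assms(2) lax_mor_ty[OF assms(1)]
  by (cases \<phi>; simp add: alg_comp_def alg_id_def Let_def ty)+

lemma id_lax:
  assumes "is_alg A"
  shows "is_lax_mor (alg_id A)"
  using assms alg_ty[OF assms] alg_laws[OF assms]
  by (simp add: is_lax_mor_def alg_id_def Let_def hom_iff cells_iff ty)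

lemma cell_law_id: "is_lax_mor \<phi> \<Longrightarrow> cell_law \<phi> \<phi> (\<iota> (amap \<phi>))"
  using lax_mor_ty[of \<phi>] by (simp add: cell_law_def ty)

lemma cell_law_vcomp:
  assumes "is_lax_mor \<phi>" "is_lax_mor \<psi>" "is_lax_mor \<chi>" "adom \<psi> = adom \<phi>" "acod \<psi> = acod \<phi>"
    "adom \<chi> = adom \<phi>" "acod \<chi> = acod \<phi>"
    and \<alpha>: "\<alpha> \<in> cells C (amap \<phi>) (amap \<psi>)" "cell_law \<phi> \<psi> \<alpha>"
    and \<beta>: "\<beta> \<in> cells C (amap \<psi>) (amap \<chi>)" "cell_law \<psi> \<chi> \<beta>"
  shows "cell_law \<phi> \<chi> (\<beta> \<bullet> \<alpha>)"
proof -
  define x a y b where d: "x = acarr (adom \<phi>)" "a = aact (adom \<phi>)" "y = acarr (acod \<phi>)" "b = aact (acod \<phi>)"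
  note T = lax_mor_ty[OF assms(1), folded d] lax_mor_ty[OF assms(2), unfolded assms(4-), folded d]
    lax_mor_ty[OF assms(3), unfolded assms(4-), folded d] \<alpha>(1)[unfolded cells_iff] \<beta>(1)[unfolded cells_iff]
  have A: "(\<alpha> \<star> \<iota> a) \<bullet> abar \<phi> = abar \<psi> \<bullet> (\<iota> b \<star> T\<^sub>2 \<alpha>)" "(\<beta> \<star> \<iota> a) \<bullet> abar \<psi> = abar \<chi> \<bullet> (\<iota> b \<star> T\<^sub>2 \<beta>)"
    using \<alpha>(2) \<beta>(2) assms(4-7) by (simp_all add: cell_law_def d)
  have "((\<beta> \<bullet> \<alpha>) \<star> \<iota> a) \<bullet> abar \<phi> = (\<beta> \<star> \<iota> a) \<bullet> ((\<alpha> \<star> \<iota> a) \<bullet> abar \<phi>)" using T by (simp add: ty)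
  also have "\<dots> = ((\<beta> \<star> \<iota> a) \<bullet> abar \<psi>) \<bullet> (\<iota> b \<star> T\<^sub>2 \<alpha>)" unfolding A(1) using T by (simp add: ty)
  also have "\<dots> = abar \<chi> \<bullet> (\<iota> b \<star> T\<^sub>2 (\<beta> \<bullet> \<alpha>))" unfolding A(2) using T by (simp add: ty)
  finally show ?thesis by (simp add: cell_law_def d)
qed

text \<open>The cell \<open>\<alpha>\<close> is moved past the structure cell of \<open>\<phi>\<close> and \<open>\<beta>\<close> past that of
  \<open>\<psi>\<close>; interchange joins the two steps.\<close>

lemma cell_law_hcomp:
  assumes "is_lax_mor \<phi>" "is_lax_mor \<phi>'" "adom \<phi>' = adom \<phi>" "acod \<phi>' = acod \<phi>"
    and "is_lax_mor \<psi>" "is_lax_mor \<psi>'" "adom \<psi>' = adom \<psi>" "acod \<psi>' = acod \<psi>"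
    and c: "adom \<psi> = acod \<phi>" and w: "w \<noteq> Colax"
    and \<alpha>: "\<alpha> \<in> cells C (amap \<phi>) (amap \<phi>')" "cell_law \<phi> \<phi>' \<alpha>"
    and \<beta>: "\<beta> \<in> cells C (amap \<psi>) (amap \<psi>')" "cell_law \<psi> \<psi>' \<beta>"
  shows "cell_law (alg_comp w \<psi> \<phi>) (alg_comp w \<psi>' \<phi>') (\<beta> \<star> \<alpha>)"
proof -
  define x a y b z e f g f' g' fb gb fb' gb' where d: "x = acarr (adom \<phi>)" "a = aact (adom \<phi>)" "y = acarr (acod \<phi>)" "b = aact (acod \<phi>)"
    "z = acarr (acod \<psi>)" "e = aact (acod \<psi>)" "f = amap \<phi>" "g = amap \<psi>" "f' = amap \<phi>'" "g' = amap \<psi>'"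
    "fb = abar \<phi>" "gb = abar \<psi>" "fb' = abar \<phi>'" "gb' = abar \<psi>'"
  note T = lax_mor_ty[OF assms(1), folded d] lax_mor_ty[OF assms(2), unfolded assms(3,4), folded d]
    lax_mor_ty[OF assms(5), unfolded c, folded d] lax_mor_ty[OF assms(6), unfolded assms(7,8) c, folded d]
    \<alpha>(1)[unfolded cells_iff, folded d] \<beta>(1)[unfolded cells_iff, folded d]
  have A: "(\<alpha> \<star> \<iota> a) \<bullet> fb = fb' \<bullet> (\<iota> b \<star> T\<^sub>2 \<alpha>)" "(\<beta> \<star> \<iota> b) \<bullet> gb = gb' \<bullet> (\<iota> e \<star> T\<^sub>2 \<beta>)"
    using \<alpha>(2) \<beta>(2) c by (simp_all add: cell_law_def d)
  have "((\<beta> \<star> \<alpha>) \<star> \<iota> a) \<bullet> (\<iota> g \<star> fb) = \<beta> \<star> ((\<alpha> \<star> \<iota> a) \<bullet> fb)"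
    using T interchange'[of fb "\<alpha> \<star> \<iota> a" "\<iota> g" \<beta>] by (simp add: ty)
  also have "\<dots> = (\<iota> g' \<star> fb') \<bullet> ((\<beta> \<star> \<iota> b) \<star> T\<^sub>2 \<alpha>)"
    unfolding A using T interchange'[of "\<iota> b \<star> T\<^sub>2 \<alpha>" fb' \<beta> "\<iota> g'"] by (simp add: ty)
  finally have 1: "((\<beta> \<star> \<alpha>) \<star> \<iota> a) \<bullet> (\<iota> g \<star> fb) = (\<iota> g' \<star> fb') \<bullet> ((\<beta> \<star> \<iota> b) \<star> T\<^sub>2 \<alpha>)" .
  have "((\<beta> \<star> \<iota> b) \<star> T\<^sub>2 \<alpha>) \<bullet> (gb \<star> \<iota> (T\<^sub>1 f)) = ((\<beta> \<star> \<iota> b) \<bullet> gb) \<star> T\<^sub>2 \<alpha>"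
    using T interchange'[of "\<iota> (T\<^sub>1 f)" "T\<^sub>2 \<alpha>" gb "\<beta> \<star> \<iota> b"] by (simp add: ty)
  also have "\<dots> = (gb' \<star> \<iota> (T\<^sub>1 f')) \<bullet> (\<iota> e \<star> T\<^sub>2 (\<beta> \<star> \<alpha>))"
    unfolding A using T interchange'[of "T\<^sub>2 \<alpha>" "\<iota> (T\<^sub>1 f')" "\<iota> e \<star> T\<^sub>2 \<beta>" gb'] by (simp add: ty)
  finally have 2: "((\<beta> \<star> \<iota> b) \<star> T\<^sub>2 \<alpha>) \<bullet> (gb \<star> \<iota> (T\<^sub>1 f)) = (gb' \<star> \<iota> (T\<^sub>1 f')) \<bullet> (\<iota> e \<star> T\<^sub>2 (\<beta> \<star> \<alpha>))" .
  have "((\<beta> \<star> \<alpha>) \<star> \<iota> a) \<bullet> (\<iota> g \<star> fb) \<bullet> (gb \<star> \<iota> (T\<^sub>1 f))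
      = (((\<beta> \<star> \<alpha>) \<star> \<iota> a) \<bullet> (\<iota> g \<star> fb)) \<bullet> (gb \<star> \<iota> (T\<^sub>1 f))"
    using T by (simp add: ty)
  also have "\<dots> = (\<iota> g' \<star> fb') \<bullet> (((\<beta> \<star> \<iota> b) \<star> T\<^sub>2 \<alpha>) \<bullet> (gb \<star> \<iota> (T\<^sub>1 f)))"
    unfolding 1 using T by (simp add: ty)
  also have "\<dots> = ((\<iota> g' \<star> fb') \<bullet> (gb' \<star> \<iota> (T\<^sub>1 f'))) \<bullet> (\<iota> e \<star> T\<^sub>2 (\<beta> \<star> \<alpha>))"
    unfolding 2 using T by (simp add: ty)
  finally show ?thesis using w by (simp add: cell_law_def alg_comp_def Let_def d)
qed

lemma is_mor_lax: "is_mor w \<phi> \<Longrightarrow> w \<noteq> Colax \<Longrightarrow> is_lax_mor \<phi>"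
  by (cases w) auto

lemma is_mor_comp:
  assumes f: "is_mor w \<phi>" and g: "is_mor w \<psi>" and c: "adom \<psi> = acod \<phi>" and w: "w \<noteq> Colax"
  shows "is_mor w (alg_comp w \<psi> \<phi>)"
proof -
  note L = is_mor_lax[OF f w] is_mor_lax[OF g w]
  note T = lax_mor_ty[OF L(1)] lax_mor_ty[OF L(2), unfolded c]
  note K = comp_lax[OF L c w]
  show ?thesis
  proof (cases w)
    case Strict
    with f g obtain k l where k: "k \<in> Mor C" "abar \<phi> = \<iota> k" "l \<in> Mor C" "abar \<psi> = \<iota> l"
      by (auto simp: identity2_def)
    then have dk: "k = aact (acod \<phi>) \<cdot> T\<^sub>1 (amap \<phi>)" "k = amap \<phi> \<cdot> aact (adom \<phi>)"
      "l = aact (acod \<psi>) \<cdot> T\<^sub>1 (amap \<psi>)" "l = amap \<psi> \<cdot> aact (acod \<phi>)" using T by (simp_all add: ty)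
    have "l \<cdot> T\<^sub>1 (amap \<phi>) = amap \<psi> \<cdot> k" unfolding dk(1) dk(4) using T by (simp add: ty)
    moreover have "dom1 C l = T\<^sub>0 (acarr (acod \<phi>))" "cod1 C k = acarr (acod \<phi>)" using T dk by (simp_all add: ty)
    ultimately have "abar (alg_comp w \<psi> \<phi>) = \<iota> (amap \<psi> \<cdot> k)" "amap \<psi> \<cdot> k \<in> Mor C"
      using k T w by (simp_all add: alg_comp_def Let_def ty)
    then show ?thesis using K Strict by (auto simp: identity2_def)
  next
    case Pseudo
    with f g obtain k l where k: "inverse2 C (abar \<phi>) k" "inverse2 C (abar \<psi>) l"
      by (auto simp: iso2_def)
    have "inverse2 C ((\<iota> (amap \<psi>) \<star> abar \<phi>) \<bullet> (abar \<psi> \<star> \<iota> (T\<^sub>1 (amap \<phi>))))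
        ((l \<star> \<iota> (T\<^sub>1 (amap \<phi>))) \<bullet> (\<iota> (amap \<psi>) \<star> k))"
      using T k by (intro inverse2_vcomp inverse2_hcomp inverse2_id2) (simp_all add: ty)
    then show ?thesis using K Pseudo by (auto simp: iso2_def alg_comp_def Let_def)
  qed (use K w in auto)
qed

lemma is_mor_id:
  assumes "is_alg A" "w \<noteq> Colax"
  shows "is_mor w (alg_id A)"
  using assms id_lax[OF assms(1)] alg_ty[OF assms(1)]
  by (cases w) (auto simp: identity2_def iso2_def alg_id_def intro: inverse2_id2)

lemma two_category_Alg_lax:
  assumes w: "w \<noteq> Colax"
  shows "two_category (Alg w)"
proof
  note S = Alg_def hom_def cells_def
  show "hcomp (Alg w) (vcomp (Alg w) \<beta>' \<beta>) (vcomp (Alg w) \<alpha>' \<alpha>)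
      = vcomp (Alg w) (hcomp (Alg w) \<beta>' \<alpha>') (hcomp (Alg w) \<beta> \<alpha>)"
    if "f \<in> hom (Alg w) x y" "g \<in> hom (Alg w) y z" "\<alpha> \<in> cells (Alg w) f f'" "\<alpha>' \<in> cells (Alg w) f' f''"
      "\<beta> \<in> cells (Alg w) g g'" "\<beta>' \<in> cells (Alg w) g' g''" for f g x y z \<alpha> \<alpha>' \<beta> \<beta>' f' f'' g' g''
    using that w is_mor_lax[of w f] is_mor_lax[of w g] lax_mor_ty[of f] lax_mor_ty[of g]
    by (auto simp: S is_cell_iff intro!: interchange')
  show "hcomp (Alg w) \<beta> \<alpha> \<in> cells (Alg w) (comp1 (Alg w) g f) (comp1 (Alg w) g' f')"
    if "f \<in> hom (Alg w) x y" "g \<in> hom (Alg w) y z" "\<alpha> \<in> cells (Alg w) f f'" "\<beta> \<in> cells (Alg w) g g'"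
    for f g x y z \<alpha> \<beta> f' g'
  proof -
    have m: "is_mor w f" "is_mor w g" "is_mor w f'" "is_mor w g'" and c: "adom g = acod f"
      "adom f' = adom f" "acod f' = acod f" "adom g' = adom g" "acod g' = acod g"
      and k: "acell \<alpha> \<in> cells C (amap f) (amap f')" "cell_law f f' (acell \<alpha>)"
        "acell \<beta> \<in> cells C (amap g) (amap g')" "cell_law g g' (acell \<beta>)"
      and e: "adom2 \<alpha> = f" "acod2 \<alpha> = f'" "adom2 \<beta> = g" "acod2 \<beta> = g'"
      using that w by (auto simp: S is_cell_iff)
    note L = m[THEN is_mor_lax, OF w]
    note T = lax_mor_ty[OF L(1)] lax_mor_ty[OF L(2)]
    have "cell_law (alg_comp w g f) (alg_comp w g' f') (acell \<beta> \<star> acell \<alpha>)"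
      using cell_law_hcomp[OF L(1,3) c(2,3) L(2,4) c(4,5) c(1) w k] .
    moreover have "acell \<beta> \<star> acell \<alpha> \<in> cells C (amap g \<cdot> amap f) (amap g' \<cdot> amap f')"
      using hcomp_cells[OF _ _ k(1,3)] T c by (simp add: S(2))
    moreover have "is_mor w (alg_comp w g f)" "is_mor w (alg_comp w g' f')"
      using is_mor_comp[OF m(1,2) c(1) w] is_mor_comp[OF m(3,4) _ w] c by simp_all
    moreover have "amap (alg_comp w g f) = amap g \<cdot> amap f" "adom (alg_comp w g f) = adom f"
      "acod (alg_comp w g f) = acod g" for g f by (simp_all add: alg_comp_def Let_def)
    ultimately show ?thesis using w c by (simp add: S(1,3) is_cell_iff e)
  qed
  show "vcomp (Alg w) \<beta> \<alpha> \<in> cells (Alg w) f h" if "\<alpha> \<in> cells (Alg w) f g" "\<beta> \<in> cells (Alg w) g h" for \<alpha> \<beta> f g h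
    using that w is_mor_lax[of w f] is_mor_lax[of w g] is_mor_lax[of w h] cell_law_vcomp[of f g h "acell \<alpha>" "acell \<beta>"]
      vcomp_cells[of "acell \<alpha>" "amap f" "amap g" "acell \<beta>" "amap h"]
    by (auto simp: S is_cell_iff cells_def)
  show "id2 (Alg w) f \<in> cells (Alg w) f f" if "f \<in> Mor (Alg w)" for f
    using that w is_mor_lax[of w f] cell_law_id[of f] lax_mor_ty[of f]
    by (auto simp: S(1) cells_def is_cell_iff cells_iff ty)
  show "comp1 (Alg w) g f \<in> hom (Alg w) x z" if "f \<in> hom (Alg w) x y" "g \<in> hom (Alg w) y z" for f g x y z
    using that is_mor_comp[of w f g] w by (auto simp: S) (auto simp: alg_comp_def Let_def)
  show "comp1 (Alg w) (comp1 (Alg w) h g) f = comp1 (Alg w) h (comp1 (Alg w) g f)"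
    if "f \<in> hom (Alg w) u x" "g \<in> hom (Alg w) x y" "h \<in> hom (Alg w) y z" for f g h u x y z
    using that comp_assoc[of f g h w] w by (auto simp: S is_mor_lax)
  show "comp1 (Alg w) f (id1 (Alg w) x) = f" "comp1 (Alg w) (id1 (Alg w) y) f = f"
    if "f \<in> hom (Alg w) x y" for f x y
    using that comp_id[of f w] w by (auto simp: S is_mor_lax)
  show "id1 (Alg w) x \<in> hom (Alg w) x x" if "x \<in> Obj (Alg w)" for x
    using that is_mor_id[of x w] w by (auto simp: S) (auto simp: alg_id_def)
  show "hcomp (Alg w) (hcomp (Alg w) \<gamma> \<beta>) \<alpha> = hcomp (Alg w) \<gamma> (hcomp (Alg w) \<beta> \<alpha>)"
    if "f \<in> hom (Alg w) u x" "g \<in> hom (Alg w) x y" "h \<in> hom (Alg w) y z"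
      "\<alpha> \<in> cells (Alg w) f f'" "\<beta> \<in> cells (Alg w) g g'" "\<gamma> \<in> cells (Alg w) h h'" for f g h u x y z \<alpha> \<beta> \<gamma> f' g' h'
    using that w is_mor_lax[of w f] is_mor_lax[of w g] is_mor_lax[of w h]
      is_mor_lax[of w f'] is_mor_lax[of w g'] is_mor_lax[of w h'] comp_assoc[of f g h w] comp_assoc[of f' g' h' w]
      lax_mor_ty[of f] lax_mor_ty[of g] lax_mor_ty[of h] hcomp_eq(1)[of "acell \<alpha>" "acell \<beta>" "acell \<gamma>"]
    by (auto simp: S is_cell_iff)
  show "hcomp (Alg w) \<alpha> (id2 (Alg w) (id1 (Alg w) x)) = \<alpha>" "hcomp (Alg w) (id2 (Alg w) (id1 (Alg w) y)) \<alpha> = \<alpha>"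
    if "f \<in> hom (Alg w) x y" "\<alpha> \<in> cells (Alg w) f f'" for f x y \<alpha> f'
    using that w is_mor_lax[of w f] is_mor_lax[of w f'] comp_id[of f w] comp_id[of f' w] lax_mor_ty[of f]
      hcomp_eq(2,3)[of "acell \<alpha>"]
    by (auto simp: S is_cell_iff) (auto simp: alg_id_def)
  show "hcomp (Alg w) (id2 (Alg w) g) (id2 (Alg w) f) = id2 (Alg w) (comp1 (Alg w) g f)"
    if "f \<in> hom (Alg w) x y" "g \<in> hom (Alg w) y z" for f g x y z
    using that w is_mor_lax[of w f] is_mor_lax[of w g] lax_mor_ty[of f] lax_mor_ty[of g]
    by (auto simp: S ty) (auto simp: alg_comp_def Let_def)
  show "vcomp (Alg w) (vcomp (Alg w) \<gamma> \<beta>) \<alpha> = vcomp (Alg w) \<gamma> (vcomp (Alg w) \<beta> \<alpha>)"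
    if "\<alpha> \<in> cells (Alg w) f g" "\<beta> \<in> cells (Alg w) g h" "\<gamma> \<in> cells (Alg w) h k" for \<alpha> \<beta> \<gamma> f g h k
    using that w vcomp_eq(1)[of "acell \<alpha>" "acell \<beta>" "acell \<gamma>"] by (auto simp: S is_cell_iff)
  show "vcomp (Alg w) \<alpha> (id2 (Alg w) f) = \<alpha>" "vcomp (Alg w) (id2 (Alg w) g) \<alpha> = \<alpha>"
    if "\<alpha> \<in> cells (Alg w) f g" for \<alpha> f g
    using that w vcomp_eq(2,3)[of "acell \<alpha>"] by (auto simp: S is_cell_iff)
qed (use w in \<open>auto simp: Alg_def is_cell_iff dest!: is_mor_lax dest: lax_mor_ty\<close>)

lemma co_alg_comp: "two_monad.alg_comp (co C) T Lax = alg_comp Colax"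
  by (intro ext) (simp add: alg_comp_def two_monad.alg_comp_def[OF co_two_monad] Let_def)

text \<open>Colax morphisms are the lax morphisms over the reversed 2-category. The algebra 2-cells are the
  same up to exchanging source and target, which are part of their data.\<close>

lemma two_category_Alg_colax: "two_category (Alg Colax)"
proof -
  interpret co: two_monad "co C" T by (rule co_two_monad)
  interpret B: two_category "co (co.Alg Lax)"
    by (rule two_category.co) (rule co.two_category_Alg_lax, simp)
  define swap :: "('o, 'm, 'c) alg_cell \<Rightarrow> ('o, 'm, 'c) alg_cell" where
    "swap = (\<lambda>\<theta>. \<lparr>adom2 = acod2 \<theta>, acod2 = adom2 \<theta>, acell = acell \<theta>\<rparr>)"
  have cell: "is_cell Colax (swap \<theta>) \<longleftrightarrow> co.is_cell Lax \<theta>" for \<theta>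
    unfolding is_cell_def co.is_cell_def Let_def swap_def
    by (auto simp: colax_is_co_lax)
  have swap2: "swap (swap \<theta>) = \<theta>" for \<theta> by (simp add: swap_def)
  have mor: "co.is_mor Lax = is_mor Colax"
    by (intro ext) (simp add: colax_is_co_lax)
  have id: "co.alg_id = alg_id"
    by (intro ext) (simp add: alg_id_def co.alg_id_def)
  interpret two_cat_iso "co (co.Alg Lax)" "Alg Colax" "\<lparr>on_obj = (\<lambda>x. x), on_mor = (\<lambda>f. f), on_cell = swap\<rparr>"
  proof
    show "bij_betw (on_cell \<lparr>on_obj = (\<lambda>x. x), on_mor = (\<lambda>f. f), on_cell = swap\<rparr>) (Cell (co (co.Alg Lax))) (Cell (Alg Colax))"
      using cell swap2 by (intro bij_betw_byWitness[of _ swap]) (auto simp: Alg_def co.Alg_def, metis)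
    show "bij_betw (on_mor \<lparr>on_obj = (\<lambda>x. x), on_mor = (\<lambda>f. f), on_cell = swap\<rparr>) (Mor (co (co.Alg Lax))) (Mor (Alg Colax))"
      by (simp add: Alg_def co.Alg_def mor bij_betw_def)
  qed (auto simp: Alg_def co.Alg_def co_is_alg id co_alg_comp swap_def bij_betw_def)
  show ?thesis by (rule two_category_A)
qed

lemma two_category_Alg: "two_category (Alg w)"
  using two_category_Alg_lax two_category_Alg_colax by (cases "w = Colax") auto

text \<open>Both sides of each lax axiom are invertible, and equal cells have equal inverses.\<close>

lemma colax_if_invertible_lax:
  assumes L: "is_lax_mor \<phi>" and k: "inverse2 C (abar \<phi>) k"
  shows "is_colax_mor (\<phi>\<lparr>abar := k\<rparr>)"
proof -
  define x a b f fb where d: "x = acarr (adom \<phi>)" "a = aact (adom \<phi>)"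
    "b = aact (acod \<phi>)" "f = amap \<phi>" "fb = abar \<phi>"
  note T = lax_mor_ty[OF L, folded d] and laws = lax_mor_laws[OF L, folded d]
  have k': "inverse2 C fb k" "k \<in> Cell C" "dom2 C k = f \<cdot> a" "cod2 C k = b \<cdot> T\<^sub>1 f" "inverse2 C (T\<^sub>2 fb) (T\<^sub>2 k)"
  proof -
    show *: "inverse2 C fb k" using k by (simp add: d)
    then show **: "k \<in> Cell C" "dom2 C k = f \<cdot> a" "cod2 C k = b \<cdot> T\<^sub>1 f"
      using T by (simp_all add: inverse2_def cells_iff)
    from * ** T show "inverse2 C (T\<^sub>2 fb) (T\<^sub>2 k)"
      using T_pres(4)[of k fb] T_pres(4)[of fb k] by (simp add: inverse2_def cells_iff ty)
  qed
  have "inverse2 C (fb \<star> \<iota> (\<mu> x)) (k \<star> \<iota> (\<mu> x))"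
    using k' T by (intro inverse2_hcomp inverse2_id2) (simp_all add: ty)
  moreover have "inverse2 C (fb \<star> \<iota> (\<mu> x)) ((\<iota> b \<star> T\<^sub>2 k) \<bullet> (k \<star> \<iota> (T\<^sub>1 a)))"
    unfolding laws using k' T by (intro inverse2_vcomp inverse2_hcomp inverse2_id2) (simp_all add: ty)
  ultimately have 1: "k \<star> \<iota> (\<mu> x) = (\<iota> b \<star> T\<^sub>2 k) \<bullet> (k \<star> \<iota> (T\<^sub>1 a))" by (rule inverse2_unique)
  have "inverse2 C (fb \<star> \<iota> (\<eta> x)) (k \<star> \<iota> (\<eta> x))"
    using k' T by (intro inverse2_hcomp inverse2_id2) (simp_all add: ty)
  then have 2: "k \<star> \<iota> (\<eta> x) = \<iota> f"
    unfolding laws using T inverse2_id2 inverse2_unique by blast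
  show ?thesis
    using 1 2 T k' by (simp add: is_colax_mor_def Let_def d[symmetric] hom_iff cells_iff)
qed

lemma strict_mor_abar:
  assumes "is_mor Strict \<phi>"
  shows "abar \<phi> = \<iota> (amap \<phi> \<cdot> aact (adom \<phi>))" "aact (acod \<phi>) \<cdot> T\<^sub>1 (amap \<phi>) = amap \<phi> \<cdot> aact (adom \<phi>)"
proof -
  obtain k where k: "k \<in> Mor C" "abar \<phi> = \<iota> k" and L: "is_lax_mor \<phi>" using assms by (auto simp: identity2_def)
  show "abar \<phi> = \<iota> (amap \<phi> \<cdot> aact (adom \<phi>))" "aact (acod \<phi>) \<cdot> T\<^sub>1 (amap \<phi>) = amap \<phi> \<cdot> aact (adom \<phi>)"
    using lax_mor_ty(15,16)[OF L] k by (simp_all add: ty)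
qed

lemma strict_is_mor:
  assumes s: "is_mor Strict \<phi>"
  shows "is_mor w \<phi>"
proof -
  have L: "is_lax_mor \<phi>" using s by simp
  have "inverse2 C (abar \<phi>) (abar \<phi>)"
    unfolding strict_mor_abar[OF s] using lax_mor_ty[OF L] by (intro inverse2_id2) (simp add: ty)
  then show ?thesis using s colax_if_invertible_lax[OF L, of "abar \<phi>"] by (cases w) (auto simp: iso2_def)
qed

text \<open>Between strict morphisms the structure cells are identities, so the lax and the colax form of
  the condition on a 2-cell \<open>\<alpha>\<close> both say \<open>\<alpha> \<star> \<iota> a = \<iota> b \<star> T\<^sub>2 \<alpha>\<close>.\<close>

lemma strict_is_cell_iff:
  assumes "is_mor Strict (adom2 \<theta>)" "is_mor Strict (acod2 \<theta>)"
  shows "is_cell w \<theta> \<longleftrightarrow> is_cell Strict \<theta>"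
proof -
  have L: "is_lax_mor (adom2 \<theta>)" "is_lax_mor (acod2 \<theta>)" using assms by simp_all
  note T = lax_mor_ty[OF L(1)] lax_mor_ty[OF L(2)]
    and S = strict_mor_abar[OF assms(1)] strict_mor_abar[OF assms(2)]
  have "(\<iota> (aact (acod (adom2 \<theta>))) \<star> T\<^sub>2 (acell \<theta>)) \<bullet> abar (adom2 \<theta>) = abar (acod2 \<theta>) \<bullet> (acell \<theta> \<star> \<iota> (aact (adom (adom2 \<theta>))))
    \<longleftrightarrow> (acell \<theta> \<star> \<iota> (aact (adom (adom2 \<theta>)))) \<bullet> abar (adom2 \<theta>) = abar (acod2 \<theta>) \<bullet> (\<iota> (aact (acod (adom2 \<theta>))) \<star> T\<^sub>2 (acell \<theta>))"
    if "acell \<theta> \<in> cells C (amap (adom2 \<theta>)) (amap (acod2 \<theta>))"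
      "adom (acod2 \<theta>) = adom (adom2 \<theta>)" "acod (acod2 \<theta>) = acod (adom2 \<theta>)"
    using that T S by (auto simp: cells_iff ty)
  then show ?thesis
    using assms strict_is_mor[OF assms(1), of w] strict_is_mor[OF assms(2), of w]
    unfolding is_cell_def Let_def by auto
qed

lemma strict_comp:
  assumes "is_mor Strict \<phi>" "is_mor Strict \<psi>" "adom \<psi> = acod \<phi>"
  shows "alg_comp Strict \<psi> \<phi> = alg_comp w \<psi> \<phi>"
proof -
  have L: "is_lax_mor \<phi>" "is_lax_mor \<psi>" using assms by simp_all
  note T = lax_mor_ty[OF L(1)] lax_mor_ty[OF L(2), unfolded assms(3)]
    and S = strict_mor_abar[OF assms(1)] strict_mor_abar[OF assms(2), unfolded assms(3)]
  have "amap \<psi> \<cdot> aact (acod \<phi>) \<cdot> T\<^sub>1 (amap \<phi>) = amap \<psi> \<cdot> amap \<phi> \<cdot> aact (adom \<phi>)"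
    unfolding S(2) ..
  then show ?thesis using T S by (simp add: alg_comp_def Let_def ty)
qed

lemma f_category_AlgF: "f_category (AlgF w)"
proof -
  interpret S: two_category "Alg Strict" by (rule two_category_Alg)
  interpret W: two_category "Alg w" by (rule two_category_Alg)
  have cellS: "is_mor Strict (adom2 \<theta>)" "is_mor Strict (acod2 \<theta>)" if "is_cell Strict \<theta>" for \<theta>
    using that by (auto simp: is_cell_def Let_def)
  have mor: "Mor (Alg Strict) \<subseteq> Mor (Alg w)" using strict_is_mor by (auto simp: Alg_def)
  have cell: "Cell (Alg Strict) \<subseteq> Cell (Alg w)"
  proof
    fix \<theta> assume "\<theta> \<in> Cell (Alg Strict)"
    then have "is_cell Strict \<theta>" by (simp add: Alg_def)
    then have "is_cell w \<theta>" using strict_is_cell_iff cellS by blast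
    then show "\<theta> \<in> Cell (Alg w)" by (simp add: Alg_def)
  qed
  interpret I: two_functor "Alg Strict" "Alg w" id_fun
  proof
    show "on_cell id_fun (hcomp (Alg Strict) \<beta> \<alpha>) = hcomp (Alg w) (on_cell id_fun \<beta>) (on_cell id_fun \<alpha>)"
      if "f \<in> hom (Alg Strict) x y" "g \<in> hom (Alg Strict) y z" "\<alpha> \<in> cells (Alg Strict) f f'"
        "\<beta> \<in> cells (Alg Strict) g g'" for f g x y z \<alpha> \<beta> f' g'
    proof -
      have "f' \<in> hom (Alg Strict) x y" "g' \<in> hom (Alg Strict) y z"
        using that by (auto simp: S.hom_iff S.cells_iff ty)
      then show ?thesis
        using that strict_comp[of f g w] strict_comp[of f' g' w]
        by (auto simp: id_fun_def Alg_def hom_def cells_def)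
    qed
  qed (use mor cell strict_comp[of _ _ w] in \<open>auto simp: id_fun_def Alg_def hom_def cells_def\<close>)
  show ?thesis
  proof (intro f_category.intro f_category_axioms.intro)
    show "two_functor (tight (AlgF w)) (loose (AlgF w)) (incl (AlgF w))"
      by (simp add: AlgF_def I.two_functor_axioms)
    show "bij_betw (on_cell (incl (AlgF w))) (cells (tight (AlgF w)) f g)
        (cells (loose (AlgF w)) (on_mor (incl (AlgF w)) f) (on_mor (incl (AlgF w)) g))"
      if fg: "f \<in> hom (tight (AlgF w)) x y" "g \<in> hom (tight (AlgF w)) x y" for f g x y
    proof -
      have "is_mor Strict f" "is_mor Strict g" using fg by (simp_all add: AlgF_def Alg_def hom_def)
      then have "is_cell w \<theta> \<longleftrightarrow> is_cell Strict \<theta>" if "adom2 \<theta> = f" "acod2 \<theta> = g" for \<theta>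
        using strict_is_cell_iff[of \<theta> w] that by blast
      then have "cells (Alg w) f g = cells (Alg Strict) f g"
        by (auto simp: Alg_def cells_def)
      then show ?thesis by (simp add: AlgF_def id_fun_def bij_betw_def)
    qed
  qed (simp_all add: AlgF_def id_fun_def Alg_def)
qed

lemma is_mor_ty:
  assumes "is_mor w \<phi>"
  shows "is_alg (adom \<phi>)" "is_alg (acod \<phi>)" "amap \<phi> \<in> hom C (acarr (adom \<phi>)) (acarr (acod \<phi>))"
  using assms by (cases w; auto simp: is_lax_mor_def is_colax_mor_def Let_def)+

lemma two_functor_alg_forget: "two_functor (Alg w) C alg_forget"
proof -
  interpret W: two_category "Alg w" by (rule two_category_Alg)
  show ?thesis
    by unfold_locales
      (auto simp: alg_forget_def Alg_def hom_def cells_def is_cell_def Let_def alg_id_def alg_comp_def is_alg_def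
        dest!: is_mor_ty)
qed

lemma alg_incl_is_mor:
  assumes "is_mor Pseudo \<phi>" "w \<in> {Lax, Colax}"
  shows "is_mor w (alg_incl_mor w \<phi>)"
  using assms colax_if_invertible_lax[of \<phi> "inv2 C (abar \<phi>)"] iso2_inv2[of "abar \<phi>"]
  by (auto simp: alg_incl_mor_def)

lemma alg_incl_is_cell:
  assumes \<theta>: "is_cell Pseudo \<theta>" and w: "w \<in> {Lax, Colax}"
  shows "is_cell w (on_cell (alg_incl w) \<theta>)"
proof (cases "w = Colax")
  case True
  define \<phi> \<psi> \<alpha> where d: "\<phi> = adom2 \<theta>" "\<psi> = acod2 \<theta>" "\<alpha> = acell \<theta>"
  have P: "is_mor Pseudo \<phi>" "is_mor Pseudo \<psi>" and same: "adom \<psi> = adom \<phi>" "acod \<psi> = acod \<phi>"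
    and \<alpha>: "\<alpha> \<in> cells C (amap \<phi>) (amap \<psi>)"
      "(\<alpha> \<star> \<iota> (aact (adom \<phi>))) \<bullet> abar \<phi> = abar \<psi> \<bullet> (\<iota> (aact (acod \<phi>)) \<star> T\<^sub>2 \<alpha>)"
    using \<theta> by (auto simp: is_cell_def Let_def d)
  have L: "is_lax_mor \<phi>" "is_lax_mor \<psi>" using P by simp_all
  define a b k l where d': "a = aact (adom \<phi>)" "b = aact (acod \<phi>)" "k = inv2 C (abar \<phi>)" "l = inv2 C (abar \<psi>)"
  have kl: "inverse2 C (abar \<phi>) k" "inverse2 C (abar \<psi>) l" using P iso2_inv2 by (simp_all add: d')
  note T = lax_mor_ty[OF L(1), folded d'] lax_mor_ty[OF L(2), unfolded same, folded d'] \<alpha>(1)[unfolded cells_iff]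
  have K: "k \<in> Cell C" "dom2 C k = amap \<phi> \<cdot> a" "cod2 C k = b \<cdot> T\<^sub>1 (amap \<phi>)" "abar \<phi> \<bullet> k = \<iota> (amap \<phi> \<cdot> a)"
    "l \<in> Cell C" "dom2 C l = amap \<psi> \<cdot> a" "cod2 C l = b \<cdot> T\<^sub>1 (amap \<psi>)" "l \<bullet> abar \<psi> = \<iota> (b \<cdot> T\<^sub>1 (amap \<psi>))"
    using kl T by (auto simp: inverse2_def cells_iff)
  have "(\<iota> b \<star> T\<^sub>2 \<alpha>) \<bullet> k = (l \<bullet> abar \<psi>) \<bullet> (\<iota> b \<star> T\<^sub>2 \<alpha>) \<bullet> k"
    unfolding K using T K by (simp add: ty)
  also have "\<dots> = l \<bullet> (abar \<psi> \<bullet> (\<iota> b \<star> T\<^sub>2 \<alpha>)) \<bullet> k"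
    using T K(1-3,5-7) by (simp add: ty)
  also have "\<dots> = l \<bullet> ((\<alpha> \<star> \<iota> a) \<bullet> abar \<phi>) \<bullet> k" using \<alpha>(2) by (simp add: d')
  also have "\<dots> = l \<bullet> (\<alpha> \<star> \<iota> a) \<bullet> (abar \<phi> \<bullet> k)" using T K(1-3,5-7) by (simp add: ty)
  also have "\<dots> = l \<bullet> (\<alpha> \<star> \<iota> a)" unfolding K using T by (simp add: ty)
  finally have "(\<iota> b \<star> T\<^sub>2 \<alpha>) \<bullet> k = l \<bullet> (\<alpha> \<star> \<iota> a)" .
  then show ?thesis
    using True same \<alpha>(1) alg_incl_is_mor[OF P(1), of Colax] alg_incl_is_mor[OF P(2), of Colax]
    by (simp add: is_cell_def Let_def alg_incl_def d[symmetric] alg_incl_mor_def d'[symmetric])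
next
  case False
  with w \<theta> show ?thesis by (auto simp: is_cell_def Let_def alg_incl_def alg_incl_mor_def)
qed

end

section \<open>Algebras for the free monoid monad\<close>

text \<open>The adjunction between \<open>C\<close> and the strict monoid morphisms in elementary terms: \<open>J x\<close> is
  the free monoid on \<open>x\<close> and \<open>e\<close> is the counit. In this form the conditions are
  visibly invariant under reversal of the 2-cells.\<close>

locale free_monoids =
  monoidal_two_category C M + alg: two_monad C T
  for C :: "('o, 'm, 'c) two_cat" (structure) and M :: "('o, 'm, 'c) monoidal_structure"
    and T :: "('o, 'm, 'c) monad" +
  fixes J :: "'o \<Rightarrow> ('o, 'm) mon" and e :: "('o, 'm) mon \<Rightarrow> 'm"
  assumes J_monoid: "x \<in> Obj C \<Longrightarrow> is_monoid (J x)"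
    and J_carrier: "x \<in> Obj C \<Longrightarrow> mcarr (J x) = T\<^sub>0 x"
    and T_hom: "f \<in> hom C x y \<Longrightarrow> strict_hom (J x) (J y) (T\<^sub>1 f)"
    and T_cell_mult: "\<lbrakk>f \<in> hom C x y; \<alpha> \<in> cells C f g\<rbrakk> \<Longrightarrow>
          T\<^sub>2 \<alpha> \<star> \<iota> (mmult (J x)) = \<iota> (mmult (J y)) \<star> (T\<^sub>2 \<alpha> \<circledast> T\<^sub>2 \<alpha>)"
    and T_cell_unit: "\<lbrakk>f \<in> hom C x y; \<alpha> \<in> cells C f g\<rbrakk> \<Longrightarrow>
          T\<^sub>2 \<alpha> \<star> \<iota> (munit (J x)) = \<iota> (munit (J y))"
    and counit_hom: "is_monoid X \<Longrightarrow> strict_hom (J (mcarr X)) X (e X)"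
    and counit_nat: "strict_hom X Y u \<Longrightarrow> u \<cdot> e X = e Y \<cdot> T\<^sub>1 u"
    and counit_unit: "is_monoid X \<Longrightarrow> e X \<cdot> \<eta> (mcarr X) = \<one> (mcarr X)"
    and counit_free: "x \<in> Obj C \<Longrightarrow> e (J x) = \<mu> x"
begin

lemma J_ty [ty]:
  assumes "x \<in> Obj C"
  shows "mmult (J x) \<in> Mor C" "dom1 C (mmult (J x)) = T\<^sub>0 x \<boxtimes> T\<^sub>0 x" "cod1 C (mmult (J x)) = T\<^sub>0 x"
    "munit (J x) \<in> Mor C" "dom1 C (munit (J x)) = \<I>" "cod1 C (munit (J x)) = T\<^sub>0 x"
  using monoid_ty[OF J_monoid[OF assms]] J_carrier[OF assms] by simp_all

lemma free_on_J:
  assumes x: "x \<in> Obj C"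
  shows "free_on x (J x) (\<eta> x)"
  unfolding free_on_def
proof (intro conjI allI impI ballI)
  fix X v assume X: "is_monoid X" and v: "v \<in> hom C x (mcarr X)"
  note c = counit_hom[OF X] and XT = monoid_ty[OF X]
  note cT = strict_hom_ty[OF c, unfolded J_carrier[OF XT(1)]]
  show "\<exists>!u. strict_hom (J x) X u \<and> u \<cdot> \<eta> x = v"
  proof (intro ex1I[of _ "e X \<cdot> T\<^sub>1 v"] conjI)
    show "strict_hom (J x) X (e X \<cdot> T\<^sub>1 v)" by (rule strict_hom_comp[OF T_hom[OF v] c])
    have "(e X \<cdot> T\<^sub>1 v) \<cdot> \<eta> x = (e X \<cdot> \<eta> (mcarr X)) \<cdot> v"
      using v x cT XT by (simp add: hom_iff ty alg.unit_nat)
    then show "(e X \<cdot> T\<^sub>1 v) \<cdot> \<eta> x = v" using v by (simp add: counit_unit[OF X] hom_iff ty)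
  next
    fix u assume u: "strict_hom (J x) X u \<and> u \<cdot> \<eta> x = v"
    note uT = strict_hom_ty[OF u[THEN conjunct1], unfolded J_carrier[OF x]]
    have "e X \<cdot> T\<^sub>1 (u \<cdot> \<eta> x) = (e X \<cdot> T\<^sub>1 u) \<cdot> T\<^sub>1 (\<eta> x)" using uT x cT by (simp add: ty)
    also have "e X \<cdot> T\<^sub>1 u = u \<cdot> \<mu> x"
      using counit_nat[OF u[THEN conjunct1]] by (simp add: counit_free[OF x])
    also have "(u \<cdot> \<mu> x) \<cdot> T\<^sub>1 (\<eta> x) = u \<cdot> (\<mu> x \<cdot> T\<^sub>1 (\<eta> x))" using uT x by (simp add: ty)
    also have "\<dots> = u" using uT x by (simp add: alg.mult_unit_right ty)
    finally show "u = e X \<cdot> T\<^sub>1 v" using u by simp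
  qed
next
  show "is_monoid (J x)" by (rule J_monoid[OF x])
  show "\<eta> x \<in> hom C x (mcarr (J x))" using x by (simp add: J_carrier hom_iff ty)
qed

text \<open>The inclusion of the words of length two into the free monoid. An action is turned into a
  multiplication by evaluating these words.\<close>

definition binary :: "'o \<Rightarrow> 'm" where
  "binary x = mmult (J x) \<cdot> (\<eta> x \<otimes> \<eta> x)"

lemma binary_ty [ty]:
  assumes "x \<in> Obj C"
  shows "binary x \<in> Mor C" "dom1 C (binary x) = x \<boxtimes> x" "cod1 C (binary x) = T\<^sub>0 x"
  using assms by (simp_all add: binary_def ty)

definition monoid_of :: "('o, 'm) alg \<Rightarrow> ('o, 'm) mon" where
  "monoid_of A = \<lparr>mcarr = acarr A, mmult = aact A \<cdot> binary (acarr A), munit = aact A \<cdot> munit (J (acarr A))\<rparr>"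

definition mor_of :: "('o, 'm, 'c) alg_mor \<Rightarrow> ('o, 'm, 'c) mon_mor" where
  "mor_of \<phi> = \<lparr>mdom = monoid_of (adom \<phi>), mcod = monoid_of (acod \<phi>), mmap = amap \<phi>,
     mbar = abar \<phi> \<star> \<iota> (binary (acarr (adom \<phi>))), mzero = abar \<phi> \<star> \<iota> (munit (J (acarr (adom \<phi>))))\<rparr>"

definition cell_of :: "('o, 'm, 'c) alg_cell \<Rightarrow> ('o, 'm, 'c) mon_cell" where
  "cell_of \<theta> = \<lparr>mdom2 = mor_of (adom2 \<theta>), mcod2 = mor_of (acod2 \<theta>), mcell = acell \<theta>\<rparr>"

lemma mor_of_simps [simp]:
  "mcarr (monoid_of A) = acarr A" "mdom (mor_of \<phi>) = monoid_of (adom \<phi>)"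
  "mcod (mor_of \<phi>) = monoid_of (acod \<phi>)" "mmap (mor_of \<phi>) = amap \<phi>"
  by (simp_all add: monoid_of_def mor_of_def)

lemma T_mult:
  assumes "f \<in> Mor C" "dom1 C f = x"
  shows "T\<^sub>1 f \<cdot> mmult (J x) = mmult (J (cod1 C f)) \<cdot> (T\<^sub>1 f \<otimes> T\<^sub>1 f)"
  using T_hom[of f x "cod1 C f"] assms by (simp add: hom_iff strict_hom_def)

text \<open>As \<open>\<mu> x\<close> is a strict homomorphism, it sends a product of two generators to the product of
  their values.\<close>

lemma mult_J:
  assumes x: "x \<in> Obj C"
  shows "mmult (J x) = \<mu> x \<cdot> binary (T\<^sub>0 x)"
proof -
  have "\<mu> x \<cdot> binary (T\<^sub>0 x) = (\<mu> x \<cdot> mmult (J (T\<^sub>0 x))) \<cdot> (\<eta> (T\<^sub>0 x) \<otimes> \<eta> (T\<^sub>0 x))"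
    using x by (simp add: binary_def ty)
  also have "\<mu> x \<cdot> mmult (J (T\<^sub>0 x)) = mmult (J x) \<cdot> (\<mu> x \<otimes> \<mu> x)"
    using counit_hom[OF J_monoid[OF x]] by (simp add: counit_free[OF x] J_carrier[OF x] strict_hom_def)
  finally show ?thesis
    using x by (simp add: ty tensor_comp1 alg.mult_unit_left)
qed

text \<open>The action \<open>a\<close> is the absolute coequaliser of \<open>\<mu> x\<close> and \<open>T a\<close>, split by the units,
  so the multiplication of the free monoid descends along \<open>a\<close>. The proof writes the
  splitting out.\<close>

lemma alg_mult:
  assumes A: "alg.is_alg A"
  shows "aact A \<cdot> mmult (J (acarr A)) = mmult (monoid_of A) \<cdot> (aact A \<otimes> aact A)"
proof -
  define x a where d: "x = acarr A" "a = aact A"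
  note T = alg.alg_ty[OF A, folded d] and laws = alg.alg_laws[OF A, folded d]
  have "a \<cdot> mmult (J x) = (a \<cdot> \<mu> x) \<cdot> binary (T\<^sub>0 x)"
    using T by (simp add: mult_J ty)
  also have "\<dots> = a \<cdot> (T\<^sub>1 a \<cdot> mmult (J (T\<^sub>0 x))) \<cdot> (\<eta> (T\<^sub>0 x) \<otimes> \<eta> (T\<^sub>0 x))"
    unfolding laws using T by (simp add: ty binary_def)
  also have "\<dots> = a \<cdot> (mmult (J x) \<cdot> (T\<^sub>1 a \<otimes> T\<^sub>1 a)) \<cdot> (\<eta> (T\<^sub>0 x) \<otimes> \<eta> (T\<^sub>0 x))"
    using T by (simp add: T_mult)
  also have "\<dots> = (a \<cdot> binary x) \<cdot> (a \<otimes> a)"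
    using T by (simp add: ty tensor_comp1 binary_def alg.unit_nat)
  finally show ?thesis by (simp add: monoid_of_def d)
qed

text \<open>As \<open>\<eta> x\<close> is a section of \<open>a\<close>, each monoid law for \<open>monoid_of A\<close> is the image under
  \<open>a\<close> of the law of the free monoid, applied to generators.\<close>

lemma monoid_of_hom:
  assumes A: "alg.is_alg A"
  shows "strict_hom (J (acarr A)) (monoid_of A) (aact A)"
proof -
  define x a m i where d: "x = acarr A" "a = aact A" "m = mmult (monoid_of A)" "i = munit (monoid_of A)"
  note T = alg.alg_ty[OF A, folded d] and laws = alg.alg_laws[OF A, folded d]
  note Jm = J_monoid[OF T(1)]
  have m: "m = a \<cdot> binary x" and i: "i = a \<cdot> munit (J x)" by (simp_all add: d monoid_of_def)
  have mT: "m \<in> Mor C" "dom1 C m = x \<boxtimes> x" "cod1 C m = x" "i \<in> Mor C" "dom1 C i = \<I>" "cod1 C i = x"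
    using T by (simp_all add: m i ty)
  have mult: "m \<cdot> ((a \<cdot> u) \<otimes> (a \<cdot> v)) = a \<cdot> (mmult (J x) \<cdot> (u \<otimes> v))"
    if "u \<in> Mor C" "v \<in> Mor C" "cod1 C u = T\<^sub>0 x" "cod1 C v = T\<^sub>0 x" for u v
  proof -
    have "m \<cdot> ((a \<cdot> u) \<otimes> (a \<cdot> v)) = (m \<cdot> (a \<otimes> a)) \<cdot> (u \<otimes> v)"
      using T mT that by (simp add: ty tensor_comp1)
    also have "\<dots> = (a \<cdot> mmult (J x)) \<cdot> (u \<otimes> v)" using alg_mult[OF A] by (simp add: d)
    finally show ?thesis using T that by (simp add: ty)
  qed
  have one: "a \<cdot> \<eta> x = \<one> x" by (rule laws)
  have bin: "mmult (J x) \<cdot> (\<eta> x \<otimes> \<eta> x) = binary x" by (simp add: binary_def)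
  have "m \<cdot> (m \<otimes> \<one> x) = a \<cdot> (mmult (J x) \<cdot> (binary x \<otimes> \<eta> x))"
    using mult[of "binary x" "\<eta> x"] T by (simp add: one m ty)
  also have "mmult (J x) \<cdot> (binary x \<otimes> \<eta> x) = (mmult (J x) \<cdot> (\<eta> x \<otimes> binary x)) \<cdot> \<a> x x x"
    using mult_assoc_mor[OF Jm, of "\<eta> x" "\<eta> x" "\<eta> x"] T by (simp add: J_carrier ty bin)
  also have "a \<cdot> \<dots> = (a \<cdot> (mmult (J x) \<cdot> (\<eta> x \<otimes> binary x))) \<cdot> \<a> x x x"
    using T by (simp add: ty)
  also have "a \<cdot> (mmult (J x) \<cdot> (\<eta> x \<otimes> binary x)) = m \<cdot> (\<one> x \<otimes> m)"
    using mult[of "\<eta> x" "binary x"] T by (simp add: one m ty)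
  finally have 1: "m \<cdot> (m \<otimes> \<one> x) = (m \<cdot> (\<one> x \<otimes> m)) \<cdot> \<a> x x x" .
  have "m \<cdot> (i \<otimes> \<one> x) = a \<cdot> (mmult (J x) \<cdot> (munit (J x) \<otimes> \<eta> x))"
    using mult[of "munit (J x)" "\<eta> x"] T by (simp add: one i ty)
  also have "\<dots> = (a \<cdot> \<eta> x) \<cdot> \<l> x"
    using mult_unit_mor(2)[OF Jm, of "\<eta> x"] T by (simp add: J_carrier ty)
  finally have 2: "m \<cdot> (i \<otimes> \<one> x) = \<l> x" using T by (simp add: one ty)
  have "m \<cdot> (\<one> x \<otimes> i) = a \<cdot> (mmult (J x) \<cdot> (\<eta> x \<otimes> munit (J x)))"
    using mult[of "\<eta> x" "munit (J x)"] T by (simp add: one i ty)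
  also have "\<dots> = (a \<cdot> \<eta> x) \<cdot> \<r> x"
    using mult_unit_mor(1)[OF Jm, of "\<eta> x"] T by (simp add: J_carrier ty)
  finally have 3: "m \<cdot> (\<one> x \<otimes> i) = \<r> x" using T by (simp add: one ty)
  have "is_monoid (monoid_of A)"
    using 1 2 3 T mT unfolding is_monoid_def Let_def by (simp add: d[symmetric] hom_iff ty)
  then show ?thesis
    using alg_mult[OF A] T Jm by (simp add: strict_hom_def d[symmetric] J_carrier hom_iff) (simp add: i)
qed

lemma monoid_of_monoid: "alg.is_alg A \<Longrightarrow> is_monoid (monoid_of A)"
  using monoid_of_hom strict_hom_def by blast

lemma free_hom_unique:
  assumes "x \<in> Obj C" "strict_hom (J x) X u" "strict_hom (J x) X v" "u \<cdot> \<eta> x = v \<cdot> \<eta> x"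
  shows "u = v"
proof -
  have "u \<cdot> \<eta> x \<in> hom C x (mcarr X)"
    using assms(1) strict_hom_ty[OF assms(2)] by (simp add: J_carrier hom_iff ty)
  then have "\<exists>!w. strict_hom (J x) X w \<and> w \<cdot> \<eta> x = u \<cdot> \<eta> x"
    using free_on_J[OF assms(1)] strict_hom_ty(5)[OF assms(2)] by (simp add: free_on_def)
  then show ?thesis using assms(2-4) by auto
qed

lemma counit_monoid_of:
  assumes A: "alg.is_alg A"
  shows "e (monoid_of A) = aact A"
proof (rule free_hom_unique)
  show "acarr A \<in> Obj C" by (rule alg.alg_ty(1)[OF A])
  show "strict_hom (J (acarr A)) (monoid_of A) (e (monoid_of A))"
    using counit_hom[OF monoid_of_monoid[OF A]] by simp
  show "strict_hom (J (acarr A)) (monoid_of A) (aact A)" by (rule monoid_of_hom[OF A])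
  show "e (monoid_of A) \<cdot> \<eta> (acarr A) = aact A \<cdot> \<eta> (acarr A)"
    using counit_unit[OF monoid_of_monoid[OF A]] by (simp add: alg.alg_laws(2)[OF A])
qed

lemma counit_alg:
  assumes X: "is_monoid X"
  shows "alg.is_alg \<lparr>acarr = mcarr X, aact = e X\<rparr>" "monoid_of \<lparr>acarr = mcarr X, aact = e X\<rparr> = X"
proof -
  note XT = monoid_ty[OF X] and c = counit_hom[OF X]
  note cT = strict_hom_ty[OF c, unfolded J_carrier[OF XT(1)]]
  show "alg.is_alg \<lparr>acarr = mcarr X, aact = e X\<rparr>"
    using counit_nat[OF c] counit_unit[OF X] XT cT by (simp add: alg.is_alg_def counit_free hom_iff)
  have "e X \<cdot> binary (mcarr X) = (e X \<cdot> mmult (J (mcarr X))) \<cdot> (\<eta> (mcarr X) \<otimes> \<eta> (mcarr X))"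
    using XT cT by (simp add: binary_def ty)
  also have "\<dots> = (mmult X \<cdot> (e X \<otimes> e X)) \<cdot> (\<eta> (mcarr X) \<otimes> \<eta> (mcarr X))"
    using c by (simp add: strict_hom_def)
  also have "\<dots> = mmult X" using XT cT by (simp add: ty tensor_comp1 counit_unit[OF X])
  finally show "monoid_of \<lparr>acarr = mcarr X, aact = e X\<rparr> = X"
    using c by (cases X) (simp add: monoid_of_def strict_hom_def)
qed

lemma act_T_hom:
  assumes "alg.is_lax_mor \<phi>"
  shows "strict_hom (J (acarr (adom \<phi>))) (monoid_of (acod \<phi>)) (aact (acod \<phi>) \<cdot> T\<^sub>1 (amap \<phi>))"
    "(aact (acod \<phi>) \<cdot> T\<^sub>1 (amap \<phi>)) \<cdot> \<eta> (acarr (adom \<phi>)) = amap \<phi>"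
proof -
  note T = alg.lax_mor_ty[OF assms]
  show "strict_hom (J (acarr (adom \<phi>))) (monoid_of (acod \<phi>)) (aact (acod \<phi>) \<cdot> T\<^sub>1 (amap \<phi>))"
    by (rule strict_hom_comp[OF T_hom monoid_of_hom]) (use T in \<open>simp_all add: hom_iff\<close>)
  have "(aact (acod \<phi>) \<cdot> T\<^sub>1 (amap \<phi>)) \<cdot> \<eta> (acarr (adom \<phi>)) = (aact (acod \<phi>) \<cdot> \<eta> (acarr (acod \<phi>))) \<cdot> amap \<phi>"
    using T by (simp add: ty alg.unit_nat)
  then show "(aact (acod \<phi>) \<cdot> T\<^sub>1 (amap \<phi>)) \<cdot> \<eta> (acarr (adom \<phi>)) = amap \<phi>"
    using T by (simp add: alg.alg_laws ty)
qed

lemma strict_hom_binary: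
  assumes "x \<in> Obj C" "strict_hom (J x) X u"
  shows "u \<cdot> binary x = mmult X \<cdot> ((u \<cdot> \<eta> x) \<otimes> (u \<cdot> \<eta> x))"
proof -
  note T = strict_hom_ty[OF assms(2), unfolded J_carrier[OF assms(1)]]
  note X = monoid_ty[OF T(5)]
  have "u \<cdot> binary x = (u \<cdot> mmult (J x)) \<cdot> (\<eta> x \<otimes> \<eta> x)" using assms T X by (simp add: binary_def ty)
  also have "u \<cdot> mmult (J x) = mmult X \<cdot> (u \<otimes> u)" using assms(2) by (simp add: strict_hom_def)
  finally show ?thesis using T X assms by (simp add: ty tensor_comp1)
qed

lemma mor_of_pre_lax:
  assumes L: "alg.is_lax_mor \<phi>"
  shows "pre_lax (mor_of \<phi>)"
proof -
  define x a y b f fb where d: "x = acarr (adom \<phi>)" "a = aact (adom \<phi>)" "y = acarr (acod \<phi>)"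
    "b = aact (acod \<phi>)" "f = amap \<phi>" "fb = abar \<phi>"
  note T = alg.lax_mor_ty[OF L, folded d] and h = act_T_hom[OF L, folded d]
  have 1: "b \<cdot> T\<^sub>1 f \<cdot> binary x = mmult (monoid_of (acod \<phi>)) \<cdot> (f \<otimes> f)"
    using strict_hom_binary[OF T(3) h(1)] T by (simp add: h(2)) (simp add: ty)
  have 2: "b \<cdot> T\<^sub>1 f \<cdot> munit (J x) = munit (monoid_of (acod \<phi>))"
    using h(1) T by (simp add: strict_hom_def ty)
  have 3: "a \<cdot> binary x = mmult (monoid_of (adom \<phi>))" "a \<cdot> munit (J x) = munit (monoid_of (adom \<phi>))"
    by (simp_all add: monoid_of_def d)
  have "is_monoid (monoid_of (adom \<phi>))" "is_monoid (monoid_of (acod \<phi>))"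
    using T by (simp_all add: monoid_of_monoid)
  then show ?thesis
    using T unfolding pre_lax_def
    by (simp add: d[symmetric] hom_iff cells_iff) (simp add: mor_of_def d[symmetric] ty 1 2 3)
qed

text \<open>The two-dimensional form of \<open>alg_mult\<close>. The multiplication law of the algebra morphism
  writes \<open>abar\<close> on a product of words as a composite of \<open>abar\<close> on a binary word and
  \<open>T\<^sub>2\<close> of \<open>abar\<close>, and the latter is a monoid 2-cell.\<close>

lemma mor_of_homomorphic:
  assumes L: "alg.is_lax_mor \<phi>"
  shows "homomorphic UNIV (mor_of \<phi>) (J (acarr (adom \<phi>)))
    (aact (adom \<phi>), aact (acod \<phi>) \<cdot> T\<^sub>1 (amap \<phi>), abar \<phi>)"
proof -
  define x a y b f fb n where d: "x = acarr (adom \<phi>)" "a = aact (adom \<phi>)" "y = acarr (acod \<phi>)"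
    "b = aact (acod \<phi>)" "f = amap \<phi>" "fb = abar \<phi>" "n = mmult (monoid_of (acod \<phi>))"
  note T = alg.lax_mor_ty[OF L, folded d] and h = act_T_hom[OF L, folded d]
    and laws = alg.lax_mor_laws[OF L, folded d]
  have ah: "strict_hom (J x) (monoid_of (adom \<phi>)) a" "strict_hom (J y) (monoid_of (acod \<phi>)) b"
    using monoid_of_hom[of "adom \<phi>"] monoid_of_hom[of "acod \<phi>"] T by (simp_all add: d)
  have nT: "n \<in> Mor C" "dom1 C n = y \<boxtimes> y" "cod1 C n = y"
    using monoid_ty(2-4)[OF monoid_of_monoid[OF T(2)]] by (simp_all add: d)
  have bm: "b \<cdot> mmult (J y) = n \<cdot> (b \<otimes> b)" using ah(2) by (simp add: strict_hom_def d)
  let ?ee = "\<eta> (T\<^sub>0 x) \<otimes> \<eta> (T\<^sub>0 x)"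
  have "fb \<star> \<iota> (mmult (J x)) = (fb \<star> \<iota> (\<mu> x)) \<star> \<iota> (binary (T\<^sub>0 x))"
    using T by (simp add: mult_J ty)
  also have "\<dots> = (fb \<star> \<iota> (T\<^sub>1 a \<cdot> binary (T\<^sub>0 x))) \<bullet> (\<iota> b \<star> T\<^sub>2 fb \<star> \<iota> (binary (T\<^sub>0 x)))"
    unfolding laws using T by (simp add: ty)
  also have "T\<^sub>1 a \<cdot> binary (T\<^sub>0 x) = (T\<^sub>1 a \<cdot> mmult (J (T\<^sub>0 x))) \<cdot> ?ee"
    using T by (simp add: binary_def ty)
  also have "\<dots> = binary x \<cdot> (a \<otimes> a)"
    using T by (simp add: T_mult) (simp add: binary_def ty tensor_comp1 alg.unit_nat)
  also have "T\<^sub>2 fb \<star> \<iota> (binary (T\<^sub>0 x)) = (T\<^sub>2 fb \<star> \<iota> (mmult (J (T\<^sub>0 x)))) \<star> \<iota> ?ee"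
    using T by (simp add: binary_def ty)
  also have "T\<^sub>2 fb \<star> \<iota> (mmult (J (T\<^sub>0 x))) = \<iota> (mmult (J y)) \<star> (T\<^sub>2 fb \<circledast> T\<^sub>2 fb)"
    using T by (intro T_cell_mult[of "b \<cdot> T\<^sub>1 f" _ _ _ "f \<cdot> a"]) (simp_all add: hom_iff cells_iff ty)
  also have "\<iota> b \<star> (\<iota> (mmult (J y)) \<star> (T\<^sub>2 fb \<circledast> T\<^sub>2 fb)) \<star> \<iota> ?ee
      = \<iota> (b \<cdot> mmult (J y)) \<star> ((T\<^sub>2 fb \<star> \<iota> (\<eta> (T\<^sub>0 x))) \<circledast> (T\<^sub>2 fb \<star> \<iota> (\<eta> (T\<^sub>0 x))))"
    using T by (simp add: ty tensor_whisker)
  also have "T\<^sub>2 fb \<star> \<iota> (\<eta> (T\<^sub>0 x)) = \<iota> (\<eta> y) \<star> fb"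
    using T by (simp add: alg.unit_nat ty)
  also have "\<iota> (b \<cdot> mmult (J y)) \<star> ((\<iota> (\<eta> y) \<star> fb) \<circledast> (\<iota> (\<eta> y) \<star> fb))
      = \<iota> n \<star> ((\<iota> b \<star> \<iota> (\<eta> y) \<star> fb) \<circledast> (\<iota> b \<star> \<iota> (\<eta> y) \<star> fb))"
    unfolding bm using T nT tensor_whisker(2)[of "\<iota> (\<eta> y) \<star> fb" "\<iota> (\<eta> y) \<star> fb" b b]
    by (simp add: ty whisker_comp(2)[symmetric] del: whisker_comp(2))
  also have "\<iota> b \<star> \<iota> (\<eta> y) \<star> fb = fb"
    using T alg.alg_laws(2)[OF T(2)] by (simp add: ty d)
  finally have mult: "fb \<star> \<iota> (mmult (J x)) = (fb \<star> \<iota> (binary x \<cdot> (a \<otimes> a))) \<bullet> (\<iota> n \<star> (fb \<circledast> fb))" .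
  have "(fb \<star> \<iota> (binary x)) \<star> \<iota> (a \<otimes> a) = fb \<star> \<iota> (binary x \<cdot> (a \<otimes> a))"
    using T by (simp add: ty)
  then show ?thesis
    using mult h ah T unfolding homomorphic_def
    by (simp add: elt_def hom_iff cells_iff J_carrier ty d[symmetric])
      (simp add: mor_of_def eunit_def strict_hom_def d[symmetric] ty)
qed

text \<open>The uniqueness half of \<open>free_elements\<close>, in the form in which equations between structure
  cells are proved.\<close>

lemma homomorphic_unique:
  assumes L: "is_lax_mor \<phi>" and W: "has_commas UNIV" and x: "x \<in> Obj C"
    and t: "homomorphic UNIV \<phi> (J x) t" "homomorphic UNIV \<phi> (J x) t'" "act t (\<eta> x) = act t' (\<eta> x)"
  shows "t = t'"
proof -
  have P: "pre_lax \<phi>" using L by (simp add: is_lax_mor_iff)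
  have "t \<in> elt UNIV \<phi> (T\<^sub>0 x)" using t(1) x by (simp add: homomorphic_def J_carrier)
  then have "act t (\<eta> x) \<in> elt UNIV \<phi> x"
    by (rule act_elt[OF closed_cells_UNIV P]) (use x in \<open>simp add: hom_iff ty\<close>)
  from free_elements[OF L UNIV_I UNIV_I closed_cells_UNIV W free_on_J[OF x] this] t show ?thesis by auto
qed

lemma generic_elt:
  assumes "pre_lax \<phi>" "closed_cells W"
  shows "(\<one> (mcarr (mdom \<phi>)), mmap \<phi>, \<iota> (mmap \<phi>)) \<in> elt W \<phi> (mcarr (mdom \<phi>))"
  using lax_ty[OF assms(1)] assms(2) by (simp add: elt_def hom_iff cells_iff ty closed_cells_def)

lemma generic_prod:
  assumes "pre_lax \<phi>"
  shows "eprod \<phi> (\<one> (mcarr (mdom \<phi>)), mmap \<phi>, \<iota> (mmap \<phi>)) (\<one> (mcarr (mdom \<phi>)), mmap \<phi>, \<iota> (mmap \<phi>))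
    = (mmult (mdom \<phi>), mmult (mcod \<phi>) \<cdot> (mmap \<phi> \<otimes> mmap \<phi>), mbar \<phi>)"
  using lax_ty[OF assms] by (simp add: ty)

text \<open>The generic element is the restriction along \<open>\<eta>\<close> of the homomorphic element \<open>t\<close>.
  Products of restrictions of \<open>t\<close> are restrictions of \<open>t\<close> along products in the free
  monoid, so the laws for the generic element, which are the axioms, follow from the monoid laws
  of \<open>J x\<close>.\<close>

lemma mor_of_lax:
  assumes L: "alg.is_lax_mor \<phi>"
  shows "is_lax_mor (mor_of \<phi>)"
proof -
  define \<psi> where "\<psi> = mor_of \<phi>"
  have P: "pre_lax \<psi>" unfolding \<psi>_def by (rule mor_of_pre_lax[OF L])
  define x f where d: "x = mcarr (mdom \<psi>)" "f = mmap \<psi>"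
  define g where "g = (\<one> x, f, \<iota> f)"
  note T = lax_ty[OF P, folded d]
  define t where "t = (aact (adom \<phi>), aact (acod \<phi>) \<cdot> T\<^sub>1 (amap \<phi>), abar \<phi>)"
  have x: "x = acarr (adom \<phi>)" "f = amap \<phi>" by (simp_all add: d \<psi>_def)
  have t: "homomorphic UNIV \<psi> (J x) t"
    using mor_of_homomorphic[OF L] by (simp add: \<psi>_def t_def x)
  then have te: "t \<in> elt UNIV \<psi> (T\<^sub>0 x)" and tm: "act t (mmult (J x)) = eprod \<psi> t t"
    and tu: "act t (munit (J x)) = eunit \<psi>"
    using T by (simp_all add: homomorphic_def J_carrier)
  have tg: "act t (\<eta> x) = g"
    using act_T_hom(2)[OF L] alg.lax_mor_laws(2)[OF L] alg.alg_laws(2) alg.lax_mor_ty(1)[OF L]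
    by (simp add: t_def g_def x)
  have prod: "eprod \<psi> (act t u) (act t v) = act t (mmult (J x) \<cdot> (u \<otimes> v))"
    if "u \<in> hom C z (T\<^sub>0 x)" "v \<in> hom C z' (T\<^sub>0 x)" for u v z z'
    using eprod_act[OF P te te that] act_act[OF te, of "mmult (J x)" _ "u \<otimes> v"] that T
    by (simp add: tm hom_iff ty)
  have h: "\<eta> x \<in> hom C x (T\<^sub>0 x)" "mmult (J x) \<cdot> (\<eta> x \<otimes> \<eta> x) \<in> hom C (x \<boxtimes> x) (T\<^sub>0 x)" "munit (J x) \<in> hom C \<I> (T\<^sub>0 x)"
    "mmult (J x) \<cdot> (\<eta> x \<otimes> (mmult (J x) \<cdot> (\<eta> x \<otimes> \<eta> x))) \<in> hom C (x \<boxtimes> (x \<boxtimes> x)) (T\<^sub>0 x)"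
    "\<a> x x x \<in> hom C ((x \<boxtimes> x) \<boxtimes> x) (x \<boxtimes> (x \<boxtimes> x))"
    using T by (simp_all add: hom_iff ty)
  note Jm = J_monoid[OF T(12)]
  have "eprod \<psi> (eprod \<psi> g g) g = act t (mmult (J x) \<cdot> ((mmult (J x) \<cdot> (\<eta> x \<otimes> \<eta> x)) \<otimes> \<eta> x))"
    using prod[OF h(1,1)] prod[OF h(2,1)] by (simp add: tg)
  also have "\<dots> = act t ((mmult (J x) \<cdot> (\<eta> x \<otimes> (mmult (J x) \<cdot> (\<eta> x \<otimes> \<eta> x)))) \<cdot> \<a> x x x)"
    using mult_assoc_mor[OF Jm, of "\<eta> x" "\<eta> x" "\<eta> x"] T by (simp add: J_carrier ty)
  also have "\<dots> = act (eprod \<psi> g (eprod \<psi> g g)) (\<a> x x x)"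
    using prod[OF h(1,1)] prod[OF h(1,2)] act_act[OF te h(4,5), symmetric] by (simp add: tg)
  finally have 1: "eprod \<psi> (eprod \<psi> g g) g = act (eprod \<psi> g (eprod \<psi> g g)) (\<a> x x x)" .
  have "eprod \<psi> g (eunit \<psi>) = act t (mmult (J x) \<cdot> (\<eta> x \<otimes> munit (J x)))"
    using prod[OF h(1,3)] by (simp add: tg tu)
  also have "\<dots> = act g (\<r> x)"
    using mult_unit_mor[OF Jm, of "\<eta> x"] act_act[OF te h(1), of "\<r> x", symmetric] T
    by (simp add: tg hom_iff J_carrier ty)
  finally have 2: "eprod \<psi> g (eunit \<psi>) = act g (\<r> x)" .
  have "eprod \<psi> (eunit \<psi>) g = act t (mmult (J x) \<cdot> (munit (J x) \<otimes> \<eta> x))"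
    using prod[OF h(3,1)] by (simp add: tg tu)
  also have "\<dots> = act g (\<l> x)"
    using mult_unit_mor[OF Jm, of "\<eta> x"] act_act[OF te h(1), of "\<l> x", symmetric] T
    by (simp add: tg hom_iff J_carrier ty)
  finally have 3: "eprod \<psi> (eunit \<psi>) g = act g (\<l> x)" .
  have gg: "eprod \<psi> g g = (mmult (mdom \<psi>), mmult (mcod \<psi>) \<cdot> (f \<otimes> f), mbar \<psi>)"
    using generic_prod[OF P] by (simp add: g_def d)
  show ?thesis
    unfolding \<psi>_def[symmetric] is_lax_mor_iff Let_def d[symmetric]
  proof (intro conjI)
    show "pre_lax \<psi>" by (rule P)
    show "(mbar \<psi> \<star> \<iota> (\<one> x \<otimes> mmult (mdom \<psi>)) \<bullet> \<iota> (mmult (mcod \<psi>)) \<star> \<iota> f \<circledast> mbar \<psi>) \<star> \<iota> (\<a> x x x)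
      = mbar \<psi> \<star> \<iota> (mmult (mdom \<psi>) \<otimes> \<one> x) \<bullet> \<iota> (mmult (mcod \<psi>)) \<star> mbar \<psi> \<circledast> \<iota> f"
      using 1 unfolding gg unfolding g_def by simp
    show "mbar \<psi> \<star> \<iota> (\<one> x \<otimes> munit (mdom \<psi>)) \<bullet> \<iota> (mmult (mcod \<psi>)) \<star> \<iota> f \<circledast> mzero \<psi> = \<iota> (f \<cdot> \<r> x)"
      using 2 T by (simp add: g_def eunit_def ty)
    show "mbar \<psi> \<star> \<iota> (munit (mdom \<psi>) \<otimes> \<one> x) \<bullet> \<iota> (mmult (mcod \<psi>)) \<star> mzero \<psi> \<circledast> \<iota> f = \<iota> (f \<cdot> \<l> x)"
      using 3 T by (simp add: g_def eunit_def ty)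
  qed
qed

text \<open>The structure cell of the algebra morphism is the 2-cell \<open>h\<close> of the homomorphic extension of
  the generic element. Its 1-cells are forced by freeness, because they restrict to the identity
  and to \<open>f\<close>. Taking the extension in \<open>W\<close> shows that \<open>h\<close> is invertible or an identity when
  the structure cells of \<open>\<psi>\<close> are.\<close>

lemma lax_mor_exists:
  assumes L: "is_lax_mor \<psi>" "mbar \<psi> \<in> W" "mzero \<psi> \<in> W"
    and W: "closed_cells W" "has_commas W" "has_commas UNIV"
  shows "\<exists>\<phi>. alg.is_lax_mor \<phi> \<and> mor_of \<phi> = \<psi> \<and> abar \<phi> \<in> W"
proof -
  have P: "pre_lax \<psi>" using L by (simp add: is_lax_mor_iff)
  define X Y x y f where d: "X = mdom \<psi>" "Y = mcod \<psi>" "x = mcarr X" "y = mcarr Y" "f = mmap \<psi>"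
  note T = lax_ty[OF P, folded d]
  define g where "g = (\<one> x, f, \<iota> f)"
  have g: "g \<in> elt W \<psi> x" using generic_elt[OF P W(1)] by (simp add: g_def d)
  obtain t where t: "homomorphic W \<psi> (J x) t" "act t (\<eta> x) = g"
    using free_elements[OF L W(1,2) free_on_J[OF T(12)] g] by blast
  obtain a b h where tabh: "t = (a, b, h)" by (metis prod.exhaust)
  define c where "c = e Y"
  note Jm = J_monoid[OF T(12)]
  have hs: "strict_hom (J x) X a" "strict_hom (J x) Y b"
    using homomorphic_strict_homs[OF t(1)[unfolded tabh] P Jm] by (simp_all add: d)
  have tg: "a \<cdot> \<eta> x = \<one> x" "b \<cdot> \<eta> x = f" "h \<star> \<iota> (\<eta> x) = \<iota> f"
    using t(2) by (simp_all add: tabh g_def)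
  have XY: "is_monoid X" "is_monoid Y" using T by simp_all
  note cX = counit_hom[OF XY(1), folded d] and cY = counit_hom[OF XY(2), folded c_def d]
  have cT: "c \<in> Mor C" "dom1 C c = T\<^sub>0 y" "cod1 C c = y"
    using strict_hom_ty[OF cY] T by (simp_all add: J_carrier d)
  have cu: "c \<cdot> \<eta> y = \<one> y" "e X \<cdot> \<eta> x = \<one> x"
    using counit_unit[OF XY(1)] counit_unit[OF XY(2)] by (simp_all add: c_def d)
  have a: "a = e X"
    using free_hom_unique[OF T(12) hs(1) cX] by (simp add: tg cu)
  have b: "b = c \<cdot> T\<^sub>1 f"
  proof (rule free_hom_unique[OF T(12) hs(2)])
    show "strict_hom (J x) Y (c \<cdot> T\<^sub>1 f)"
      by (rule strict_hom_comp[OF T_hom cY]) (use T in \<open>simp add: hom_iff\<close>)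
    have "(c \<cdot> T\<^sub>1 f) \<cdot> \<eta> x = (c \<cdot> \<eta> y) \<cdot> f" using T cT by (simp add: ty alg.unit_nat)
    then show "b \<cdot> \<eta> x = (c \<cdot> T\<^sub>1 f) \<cdot> \<eta> x" using T by (simp add: tg cu ty)
  qed
  have abT: "a \<in> Mor C" "dom1 C a = T\<^sub>0 x" "cod1 C a = x" "b \<in> Mor C" "dom1 C b = T\<^sub>0 x" "cod1 C b = y"
    "h \<in> Cell C" "dom2 C h = b" "cod2 C h = f \<cdot> a" "h \<in> W"
    using t(1) T unfolding tabh by (auto simp: homomorphic_def elt_def hom_iff cells_iff d J_carrier)
  have te: "t \<in> elt W \<psi> (T\<^sub>0 x)" using t(1) T by (simp add: homomorphic_def J_carrier)
  have tU: "homomorphic UNIV \<psi> (J x) t"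
    using t(1) unfolding homomorphic_def by (auto simp: elt_def)
  \<comment> \<open>Restricting along binary words and the empty word recovers the structure cells of \<open>\<psi>\<close>.\<close>
  have "act t (binary x) = act (eprod \<psi> t t) (\<eta> x \<otimes> \<eta> x)"
    using act_act[OF te, of "mmult (J x)" _ "\<eta> x \<otimes> \<eta> x"] t(1) T
    by (simp add: homomorphic_def binary_def hom_iff ty)
  also have "\<dots> = eprod \<psi> g g"
    using eprod_act[OF P te te, of "\<eta> x" x "\<eta> x" x] T by (simp add: t(2) hom_iff ty)
  also have "\<dots> = (mmult X, mmult Y \<cdot> (f \<otimes> f), mbar \<psi>)"
    using generic_prod[OF P] by (simp add: g_def d)
  finally have bar: "h \<star> \<iota> (binary x) = mbar \<psi>" by (simp add: tabh)
  have zero: "h \<star> \<iota> (munit (J x)) = mzero \<psi>"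
    using t(1) by (simp add: homomorphic_def tabh eunit_def)
  \<comment> \<open>Both sides of the multiplication law are homomorphic elements over the free monoid on \<open>T\<^sub>0 x\<close>
    that restrict to \<open>t\<close> along the unit.\<close>
  define k where "k = \<iota> c \<star> T\<^sub>2 h"
  have kT: "k \<in> Cell C" "dom2 C k = c \<cdot> T\<^sub>1 b" "cod2 C k = b \<cdot> T\<^sub>1 a"
    using abT cT T by (simp_all add: k_def ty b)
  have Tx: "T\<^sub>0 x \<in> Obj C" using T by (simp add: ty)
  note JT = J_monoid[OF Tx]
  have muh: "strict_hom (J (T\<^sub>0 x)) (J x) (\<mu> x)"
    using counit_hom[OF Jm] T by (simp add: J_carrier counit_free)
  have Tah: "strict_hom (J (T\<^sub>0 x)) (J x) (T\<^sub>1 a)"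
    using T_hom[of a "T\<^sub>0 x" x] abT by (simp add: hom_iff)
  have cm: "c \<cdot> mmult (J y) = mmult Y \<cdot> (c \<otimes> c)" "c \<cdot> munit (J y) = munit Y"
    using cY by (simp_all add: strict_hom_def)
  have Th: "T\<^sub>2 h \<star> \<iota> (mmult (J (T\<^sub>0 x))) = \<iota> (mmult (J y)) \<star> (T\<^sub>2 h \<circledast> T\<^sub>2 h)"
    "T\<^sub>2 h \<star> \<iota> (munit (J (T\<^sub>0 x))) = \<iota> (munit (J y))"
    using abT by (auto intro!: T_cell_mult[of b _ _ _ "f \<cdot> a"] T_cell_unit[of b _ _ _ "f \<cdot> a"] simp: hom_iff cells_iff)
  have "k \<star> \<iota> (mmult (J (T\<^sub>0 x))) = \<iota> c \<star> (T\<^sub>2 h \<star> \<iota> (mmult (J (T\<^sub>0 x))))"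
    using abT cT T Tx by (simp add: k_def ty)
  also have "\<dots> = \<iota> (c \<cdot> mmult (J y)) \<star> (T\<^sub>2 h \<circledast> T\<^sub>2 h)"
    unfolding Th using abT cT T Tx by (simp add: ty)
  also have "\<dots> = \<iota> (mmult Y) \<star> (k \<circledast> k)"
    unfolding cm k_def using abT cT T Tx tensor_whisker(2)[of "T\<^sub>2 h" "T\<^sub>2 h" c c]
    by (simp add: ty whisker_comp(2)[symmetric] del: whisker_comp(2))
  finally have k1: "k \<star> \<iota> (mmult (J (T\<^sub>0 x))) = \<iota> (mmult Y) \<star> (k \<circledast> k)" .
  have "k \<star> \<iota> (munit (J (T\<^sub>0 x))) = \<iota> c \<star> (T\<^sub>2 h \<star> \<iota> (munit (J (T\<^sub>0 x))))"
    using abT cT T Tx by (simp add: k_def ty)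
  then have k2: "k \<star> \<iota> (munit (J (T\<^sub>0 x))) = \<iota> (munit Y)"
    unfolding Th using cT T cm by (simp add: ty)
  have s1: "homomorphic UNIV \<psi> (J (T\<^sub>0 x)) (act t (\<mu> x))"
    by (rule homomorphic_act[OF tU P closed_cells_UNIV muh])
  have "homomorphic UNIV \<psi> (J (T\<^sub>0 x)) (a \<cdot> T\<^sub>1 a, b \<cdot> T\<^sub>1 a, h \<star> \<iota> (T\<^sub>1 a))"
    using homomorphic_act[OF tU P closed_cells_UNIV Tah] by (simp add: tabh)
  from homomorphic_precell[OF this P JT, of k]
  have s2: "homomorphic UNIV \<psi> (J (T\<^sub>0 x)) (a \<cdot> T\<^sub>1 a, dom2 C k, (h \<star> \<iota> (T\<^sub>1 a)) \<bullet> k)"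
    using kT k1 k2 cT abT Tx by (simp add: d[symmetric] J_carrier ty)
  have r1: "act (act t (\<mu> x)) (\<eta> (T\<^sub>0 x)) = t"
    using act_act[OF te, of "\<mu> x" _ "\<eta> (T\<^sub>0 x)"] act_id[OF te] T
    by (simp add: hom_iff ty alg.mult_unit_left)
  have "((h \<star> \<iota> (T\<^sub>1 a)) \<bullet> k) \<star> \<iota> (\<eta> (T\<^sub>0 x)) = ((h \<star> \<iota> (\<eta> x)) \<star> \<iota> a) \<bullet> ((\<iota> c \<star> \<iota> (\<eta> y)) \<star> h)"
    using abT cT T Tx kT by (simp add: k_def ty alg.unit_nat)
  also have "\<dots> = h" unfolding tg using abT cT T cu by (simp add: ty)
  finally have r2h: "((h \<star> \<iota> (T\<^sub>1 a)) \<bullet> k) \<star> \<iota> (\<eta> (T\<^sub>0 x)) = h" .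
  have "(a \<cdot> T\<^sub>1 a) \<cdot> \<eta> (T\<^sub>0 x) = (a \<cdot> \<eta> x) \<cdot> a" "dom2 C k \<cdot> \<eta> (T\<^sub>0 x) = (c \<cdot> \<eta> y) \<cdot> b"
    using abT cT T Tx kT by (simp_all add: ty alg.unit_nat)
  then have "act (a \<cdot> T\<^sub>1 a, dom2 C k, (h \<star> \<iota> (T\<^sub>1 a)) \<bullet> k) (\<eta> (T\<^sub>0 x)) = t"
    using r2h abT by (simp add: tg cu tabh ty)
  then have "act t (\<mu> x) = (a \<cdot> T\<^sub>1 a, dom2 C k, (h \<star> \<iota> (T\<^sub>1 a)) \<bullet> k)"
    using r1 by (intro homomorphic_unique[OF L(1) W(3) Tx s1 s2]) simp
  then have mu: "h \<star> \<iota> (\<mu> x) = (h \<star> \<iota> (T\<^sub>1 a)) \<bullet> (\<iota> c \<star> T\<^sub>2 h)" by (simp add: tabh k_def)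
  define \<phi> where "\<phi> = \<lparr>adom = \<lparr>acarr = x, aact = e X\<rparr>, acod = \<lparr>acarr = y, aact = e Y\<rparr>, amap = f, abar = h\<rparr>"
  have "alg.is_lax_mor \<phi>"
    using counit_alg(1)[OF XY(1)] counit_alg(1)[OF XY(2)] mu tg abT b T
    by (simp add: alg.is_lax_mor_def \<phi>_def Let_def d[symmetric] hom_iff cells_iff c_def a[symmetric])
  moreover have "mor_of \<phi> = \<psi>"
    using counit_alg(2)[OF XY(1)] counit_alg(2)[OF XY(2)] bar zero
    by (cases \<psi>) (simp add: mor_of_def \<phi>_def d)
  ultimately show ?thesis using abT by (auto simp: \<phi>_def)
qed

lemma monoid_of_inj:
  assumes "alg.is_alg A" "alg.is_alg B" "monoid_of A = monoid_of B"
  shows "A = B"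
proof -
  have "acarr A = acarr B" using assms(3) by (simp add: monoid_of_def)
  moreover have "aact A = aact B"
    using counit_monoid_of[OF assms(1)] counit_monoid_of[OF assms(2)] assms(3) by simp
  ultimately show ?thesis by (cases A; cases B) simp
qed

text \<open>The structure cells of both algebra morphisms are homomorphic extensions of the same generic
  element.\<close>

lemma mor_of_inj:
  assumes L: "alg.is_lax_mor \<phi>" "alg.is_lax_mor \<psi>" and eq: "mor_of \<phi> = mor_of \<psi>"
    and W: "has_commas UNIV"
  shows "\<phi> = \<psi>"
proof -
  have "monoid_of (adom \<phi>) = monoid_of (adom \<psi>)" "monoid_of (acod \<phi>) = monoid_of (acod \<psi>)"
    using eq mor_of_simps(2,3) by metis+
  then have same: "adom \<phi> = adom \<psi>" "acod \<phi> = acod \<psi>"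
    using monoid_of_inj alg.lax_mor_ty(1,2)[OF L(1)] alg.lax_mor_ty(1,2)[OF L(2)] by blast+
  have f: "amap \<phi> = amap \<psi>" using eq mor_of_simps(4) by metis
  note T = alg.lax_mor_ty[OF L(1)]
  let ?x = "acarr (adom \<phi>)"
  define t t' where t: "t = (aact (adom \<phi>), aact (acod \<phi>) \<cdot> T\<^sub>1 (amap \<phi>), abar \<phi>)"
    "t' = (aact (adom \<psi>), aact (acod \<psi>) \<cdot> T\<^sub>1 (amap \<psi>), abar \<psi>)"
  have h: "homomorphic UNIV (mor_of \<phi>) (J ?x) t" "homomorphic UNIV (mor_of \<phi>) (J ?x) t'"
    using mor_of_homomorphic[OF L(1)] mor_of_homomorphic[OF L(2)] same by (simp_all add: t eq[symmetric])
  have r: "act t (\<eta> ?x) = act t' (\<eta> ?x)"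
    using alg.lax_mor_laws(2)[OF L(1)] alg.lax_mor_laws(2)[OF L(2)] same f by (simp add: t)
  have "t = t'" by (rule homomorphic_unique[OF mor_of_lax[OF L(1)] W T(3) h r])
  then show ?thesis using same f by (cases \<phi>; cases \<psi>) (simp add: t)
qed

lemma T_binary:
  assumes "f \<in> Mor C" "dom1 C f = x"
  shows "T\<^sub>1 f \<cdot> binary x = binary (cod1 C f) \<cdot> (f \<otimes> f)"
proof -
  have x: "x \<in> Obj C" using assms obj_ty(1)[of f] by simp
  have "T\<^sub>1 f \<cdot> binary x = (T\<^sub>1 f \<cdot> mmult (J x)) \<cdot> (\<eta> x \<otimes> \<eta> x)"
    using assms x by (simp add: binary_def ty)
  then show ?thesis
    unfolding T_mult[OF assms] using assms x by (simp add: binary_def ty tensor_comp1 alg.unit_nat)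
qed

lemma T_munit:
  assumes "f \<in> Mor C" "dom1 C f = x"
  shows "T\<^sub>1 f \<cdot> munit (J x) = munit (J (cod1 C f))"
  using T_hom[of f x "cod1 C f"] assms by (simp add: hom_iff strict_hom_def)

lemma mor_of_comp:
  assumes L: "alg.is_lax_mor \<phi>" "alg.is_lax_mor \<psi>" and c: "adom \<psi> = acod \<phi>" and w: "w \<noteq> Colax"
  shows "mor_of (alg.alg_comp w \<psi> \<phi>) = mon_comp w (mor_of \<psi>) (mor_of \<phi>)"
  using w alg.lax_mor_ty[OF L(1)] alg.lax_mor_ty[OF L(2), unfolded c] c
  by (simp add: mor_of_def alg.alg_comp_def mon_comp_def Let_def ty T_binary T_munit)

lemma mor_of_id:
  assumes "alg.is_alg A"
  shows "mor_of (alg.alg_id A) = mon_id (monoid_of A)"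
  using alg.alg_ty[OF assms]
  by (simp add: mor_of_def alg.alg_id_def mon_id_def monoid_of_def ty)

text \<open>From algebras to monoids, the condition is restricted to binary words and the empty word.
  Conversely, both sides of the condition for algebras are homomorphic elements of \<open>mor_of \<psi>\<close>
  that restrict to \<open>\<alpha>\<close> on generators.\<close>

lemma cell_law_iff:
  assumes L: "alg.is_lax_mor \<phi>" "alg.is_lax_mor \<psi>" and same: "adom \<psi> = adom \<phi>" "acod \<psi> = acod \<phi>"
    and \<alpha>: "\<alpha> \<in> cells C (amap \<phi>) (amap \<psi>)" and W: "has_commas UNIV"
  shows "alg.cell_law \<phi> \<psi> \<alpha> \<longleftrightarrow>
    (\<alpha> \<star> \<iota> (mmult (monoid_of (adom \<phi>)))) \<bullet> mbar (mor_of \<phi>)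
      = mbar (mor_of \<psi>) \<bullet> (\<iota> (mmult (monoid_of (acod \<phi>))) \<star> (\<alpha> \<circledast> \<alpha>)) \<and>
    (\<alpha> \<star> \<iota> (munit (monoid_of (adom \<phi>)))) \<bullet> mzero (mor_of \<phi>) = mzero (mor_of \<psi>)"
    (is "_ \<longleftrightarrow> ?mult \<and> ?unit")
proof -
  define x a y b f g fb gb n j where d: "x = acarr (adom \<phi>)" "a = aact (adom \<phi>)" "y = acarr (acod \<phi>)"
    "b = aact (acod \<phi>)" "f = amap \<phi>" "g = amap \<psi>" "fb = abar \<phi>" "gb = abar \<psi>"
    "n = mmult (monoid_of (acod \<phi>))" "j = munit (monoid_of (acod \<phi>))"
  note T = alg.lax_mor_ty[OF L(1), folded d] alg.lax_mor_ty[OF L(2), unfolded same, folded d]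
    \<alpha>[unfolded cells_iff, folded d]
  have nT: "n \<in> Mor C" "dom1 C n = y \<boxtimes> y" "cod1 C n = y" "j \<in> Mor C" "dom1 C j = \<I>" "cod1 C j = y"
    using monoid_ty[OF monoid_of_monoid[OF T(2)]] by (simp_all add: d)
  have bh: "b \<cdot> mmult (J y) = n \<cdot> (b \<otimes> b)" "b \<cdot> munit (J y) = j"
    using monoid_of_hom[OF T(2)] by (simp_all add: strict_hom_def d)
  \<comment> \<open>\<open>b \<cdot> T \<alpha>\<close> is a monoid 2-cell between strict homomorphisms restricting to \<open>\<alpha>\<close>.\<close>
  define k where "k = \<iota> b \<star> T\<^sub>2 \<alpha>"
  have kT: "k \<in> Cell C" "dom2 C k = b \<cdot> T\<^sub>1 f" "cod2 C k = b \<cdot> T\<^sub>1 g"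
    using T by (simp_all add: k_def ty)
  have "k \<star> \<iota> (\<eta> x) = \<iota> (b \<cdot> \<eta> y) \<star> \<alpha>"
    using T by (simp add: k_def ty alg.unit_nat)
  then have ke: "k \<star> \<iota> (\<eta> x) = \<alpha>"
    using T alg.alg_laws(2)[OF T(2)] by (simp add: d[symmetric] ty)
  have TC: "T\<^sub>2 \<alpha> \<star> \<iota> (mmult (J x)) = \<iota> (mmult (J y)) \<star> (T\<^sub>2 \<alpha> \<circledast> T\<^sub>2 \<alpha>)"
    "T\<^sub>2 \<alpha> \<star> \<iota> (munit (J x)) = \<iota> (munit (J y))"
    using T by (auto intro!: T_cell_mult[of f _ _ _ g] T_cell_unit[of f _ _ _ g] simp: hom_iff cells_iff)
  have "k \<star> \<iota> (mmult (J x)) = \<iota> b \<star> (T\<^sub>2 \<alpha> \<star> \<iota> (mmult (J x)))" using T by (simp add: k_def ty)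
  also have "\<dots> = \<iota> (b \<cdot> mmult (J y)) \<star> (T\<^sub>2 \<alpha> \<circledast> T\<^sub>2 \<alpha>)" unfolding TC using T by (simp add: ty)
  also have "\<dots> = \<iota> n \<star> (k \<circledast> k)"
    unfolding bh k_def using T nT tensor_whisker(2)[of "T\<^sub>2 \<alpha>" "T\<^sub>2 \<alpha>" b b]
    by (simp add: ty whisker_comp(2)[symmetric] del: whisker_comp(2))
  finally have km: "k \<star> \<iota> (mmult (J x)) = \<iota> n \<star> (k \<circledast> k)" .
  have "k \<star> \<iota> (munit (J x)) = \<iota> b \<star> (T\<^sub>2 \<alpha> \<star> \<iota> (munit (J x)))" using T by (simp add: k_def ty)
  then have ku: "k \<star> \<iota> (munit (J x)) = \<iota> j" unfolding TC using T bh by (simp add: ty)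
  have "k \<star> \<iota> (binary x) = (k \<star> \<iota> (mmult (J x))) \<star> \<iota> (\<eta> x \<otimes> \<eta> x)"
    using kT T by (simp add: binary_def ty)
  also have "\<dots> = \<iota> n \<star> ((k \<star> \<iota> (\<eta> x)) \<circledast> (k \<star> \<iota> (\<eta> x)))"
    unfolding km using kT T nT by (simp add: ty tensor_whisker)
  finally have kb: "k \<star> \<iota> (binary x) = \<iota> n \<star> (\<alpha> \<circledast> \<alpha>)" by (simp add: ke)
  note S = mor_of_def monoid_of_def
  show ?thesis
  proof
    assume "alg.cell_law \<phi> \<psi> \<alpha>"
    then have law: "(\<alpha> \<star> \<iota> a) \<bullet> fb = gb \<bullet> k" by (simp add: alg.cell_law_def d k_def)
    have "((\<alpha> \<star> \<iota> a) \<bullet> fb) \<star> \<iota> (binary x) = (gb \<bullet> k) \<star> \<iota> (binary x)"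
      "((\<alpha> \<star> \<iota> a) \<bullet> fb) \<star> \<iota> (munit (J x)) = (gb \<bullet> k) \<star> \<iota> (munit (J x))" by (simp_all add: law)
    then have "(\<alpha> \<star> \<iota> (a \<cdot> binary x)) \<bullet> (fb \<star> \<iota> (binary x)) = (gb \<star> \<iota> (binary x)) \<bullet> (\<iota> n \<star> (\<alpha> \<circledast> \<alpha>))"
      "(\<alpha> \<star> \<iota> (a \<cdot> munit (J x))) \<bullet> (fb \<star> \<iota> (munit (J x))) = gb \<star> \<iota> (munit (J x))"
      using T kT bh by (simp_all add: ty kb ku T_munit)
    then show "?mult \<and> ?unit"
      using same by (simp add: mor_of_def monoid_of_def[of "adom \<phi>"] d[symmetric])
  next
    assume M: "?mult \<and> ?unit"
    have P: "pre_lax (mor_of \<phi>)" "pre_lax (mor_of \<psi>)" using L by (simp_all add: mor_of_pre_lax)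
    note Jm = J_monoid[OF T(3)]
    have f1: "homomorphic UNIV (mor_of \<phi>) (J x) (a, b \<cdot> T\<^sub>1 f, fb)"
      and g1: "homomorphic UNIV (mor_of \<psi>) (J x) (a, b \<cdot> T\<^sub>1 g, gb)"
      using mor_of_homomorphic[OF L(1)] mor_of_homomorphic[OF L(2)] same by (simp_all add: d)
    have 1: "homomorphic UNIV (mor_of \<psi>) (J x) (a, b \<cdot> T\<^sub>1 f, (\<alpha> \<star> \<iota> a) \<bullet> fb)"
      using homomorphic_postcell[OF f1 P Jm _ _ _ conjunct1 conjunct2, of \<alpha>] M same \<alpha> by simp
    have 2: "homomorphic UNIV (mor_of \<psi>) (J x) (a, b \<cdot> T\<^sub>1 f, gb \<bullet> k)"
      using homomorphic_precell[OF g1 P(2) Jm, of k] kT km ku T same by (simp add: d[symmetric] J_carrier ty)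
    have r: "act (a, b \<cdot> T\<^sub>1 f, (\<alpha> \<star> \<iota> a) \<bullet> fb) (\<eta> x) = act (a, b \<cdot> T\<^sub>1 f, gb \<bullet> k) (\<eta> x)"
    proof -
      have "((\<alpha> \<star> \<iota> a) \<bullet> fb) \<star> \<iota> (\<eta> x) = (\<alpha> \<star> \<iota> (a \<cdot> \<eta> x)) \<bullet> (fb \<star> \<iota> (\<eta> x))" using T by (simp add: ty)
      also have "\<dots> = \<alpha>"
        using T alg.lax_mor_laws(2)[OF L(1), folded d] alg.alg_laws(2)[OF T(1), folded d] by (simp add: ty)
      finally have 1: "((\<alpha> \<star> \<iota> a) \<bullet> fb) \<star> \<iota> (\<eta> x) = \<alpha>" .
      have "(gb \<bullet> k) \<star> \<iota> (\<eta> x) = (gb \<star> \<iota> (\<eta> x)) \<bullet> (k \<star> \<iota> (\<eta> x))" using T kT by (simp add: ty)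
      also have "\<dots> = \<alpha>"
        using T alg.lax_mor_laws(2)[OF L(2), unfolded same, folded d] by (simp add: ty ke)
      finally show ?thesis using 1 by simp
    qed
    have "(a, b \<cdot> T\<^sub>1 f, (\<alpha> \<star> \<iota> a) \<bullet> fb) = (a, b \<cdot> T\<^sub>1 f, gb \<bullet> k)"
      by (rule homomorphic_unique[OF mor_of_lax[OF L(2)] W T(3) 1 2 r])
    then show "alg.cell_law \<phi> \<psi> \<alpha>" by (simp add: alg.cell_law_def d k_def)
  qed
qed

end

section \<open>The isomorphism between algebras and monoids\<close>

context monoidal_two_category
begin

lemma co_is_monoid: "monoidal_two_category.is_monoid (co C) M = is_monoid"
  by (intro ext) (simp add: is_monoid_def monoidal_two_category.is_monoid_def[OF co_monoidal] Let_def)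

lemma co_strict_hom: "monoidal_two_category.strict_hom (co C) M = strict_hom"
  by (intro ext) (simp add: strict_hom_def monoidal_two_category.strict_hom_def[OF co_monoidal] co_is_monoid)

lemma colax_is_co_lax: "is_colax_mor \<phi> \<longleftrightarrow> monoidal_two_category.is_lax_mor (co C) M \<phi>"
  by (simp add: is_colax_mor_def monoidal_two_category.is_lax_mor_def[OF co_monoidal] co_is_monoid Let_def)

lemma co_mon_comp: "monoidal_two_category.mon_comp (co C) M Lax = mon_comp Colax"
  by (intro ext) (simp add: mon_comp_def monoidal_two_category.mon_comp_def[OF co_monoidal] Let_def)

definition structure_cells :: "weakness \<Rightarrow> 'c set" where
  "structure_cells w = (case w of Strict \<Rightarrow> Collect (identity2 C) | Pseudo \<Rightarrow> Collect (iso2 C) | _ \<Rightarrow> UNIV)"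

lemma closed_structure_cells: "closed_cells (structure_cells w)"
proof (cases w)
  case Strict
  have "closed_cells (Collect (identity2 C))"
    unfolding closed_cells_def identity2_def by (auto simp: ty)
  then show ?thesis using Strict by (simp add: structure_cells_def)
qed (simp_all add: structure_cells_def closed_cells_UNIV closed_cells_iso2)

lemma is_mor_iff:
  "w \<noteq> Colax \<Longrightarrow> is_mor w \<phi> \<longleftrightarrow> is_lax_mor \<phi> \<and> mbar \<phi> \<in> structure_cells w \<and> mzero \<phi> \<in> structure_cells w"
  by (cases w) (auto simp: structure_cells_def)

text \<open>An element whose 2-cell is an identity is determined by its 1-cell \<open>a\<close>, so it is represented
  by the domain of \<open>f\<close>.\<close>

lemma has_commas_identity: "has_commas (Collect (identity2 C))"
  unfolding has_commas_def
proof (intro allI ballI)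
  fix x y f assume f: "f \<in> hom C x y"
  then have x: "x \<in> Obj C" by (auto simp: hom_iff ty)
  have "\<exists>!u. u \<in> hom C z x \<and> \<one> x \<cdot> u = a \<and> f \<cdot> u = b \<and> \<iota> f \<star> \<iota> u = h"
    if a: "a \<in> hom C z x" and h: "h \<in> cells C b (f \<cdot> a) \<inter> Collect (identity2 C)" for z a b h
  proof (rule ex1I[of _ a])
    have "h = \<iota> (f \<cdot> a)" "b = f \<cdot> a"
      using h by (auto simp: cells_iff identity2_def ty)
    then show "a \<in> hom C z x \<and> \<one> x \<cdot> a = a \<and> f \<cdot> a = b \<and> \<iota> f \<star> \<iota> a = h"
      using a f by (simp add: hom_iff ty)
  qed (auto simp: hom_iff ty)
  moreover have "\<one> x \<in> hom C x x" "\<iota> f \<in> cells C f (f \<cdot> \<one> x) \<inter> Collect (identity2 C)"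
    using f x by (auto simp: hom_iff cells_iff identity2_def ty)
  ultimately show "\<exists>P \<in> Obj C. \<exists>p \<in> hom C P x. \<exists>q \<in> hom C P y. \<exists>l \<in> cells C q (f \<cdot> p) \<inter> Collect (identity2 C).
       \<forall>z \<in> Obj C. \<forall>a \<in> hom C z x. \<forall>b \<in> hom C z y. \<forall>h \<in> cells C b (f \<cdot> a) \<inter> Collect (identity2 C).
         \<exists>!u. u \<in> hom C z P \<and> p \<cdot> u = a \<and> q \<cdot> u = b \<and> l \<star> \<iota> u = h"
    using f x by blast
qed

end

context free_monoids
begin

lemma co_free_monoids: "free_monoids (co C) M T J e"
proof -
  interpret co: monoidal_two_category "co C" M by (rule co_monoidal)
  interpret coalg: two_monad "co C" T by (rule alg.co_two_monad)
  have T: "T\<^sub>2 \<alpha> \<star> \<iota> (mmult (J x)) = \<iota> (mmult (J y)) \<star> (T\<^sub>2 \<alpha> \<circledast> T\<^sub>2 \<alpha>)"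
    "T\<^sub>2 \<alpha> \<star> \<iota> (munit (J x)) = \<iota> (munit (J y))"
    if f: "f \<in> hom C x y" and \<alpha>: "\<alpha> \<in> cells C g f" for f g x y \<alpha>
  proof -
    have "g \<in> hom C x y" using f \<alpha> globular_dom[of \<alpha>] globular_cod[of \<alpha>] dom2_in[of \<alpha>]
      by (simp add: hom_iff cells_iff)
    then show "T\<^sub>2 \<alpha> \<star> \<iota> (mmult (J x)) = \<iota> (mmult (J y)) \<star> (T\<^sub>2 \<alpha> \<circledast> T\<^sub>2 \<alpha>)"
      "T\<^sub>2 \<alpha> \<star> \<iota> (munit (J x)) = \<iota> (munit (J y))"
      using \<alpha> by (rule T_cell_mult T_cell_unit)+
  qed
  show ?thesis
    by (unfold_locales; unfold co_is_monoid co_strict_hom co_simps)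
      (rule J_monoid J_carrier T_hom T counit_hom counit_nat counit_unit counit_free; assumption)+
qed

lemma co_mor_of:
  "free_monoids.monoid_of (co C) M T J = monoid_of" "free_monoids.mor_of (co C) M T J = mor_of"
proof -
  interpret co: free_monoids "co C" M T J e by (rule co_free_monoids)
  have b: "co.binary = binary" by (intro ext) (simp add: binary_def co.binary_def)
  show m: "co.monoid_of = monoid_of" by (intro ext) (simp add: monoid_of_def co.monoid_of_def b)
  show "co.mor_of = mor_of" by (intro ext) (simp add: mor_of_def co.mor_of_def b m)
qed

lemma alg_is_mor_iff:
  "w \<noteq> Colax \<Longrightarrow> alg.is_mor w \<phi> \<longleftrightarrow> alg.is_lax_mor \<phi> \<and> abar \<phi> \<in> structure_cells w"
  by (cases w) (auto simp: structure_cells_def)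

end

locale free_monoids_with_commas = free_monoids C M T J e
  for C :: "('o, 'm, 'c) two_cat" (structure) and M :: "('o, 'm, 'c) monoidal_structure"
    and T :: "('o, 'm, 'c) monad" and J :: "'o \<Rightarrow> ('o, 'm) mon" and e :: "('o, 'm) mon \<Rightarrow> 'm" +
  assumes lax_commas: "has_commas UNIV"
    and iso_commas: "has_commas (Collect (iso2 C))"
    and colax_commas: "two_category.has_commas (co C) UNIV"
begin

interpretation co: free_monoids "co C" M T J e by (rule co_free_monoids)

lemma structure_commas: "has_commas (structure_cells w)"
  by (cases w) (simp_all add: structure_cells_def lax_commas iso_commas has_commas_identity)

lemma mor_of_is_mor:
  assumes "alg.is_mor w \<phi>"
  shows "is_mor w (mor_of \<phi>)"
proof (cases "w = Colax")
  case True
  then show ?thesis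
    using assms co.mor_of_lax[of \<phi>] by (simp add: colax_is_co_lax alg.colax_is_co_lax co_mor_of)
next
  case False
  then have L: "alg.is_lax_mor \<phi>" and W: "abar \<phi> \<in> structure_cells w"
    using assms by (simp_all add: alg_is_mor_iff)
  note T = alg.lax_mor_ty[OF L]
  have "mbar (mor_of \<phi>) \<in> structure_cells w" "mzero (mor_of \<phi>) \<in> structure_cells w"
    using closed_structure_cells[of w] W T unfolding closed_cells_def by (simp_all add: mor_of_def ty)
  then show ?thesis using mor_of_lax[OF L] False by (simp add: is_mor_iff)
qed

lemma mor_of_surj:
  assumes "is_mor w \<psi>"
  shows "\<exists>\<phi>. alg.is_mor w \<phi> \<and> mor_of \<phi> = \<psi>"
proof (cases "w = Colax")
  case True
  then show ?thesis
    using assms co.lax_mor_exists[of \<psi> UNIV] colax_commas co.closed_cells_UNIV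
    by (simp add: colax_is_co_lax alg.colax_is_co_lax co_mor_of)
next
  case False
  then show ?thesis
    using assms lax_mor_exists[OF _ _ _ closed_structure_cells structure_commas lax_commas, of \<psi> w]
    by (auto simp: is_mor_iff alg_is_mor_iff)
qed

lemma mor_of_eq_iff:
  assumes "alg.is_mor w \<phi>" "alg.is_mor w \<psi>"
  shows "mor_of \<phi> = mor_of \<psi> \<longleftrightarrow> \<phi> = \<psi>"
proof (cases "w = Colax")
  case True
  then show ?thesis
    using assms co.mor_of_inj[OF _ _ _ colax_commas, of \<phi> \<psi>] by (auto simp: alg.colax_is_co_lax co_mor_of)
next
  case False
  then show ?thesis
    using assms mor_of_inj[OF _ _ _ lax_commas, of \<phi> \<psi>] by (auto simp: alg_is_mor_iff)
qed

lemma cell_of_iff: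
  assumes "alg.is_mor w \<phi>" "alg.is_mor w \<psi>"
  shows "alg.is_cell w \<lparr>adom2 = \<phi>, acod2 = \<psi>, acell = \<alpha>\<rparr> \<longleftrightarrow>
    is_cell w \<lparr>mdom2 = mor_of \<phi>, mcod2 = mor_of \<psi>, mcell = \<alpha>\<rparr>"
proof -
  note A = alg.is_mor_ty(1,2)[OF assms(1)] alg.is_mor_ty(1,2)[OF assms(2)]
  have same: "monoid_of (adom \<psi>) = monoid_of (adom \<phi>) \<longleftrightarrow> adom \<psi> = adom \<phi>"
    "monoid_of (acod \<psi>) = monoid_of (acod \<phi>) \<longleftrightarrow> acod \<psi> = acod \<phi>"
    using monoid_of_inj[OF A(3,1)] monoid_of_inj[OF A(4,2)] by auto
  have M: "is_mor w (mor_of \<phi>)" "is_mor w (mor_of \<psi>)" using assms by (simp_all add: mor_of_is_mor)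
  show ?thesis
  proof (cases "adom \<psi> = adom \<phi> \<and> acod \<psi> = acod \<phi> \<and> \<alpha> \<in> cells C (amap \<phi>) (amap \<psi>)")
    case True
    then have eq: "adom \<psi> = adom \<phi>" "acod \<psi> = acod \<phi>" and \<alpha>: "\<alpha> \<in> cells C (amap \<phi>) (amap \<psi>)" by auto
    show ?thesis
    proof (cases "w = Colax")
      case w: True
      have L: "two_monad.is_lax_mor (co C) T \<phi>" "two_monad.is_lax_mor (co C) T \<psi>"
        using assms w by (simp_all add: alg.colax_is_co_lax)
      have "(\<iota> (aact (acod \<phi>)) \<star> T\<^sub>2 \<alpha>) \<bullet> abar \<phi> = abar \<psi> \<bullet> (\<alpha> \<star> \<iota> (aact (adom \<phi>))) \<longleftrightarrow>
        (\<iota> (mmult (monoid_of (acod \<phi>))) \<star> (\<alpha> \<circledast> \<alpha>)) \<bullet> mbar (mor_of \<phi>)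
          = mbar (mor_of \<psi>) \<bullet> (\<alpha> \<star> \<iota> (mmult (monoid_of (adom \<phi>)))) \<and>
        mzero (mor_of \<phi>) = mzero (mor_of \<psi>) \<bullet> (\<alpha> \<star> \<iota> (munit (monoid_of (adom \<phi>))))"
        using co.cell_law_iff[OF L(2,1) eq[symmetric] _ colax_commas, of \<alpha>] \<alpha>
        unfolding co.alg.cell_law_def co_mor_of co_simps eq by metis
      then show ?thesis
        using assms M w eq \<alpha> by (simp add: alg.is_cell_def is_cell_def Let_def)
    next
      case w: False
      then have L: "alg.is_lax_mor \<phi>" "alg.is_lax_mor \<psi>" using assms by (simp_all add: alg_is_mor_iff)
      show ?thesis
        using cell_law_iff[OF L eq \<alpha> lax_commas] assms M w eq \<alpha>
        by (simp add: alg.is_cell_def is_cell_def Let_def alg.cell_law_def)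
    qed
  next
    case False
    then show ?thesis
      using same by (auto simp: alg.is_cell_def is_cell_def Let_def)
  qed
qed

lemma mor_of_alg_comp:
  assumes "alg.is_mor w \<phi>" "alg.is_mor w \<psi>" "adom \<psi> = acod \<phi>"
  shows "mor_of (alg.alg_comp w \<psi> \<phi>) = mon_comp w (mor_of \<psi>) (mor_of \<phi>)"
proof (cases "w = Colax")
  case True
  then show ?thesis
    using assms co.mor_of_comp[of \<phi> \<psi> Lax]
    by (simp add: alg.colax_is_co_lax co_mor_of alg.co_alg_comp co_mon_comp)
next
  case False
  then show ?thesis using assms mor_of_comp[of \<phi> \<psi> w] by (simp add: alg_is_mor_iff)
qed

text \<open>The same formulas serve every weakness; only the carriers on which they are bijective vary.\<close>

definition to_mon :: "(('o, 'm) alg, ('o, 'm, 'c) alg_mor, ('o, 'm, 'c) alg_cell,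
    ('o, 'm) mon, ('o, 'm, 'c) mon_mor, ('o, 'm, 'c) mon_cell) two_fun" where
  "to_mon = \<lparr>on_obj = monoid_of, on_mor = mor_of, on_cell = cell_of\<rparr>"

lemma alg_is_cell_mor:
  assumes "alg.is_cell w \<theta>"
  shows "alg.is_mor w (adom2 \<theta>)" "alg.is_mor w (acod2 \<theta>)"
  using assms by (simp_all add: alg.is_cell_def Let_def)

lemma to_mon_iso: "two_cat_iso (alg.Alg w) (Mon w) to_mon"
proof -
  interpret B: two_category "alg.Alg w" by (rule alg.two_category_Alg)
  have cell: "alg.is_cell w \<theta> \<longleftrightarrow> is_cell w (cell_of \<theta>)" if "alg.is_mor w (adom2 \<theta>)" "alg.is_mor w (acod2 \<theta>)" for \<theta>
    using cell_of_iff[OF that, of "acell \<theta>"] by (cases \<theta>) (simp add: cell_of_def)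
  show ?thesis
  proof
    show "bij_betw (on_obj to_mon) (Obj (alg.Alg w)) (Obj (Mon w))"
      unfolding bij_betw_def inj_on_def
    proof (intro conjI equalityI subsetI ballI impI)
      fix X assume "X \<in> Obj (Mon w)"
      then have "is_monoid X" by (simp add: Mon_def)
      from counit_alg[OF this] show "X \<in> on_obj to_mon ` Obj (alg.Alg w)"
        by (force simp: to_mon_def alg.Alg_def)
    qed (auto simp: to_mon_def alg.Alg_def Mon_def monoid_of_monoid intro: monoid_of_inj)
    show "bij_betw (on_mor to_mon) (Mor (alg.Alg w)) (Mor (Mon w))"
      unfolding bij_betw_def inj_on_def
    proof (intro conjI equalityI subsetI ballI impI)
      fix \<psi> assume "\<psi> \<in> Mor (Mon w)"
      then obtain \<phi> where "alg.is_mor w \<phi>" "mor_of \<phi> = \<psi>" using mor_of_surj by (auto simp: Mon_def)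
      then show "\<psi> \<in> on_mor to_mon ` Mor (alg.Alg w)" by (auto simp: to_mon_def alg.Alg_def)
    qed (auto simp: to_mon_def alg.Alg_def Mon_def mor_of_eq_iff mor_of_is_mor)
    show "bij_betw (on_cell to_mon) (Cell (alg.Alg w)) (Cell (Mon w))"
      unfolding bij_betw_def inj_on_def
    proof (intro conjI equalityI subsetI ballI impI)
      fix \<theta> \<theta>' assume "\<theta> \<in> Cell (alg.Alg w)" "\<theta>' \<in> Cell (alg.Alg w)" and eq: "on_cell to_mon \<theta> = on_cell to_mon \<theta>'"
      then have "alg.is_cell w \<theta>" "alg.is_cell w \<theta>'" by (simp_all add: alg.Alg_def)
      note m = this[THEN alg_is_cell_mor(1)] this[THEN alg_is_cell_mor(2)]
      have "mor_of (adom2 \<theta>) = mor_of (adom2 \<theta>')" "mor_of (acod2 \<theta>) = mor_of (acod2 \<theta>')" "acell \<theta> = acell \<theta>'"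
        using eq by (simp_all add: to_mon_def cell_of_def)
      then show "\<theta> = \<theta>'"
        using mor_of_eq_iff[OF m(1,2)] mor_of_eq_iff[OF m(3,4)] by simp
    next
      fix \<theta> assume "\<theta> \<in> on_cell to_mon ` Cell (alg.Alg w)"
      then obtain \<theta>' where \<theta>': "alg.is_cell w \<theta>'" "\<theta> = cell_of \<theta>'"
        by (auto simp: to_mon_def alg.Alg_def)
      then have "is_cell w \<theta>" using cell[OF alg_is_cell_mor[OF \<theta>'(1)]] by simp
      then show "\<theta> \<in> Cell (Mon w)" by (simp add: Mon_def)
    next
      fix \<theta> assume "\<theta> \<in> Cell (Mon w)"
      then have c: "is_cell w \<theta>" by (simp add: Mon_def)
      then have "is_mor w (mdom2 \<theta>)" "is_mor w (mcod2 \<theta>)" by (simp_all add: is_cell_def Let_def)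
      then obtain \<phi> \<psi> where m: "alg.is_mor w \<phi>" "mor_of \<phi> = mdom2 \<theta>" "alg.is_mor w \<psi>" "mor_of \<psi> = mcod2 \<theta>"
        using mor_of_surj by metis
      then have "cell_of \<lparr>adom2 = \<phi>, acod2 = \<psi>, acell = mcell \<theta>\<rparr> = \<theta>"
        by (cases \<theta>) (simp add: cell_of_def)
      moreover have "alg.is_cell w \<lparr>adom2 = \<phi>, acod2 = \<psi>, acell = mcell \<theta>\<rparr>"
        using cell_of_iff[OF m(1,3)] c m by (cases \<theta>) simp
      ultimately show "\<theta> \<in> on_cell to_mon ` Cell (alg.Alg w)"
        by (force simp: to_mon_def alg.Alg_def)
    qed
    show "comp1 (Mon w) (on_mor to_mon g) (on_mor to_mon f) = on_mor to_mon (comp1 (alg.Alg w) g f)"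
      if "f \<in> Mor (alg.Alg w)" "g \<in> Mor (alg.Alg w)" "dom1 (alg.Alg w) g = cod1 (alg.Alg w) f" for f g
      using that mor_of_alg_comp[of w f g] by (simp add: to_mon_def alg.Alg_def Mon_def)
    show "hcomp (Mon w) (on_cell to_mon \<beta>) (on_cell to_mon \<alpha>) = on_cell to_mon (hcomp (alg.Alg w) \<beta> \<alpha>)"
      if "\<alpha> \<in> Cell (alg.Alg w)" "\<beta> \<in> Cell (alg.Alg w)"
        "dom1 (alg.Alg w) (dom2 (alg.Alg w) \<beta>) = cod1 (alg.Alg w) (dom2 (alg.Alg w) \<alpha>)" for \<alpha> \<beta>
    proof -
      have "dom1 (alg.Alg w) (cod2 (alg.Alg w) \<beta>) = cod1 (alg.Alg w) (cod2 (alg.Alg w) \<alpha>)"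
        using that by (simp add: ty)
      then show ?thesis
        using that mor_of_alg_comp[of w "adom2 \<alpha>" "adom2 \<beta>"] mor_of_alg_comp[of w "acod2 \<alpha>" "acod2 \<beta>"]
          alg_is_cell_mor[of w \<alpha>] alg_is_cell_mor[of w \<beta>]
        by (simp add: to_mon_def cell_of_def alg.Alg_def Mon_def)
    qed
  qed (auto simp: to_mon_def cell_of_def alg.Alg_def Mon_def mor_of_id)
qed

definition to_alg :: "weakness \<Rightarrow> (('o, 'm) mon, ('o, 'm, 'c) mon_mor, ('o, 'm, 'c) mon_cell,
    ('o, 'm) alg, ('o, 'm, 'c) alg_mor, ('o, 'm, 'c) alg_cell) two_fun" where
  "to_alg w = two_cat_iso.inverse_functor (alg.Alg w) to_mon"

lemma to_alg_to_mon:
  "A \<in> Obj (alg.Alg w) \<Longrightarrow> on_obj (to_alg w) (on_obj to_mon A) = A"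
  "\<phi> \<in> Mor (alg.Alg w) \<Longrightarrow> on_mor (to_alg w) (on_mor to_mon \<phi>) = \<phi>"
  "\<theta> \<in> Cell (alg.Alg w) \<Longrightarrow> on_cell (to_alg w) (on_cell to_mon \<theta>) = \<theta>"
  unfolding to_alg_def by (rule two_cat_iso.inverse_functor_G[OF to_mon_iso]; assumption)+

lemma two_functor_to_mon: "two_functor (alg.Alg w) (Mon w) to_mon"
  by (rule two_cat_iso.two_functor_G[OF to_mon_iso])

lemma two_functor_to_alg: "two_functor (Mon w) (alg.Alg w) (to_alg w)"
  unfolding to_alg_def by (rule two_cat_iso.two_functor_inverse[OF to_mon_iso])

lemma Mon_carriers:
  "Obj (Mon w) = on_obj to_mon ` Obj (alg.Alg w)" "Mor (Mon w) = on_mor to_mon ` Mor (alg.Alg w)"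
  "Cell (Mon w) = on_cell to_mon ` Cell (alg.Alg w)"
  by (rule two_cat_iso.carriers[OF to_mon_iso])+

lemma Alg_strict:
  "two_functor (alg.Alg Strict) (alg.Alg w) id_fun"
  "Obj (alg.Alg Strict) = Obj (alg.Alg w)" "Mor (alg.Alg Strict) \<subseteq> Mor (alg.Alg w)"
  "Cell (alg.Alg Strict) \<subseteq> Cell (alg.Alg w)"
  "\<lbrakk>f \<in> hom (alg.Alg Strict) x y; g \<in> hom (alg.Alg Strict) x y\<rbrakk> \<Longrightarrow>
     cells (alg.Alg w) f g = cells (alg.Alg Strict) f g"
proof -
  interpret f_category "alg.AlgF w" by (rule alg.f_category_AlgF)
  show F: "two_functor (alg.Alg Strict) (alg.Alg w) id_fun"
    using two_functor_axioms by (simp add: alg.AlgF_def)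
  interpret I: two_functor "alg.Alg Strict" "alg.Alg w" id_fun by (rule F)
  show "Obj (alg.Alg Strict) = Obj (alg.Alg w)" by (simp add: alg.Alg_def)
  show "Mor (alg.Alg Strict) \<subseteq> Mor (alg.Alg w)"
  proof
    fix f assume "f \<in> Mor (alg.Alg Strict)"
    then show "f \<in> Mor (alg.Alg w)"
      using I.mor[of f "dom1 (alg.Alg Strict) f" "cod1 (alg.Alg Strict) f"] by (simp add: hom_def id_fun_def)
  qed
  show "Cell (alg.Alg Strict) \<subseteq> Cell (alg.Alg w)"
  proof
    fix \<theta> assume "\<theta> \<in> Cell (alg.Alg Strict)"
    then show "\<theta> \<in> Cell (alg.Alg w)"
      using I.cell[of \<theta> "dom2 (alg.Alg Strict) \<theta>" "cod2 (alg.Alg Strict) \<theta>"] by (simp add: cells_def id_fun_def)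
  qed
  show "cells (alg.Alg w) f g = cells (alg.Alg Strict) f g"
    if "f \<in> hom (alg.Alg Strict) x y" "g \<in> hom (alg.Alg Strict) x y"
    using locally_fully_faithful[of f x y g] that by (simp add: alg.AlgF_def id_fun_def bij_betw_def)
qed

text \<open>The inclusion of strict morphisms is conjugate, by the bijections for strict and for
  \<open>w\<close>-morphisms, to the one for algebras.\<close>

lemma f_category_MonF: "f_category (MonF w)"
proof (intro f_category.intro f_category_axioms.intro)
  have "two_functor (Mon Strict) (Mon w) (comp_fun to_mon (comp_fun id_fun (to_alg Strict)))"
    by (rule two_functor_comp[OF two_functor_comp[OF two_functor_to_alg Alg_strict(1)] two_functor_to_mon])
  moreover have "fun_eq_on (Mon Strict) (comp_fun to_mon (comp_fun id_fun (to_alg Strict))) id_fun"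
    by (auto simp: fun_eq_on_def Mon_carriers comp_fun_def id_fun_def to_alg_to_mon)
  ultimately show "two_functor (tight (MonF w)) (loose (MonF w)) (incl (MonF w))"
    by (simp add: MonF_def two_functor_cong)
  show "bij_betw (on_cell (incl (MonF w))) (cells (tight (MonF w)) f g)
      (cells (loose (MonF w)) (on_mor (incl (MonF w)) f) (on_mor (incl (MonF w)) g))"
    if "f \<in> hom (tight (MonF w)) x y" "g \<in> hom (tight (MonF w)) x y" for f g x y
  proof -
    interpret S: two_cat_iso "alg.Alg Strict" "Mon Strict" to_mon by (rule to_mon_iso)
    interpret W: two_cat_iso "alg.Alg w" "Mon w" to_mon by (rule to_mon_iso)
    have "f \<in> Mor (Mon Strict)" "g \<in> Mor (Mon Strict)" and p: "dom1 (Mon Strict) f = dom1 (Mon Strict) g"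
        "cod1 (Mon Strict) f = cod1 (Mon Strict) g"
      using that by (simp_all add: MonF_def hom_def)
    then obtain f' g' where f': "f' \<in> Mor (alg.Alg Strict)" "f = on_mor to_mon f'"
        and g': "g' \<in> Mor (alg.Alg Strict)" "g = on_mor to_mon g'"
      by (auto simp: Mon_carriers)
    then have "dom1 (alg.Alg Strict) f' = dom1 (alg.Alg Strict) g'" "cod1 (alg.Alg Strict) f' = cod1 (alg.Alg Strict) g'"
      using p by (simp_all add: S.G_simps ty)
    then have "cells (alg.Alg w) f' g' = cells (alg.Alg Strict) f' g'"
      using f' g' by (intro Alg_strict(5)) (auto simp: hom_def)
    moreover have "f' \<in> Mor (alg.Alg w)" "g' \<in> Mor (alg.Alg w)" using Alg_strict(3)[of w] f' g' by auto
    ultimately have "cells (Mon w) f g = cells (Mon Strict) f g"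
      using S.cells_G[OF f'(1) g'(1)] W.cells_G[of f' g'] f' g' by simp
    then show ?thesis by (simp add: MonF_def id_fun_def bij_betw_def)
  qed
qed (simp_all add: MonF_def Mon_def id_fun_def)

lemma f_iso_to_alg:
  "f_iso_over (all_tight C) (MonF w) mon_forget (alg.AlgF w) alg.alg_forget (to_alg w)"
proof -
  have K: "f_category (all_tight C)" by (rule f_category_all_tight) unfold_locales
  have forget: "fun_eq_on (Mon w) (comp_fun alg.alg_forget (to_alg w)) mon_forget"
    by (auto simp: fun_eq_on_def Mon_carriers comp_fun_def to_alg_to_mon)
      (simp_all add: alg.alg_forget_def mon_forget_def to_mon_def cell_of_def)
  have U: "two_functor (Mon w) C mon_forget"
    by (rule two_functor_cong[OF two_functor_comp[OF two_functor_to_alg alg.two_functor_alg_forget] forget])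
  interpret A: two_functor "alg.Alg w" C "alg.alg_forget" by (rule alg.two_functor_alg_forget)
  interpret U: two_functor "Mon w" C mon_forget by (rule U)
  have tight: "tight_mors (MonF w) = Mor (Mon Strict)" "tight_mors (alg.AlgF w) = Mor (alg.Alg Strict)"
    "tight_mors (all_tight C) = Mor C"
    by (simp_all add: tight_mors_def MonF_def alg.AlgF_def all_tight_def id_fun_def)
  have loose: "loose (MonF w) = Mon w" "loose (alg.AlgF w) = alg.Alg w" "loose (all_tight C) = C"
    by (simp_all add: MonF_def alg.AlgF_def all_tight_def)
  have MS: "Mor (Mon Strict) \<subseteq> Mor (Mon w)"
    using Alg_strict(3)[of w] by (auto simp: Mon_carriers)
  have "f_functor (MonF w) (all_tight C) mon_forget"
    using U.mor[of f "dom1 (Mon w) f" "cod1 (Mon w) f" for f] MS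
    by (intro f_functor.intro f_functor_axioms.intro f_category_MonF K)
      (auto simp: loose tight U hom_def)
  moreover have "f_functor (alg.AlgF w) (all_tight C) alg.alg_forget"
    using A.mor[of f "dom1 (alg.Alg w) f" "cod1 (alg.Alg w) f" for f] Alg_strict(3)[of w]
    by (intro f_functor.intro f_functor_axioms.intro alg.f_category_AlgF K)
      (auto simp: loose tight alg.two_functor_alg_forget hom_def)
  moreover have "f_functor (MonF w) (alg.AlgF w) (to_alg w)"
  proof (intro f_functor.intro f_functor_axioms.intro f_category_MonF alg.f_category_AlgF)
    show "on_mor (to_alg w) f \<in> tight_mors (alg.AlgF w)" if "f \<in> tight_mors (MonF w)" for f
      using that Alg_strict(3)[of w] by (auto simp: tight Mon_carriers to_alg_to_mon subset_iff)
  qed (simp add: loose two_functor_to_alg)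
  moreover have "f_functor (alg.AlgF w) (MonF w) to_mon"
    by (intro f_functor.intro f_functor_axioms.intro f_category_MonF alg.f_category_AlgF)
      (auto simp: loose tight two_functor_to_mon Mon_carriers)
  moreover have "fun_eq_on (Mon w) (comp_fun to_mon (to_alg w)) id_fun"
    "fun_eq_on (alg.Alg w) (comp_fun (to_alg w) to_mon) id_fun"
    by (auto simp: fun_eq_on_def Mon_carriers comp_fun_def id_fun_def to_alg_to_mon)
  ultimately show ?thesis
    using forget unfolding f_iso_over_def f_iso_def loose by blast
qed

lemma inv2_whisker:
  assumes "iso2 C \<alpha>" "u \<in> Mor C" "cod1 C u = dom1 C (dom2 C \<alpha>)"
  shows "inv2 C (\<alpha> \<star> \<iota> u) = inv2 C \<alpha> \<star> \<iota> u"
  using assms iso2_inv2 by (intro inv2_eq inverse2_hcomp inverse2_id2) (simp_all add: ty)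

lemma mor_of_incl:
  assumes "alg.is_mor Pseudo \<phi>"
  shows "mor_of (alg.alg_incl_mor w \<phi>) = mon_incl_mor w (mor_of \<phi>)"
proof -
  have L: "alg.is_lax_mor \<phi>" "iso2 C (abar \<phi>)" using assms by simp_all
  note T = alg.lax_mor_ty[OF L(1)]
  show ?thesis
    using T L(2) by (simp add: alg.alg_incl_mor_def mon_incl_mor_def mor_of_def inv2_whisker ty)
qed

lemma to_alg_natural:
  assumes w: "w \<in> {Lax, Colax}"
  shows "fun_eq_on (Mon Pseudo) (comp_fun (to_alg w) (mon_incl w)) (comp_fun (alg.alg_incl w) (to_alg Pseudo))"
  unfolding fun_eq_on_def
proof (intro conjI ballI)
  fix X assume "X \<in> Obj (Mon Pseudo)"
  then obtain A where A: "A \<in> Obj (alg.Alg Pseudo)" "X = on_obj to_mon A" by (auto simp: Mon_carriers)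
  then have "A \<in> Obj (alg.Alg w)" by (simp add: alg.Alg_def)
  then show "on_obj (comp_fun (to_alg w) (mon_incl w)) X = on_obj (comp_fun (alg.alg_incl w) (to_alg Pseudo)) X"
    using A by (simp add: comp_fun_def mon_incl_def alg.alg_incl_def to_alg_to_mon)
next
  fix f assume "f \<in> Mor (Mon Pseudo)"
  then obtain \<phi> where \<phi>: "\<phi> \<in> Mor (alg.Alg Pseudo)" "f = on_mor to_mon \<phi>" by (auto simp: Mon_carriers)
  then have P: "alg.is_mor Pseudo \<phi>" by (simp add: alg.Alg_def)
  have "alg.alg_incl_mor w \<phi> \<in> Mor (alg.Alg w)" using alg.alg_incl_is_mor[OF P w] by (simp add: alg.Alg_def)
  moreover have "on_mor (mon_incl w) f = on_mor to_mon (alg.alg_incl_mor w \<phi>)"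
    using mor_of_incl[OF P] \<phi> by (simp add: mon_incl_def to_mon_def)
  ultimately show "on_mor (comp_fun (to_alg w) (mon_incl w)) f = on_mor (comp_fun (alg.alg_incl w) (to_alg Pseudo)) f"
    using \<phi> by (simp add: comp_fun_def alg.alg_incl_def to_alg_to_mon)
next
  fix \<alpha> assume "\<alpha> \<in> Cell (Mon Pseudo)"
  then obtain \<theta> where \<theta>: "\<theta> \<in> Cell (alg.Alg Pseudo)" "\<alpha> = on_cell to_mon \<theta>" by (auto simp: Mon_carriers)
  then have P: "alg.is_cell Pseudo \<theta>" by (simp add: alg.Alg_def)
  have "on_cell (alg.alg_incl w) \<theta> \<in> Cell (alg.Alg w)" using alg.alg_incl_is_cell[OF P w] by (simp add: alg.Alg_def)
  moreover have "on_cell (mon_incl w) \<alpha> = on_cell to_mon (on_cell (alg.alg_incl w) \<theta>)"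
    using mor_of_incl[OF alg_is_cell_mor(1)[OF P]] mor_of_incl[OF alg_is_cell_mor(2)[OF P]] \<theta>
    by (simp add: mon_incl_def alg.alg_incl_def to_mon_def cell_of_def)
  ultimately show "on_cell (comp_fun (to_alg w) (mon_incl w)) \<alpha> = on_cell (comp_fun (alg.alg_incl w) (to_alg Pseudo)) \<alpha>"
    using \<theta> by (simp add: comp_fun_def to_alg_to_mon)
qed

end

section \<open>Comma objects from pie limits\<close>

context two_category
begin

text \<open>The one-dimensional parts of the universal properties. They pass to the 2-category with reversed
  2-cells, where an inserter of \<open>f\<close> and \<open>g\<close> is one of \<open>g\<close> and \<open>f\<close>.\<close>

definition has_binary_products :: bool where
  "has_binary_products \<longleftrightarrow> (\<forall>x \<in> Obj C. \<forall>y \<in> Obj C. \<exists>P. \<exists>p \<in> hom C P x. \<exists>q \<in> hom C P y.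
     \<forall>z. \<forall>a \<in> hom C z x. \<forall>b \<in> hom C z y. \<exists>!u. u \<in> hom C z P \<and> p \<cdot> u = a \<and> q \<cdot> u = b)"

definition has_plain_inserters :: bool where
  "has_plain_inserters \<longleftrightarrow> (\<forall>x y. \<forall>f \<in> hom C x y. \<forall>g \<in> hom C x y.
     \<exists>P. \<exists>p \<in> hom C P x. \<exists>\<theta> \<in> cells C (f \<cdot> p) (g \<cdot> p).
       \<forall>z. \<forall>q \<in> hom C z x. \<forall>\<phi> \<in> cells C (f \<cdot> q) (g \<cdot> q).
         \<exists>!u. u \<in> hom C z P \<and> p \<cdot> u = q \<and> \<theta> \<star> \<iota> u = \<phi>)"

definition has_plain_equifiers :: bool where
  "has_plain_equifiers \<longleftrightarrow> (\<forall>x y. \<forall>f \<in> hom C x y. \<forall>g \<in> hom C x y. \<forall>\<phi> \<in> cells C f g. \<forall>\<psi> \<in> cells C f g.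
     \<exists>P. \<exists>p \<in> hom C P x. \<phi> \<star> \<iota> p = \<psi> \<star> \<iota> p \<and>
       (\<forall>z. \<forall>q \<in> hom C z x. \<phi> \<star> \<iota> q = \<psi> \<star> \<iota> q \<longrightarrow> (\<exists>!u. u \<in> hom C z P \<and> p \<cdot> u = q)))"

text \<open>A binary product is an indexed one over two distinct indices.\<close>

lemma has_binary_products_if_pie:
  assumes prod: "has_products TYPE('i)" and inf: "infinite (UNIV :: 'i set)"
  shows "has_binary_products"
  unfolding has_binary_products_def
proof (intro ballI)
  fix x y assume xy: "x \<in> Obj C" "y \<in> Obj C"
  obtain i j :: 'i where ij: "i \<noteq> j"
    using inf by (metis (full_types) UNIV_eq_I finite.emptyI finite_insert insertI1)
  define A where "A k = (if k = i then x else y)" for k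
  have "\<forall>k \<in> {i, j}. A k \<in> Obj C" using xy by (simp add: A_def)
  then obtain P p where P: "is_product {i, j} A P p"
    using prod unfolding has_products_def by blast
  have A: "A i = x" "A j = y" using ij by (simp_all add: A_def)
  have "\<exists>!u. u \<in> hom C z P \<and> p i \<cdot> u = a \<and> p j \<cdot> u = b" if "a \<in> hom C z x" "b \<in> hom C z y" for z a b
  proof -
    define f where "f k = (if k = i then a else b)" for k
    have f: "f i = a" "f j = b" using ij by (simp_all add: f_def)
    have "z \<in> Obj C" using that by (auto simp: hom_iff ty)
    moreover have "\<forall>k \<in> {i, j}. f k \<in> hom C z (A k)" using that by (simp add: f A)
    ultimately have "\<exists>!u. u \<in> hom C z P \<and> (\<forall>k \<in> {i, j}. p k \<cdot> u = f k)"
      using P unfolding is_product_def by blast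
    then show ?thesis by (simp add: f)
  qed
  moreover have "p i \<in> hom C P x" "p j \<in> hom C P y"
    using P A unfolding is_product_def by auto
  ultimately show "\<exists>P. \<exists>p \<in> hom C P x. \<exists>q \<in> hom C P y.
     \<forall>z. \<forall>a \<in> hom C z x. \<forall>b \<in> hom C z y. \<exists>!u. u \<in> hom C z P \<and> p \<cdot> u = a \<and> q \<cdot> u = b" by blast
qed

lemma has_plain_inserters_if_pie:
  assumes "has_inserters"
  shows "has_plain_inserters"
  unfolding has_plain_inserters_def
proof (intro allI ballI)
  fix x y f g assume fg: "f \<in> hom C x y" "g \<in> hom C x y"
  then have xy: "x \<in> Obj C" "y \<in> Obj C" and d: "dom1 C f = x" by (auto simp: hom_iff ty)
  obtain P p \<theta> where P: "is_inserter f g P p \<theta>"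
    using assms fg xy unfolding has_inserters_def by blast
  have "\<exists>!u. u \<in> hom C z P \<and> p \<cdot> u = q \<and> \<theta> \<star> \<iota> u = \<phi>"
    if "q \<in> hom C z x" "\<phi> \<in> cells C (f \<cdot> q) (g \<cdot> q)" for z q \<phi>
  proof -
    have "z \<in> Obj C" using that by (auto simp: hom_iff ty)
    then show ?thesis using P that unfolding is_inserter_def d by blast
  qed
  moreover have "p \<in> hom C P x" "\<theta> \<in> cells C (f \<cdot> p) (g \<cdot> p)" using P unfolding is_inserter_def d by blast+
  ultimately show "\<exists>P. \<exists>p \<in> hom C P x. \<exists>\<theta> \<in> cells C (f \<cdot> p) (g \<cdot> p).
       \<forall>z. \<forall>q \<in> hom C z x. \<forall>\<phi> \<in> cells C (f \<cdot> q) (g \<cdot> q).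
         \<exists>!u. u \<in> hom C z P \<and> p \<cdot> u = q \<and> \<theta> \<star> \<iota> u = \<phi>" by blast
qed

lemma has_plain_equifiers_if_pie:
  assumes "has_equifiers"
  shows "has_plain_equifiers"
  unfolding has_plain_equifiers_def
proof (intro allI ballI)
  fix x y f g \<phi> \<psi> assume fg: "f \<in> hom C x y" "g \<in> hom C x y" "\<phi> \<in> cells C f g" "\<psi> \<in> cells C f g"
  then have xy: "x \<in> Obj C" "y \<in> Obj C" and d: "dom1 C (dom2 C \<phi>) = x" by (auto simp: hom_iff cells_iff ty)
  obtain P p where P: "is_equifier \<phi> \<psi> P p"
    using assms fg xy unfolding has_equifiers_def by blast
  have "\<exists>!u. u \<in> hom C z P \<and> p \<cdot> u = q" if "q \<in> hom C z x" "\<phi> \<star> \<iota> q = \<psi> \<star> \<iota> q" for z q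
  proof -
    have "z \<in> Obj C" using that by (auto simp: hom_iff ty)
    then show ?thesis using P that unfolding is_equifier_def d by blast
  qed
  moreover have "p \<in> hom C P x" "\<phi> \<star> \<iota> p = \<psi> \<star> \<iota> p" using P unfolding is_equifier_def d by blast+
  ultimately show "\<exists>P. \<exists>p \<in> hom C P x. \<phi> \<star> \<iota> p = \<psi> \<star> \<iota> p \<and>
       (\<forall>z. \<forall>q \<in> hom C z x. \<phi> \<star> \<iota> q = \<psi> \<star> \<iota> q \<longrightarrow> (\<exists>!u. u \<in> hom C z P \<and> p \<cdot> u = q))" by blast
qed

text \<open>A comma object of \<open>f\<close> inserts a 2-cell between the two 1-cells from the product to the codomain.\<close>

lemma has_commas_UNIV:
  assumes prod: "has_binary_products" and ins: "has_plain_inserters"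
  shows "has_commas UNIV"
  unfolding has_commas_def
proof (intro allI ballI)
  fix x y f assume f: "f \<in> hom C x y"
  have xy: "x \<in> Obj C" "y \<in> Obj C" using f by (auto simp: hom_iff ty)
  obtain P0 p0 q0 where P0: "p0 \<in> hom C P0 x" "q0 \<in> hom C P0 y"
    and u0: "\<forall>z. \<forall>a \<in> hom C z x. \<forall>b \<in> hom C z y. \<exists>!u. u \<in> hom C z P0 \<and> p0 \<cdot> u = a \<and> q0 \<cdot> u = b"
    using prod xy unfolding has_binary_products_def by blast
  have fp: "f \<cdot> p0 \<in> hom C P0 y" using f P0 by (simp add: hom_iff ty)
  obtain P i l where i: "i \<in> hom C P P0" "l \<in> cells C (q0 \<cdot> i) ((f \<cdot> p0) \<cdot> i)"
    and u1: "\<forall>z. \<forall>q \<in> hom C z P0. \<forall>\<phi> \<in> cells C (q0 \<cdot> q) ((f \<cdot> p0) \<cdot> q).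
       \<exists>!u. u \<in> hom C z P \<and> i \<cdot> u = q \<and> l \<star> \<iota> u = \<phi>"
    using ins[unfolded has_plain_inserters_def, rule_format, OF P0(2) fp] by blast
  note t = f[unfolded hom_iff] P0[unfolded hom_iff] i(1)[unfolded hom_iff]
  have "\<exists>!u. u \<in> hom C z P \<and> (p0 \<cdot> i) \<cdot> u = a \<and> (q0 \<cdot> i) \<cdot> u = b \<and> l \<star> \<iota> u = h"
    if a: "a \<in> hom C z x" and b: "b \<in> hom C z y" and h: "h \<in> cells C b (f \<cdot> a)" for z a b h
  proof -
    obtain v where v: "v \<in> hom C z P0" "p0 \<cdot> v = a" "q0 \<cdot> v = b"
      and vv: "\<And>v'. \<lbrakk>v' \<in> hom C z P0; p0 \<cdot> v' = a; q0 \<cdot> v' = b\<rbrakk> \<Longrightarrow> v' = v"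
      using u0[rule_format, OF a b] by blast
    have "(f \<cdot> p0) \<cdot> v = f \<cdot> a" using v t by (simp add: hom_iff ty)
    then have "h \<in> cells C (q0 \<cdot> v) ((f \<cdot> p0) \<cdot> v)" using h v by simp
    from u1[rule_format, OF v(1) this] obtain u where u: "u \<in> hom C z P" "i \<cdot> u = v" "l \<star> \<iota> u = h"
      and uu: "\<And>u'. \<lbrakk>u' \<in> hom C z P; i \<cdot> u' = v; l \<star> \<iota> u' = h\<rbrakk> \<Longrightarrow> u' = u"
      by blast
    show ?thesis
    proof (rule ex1I[of _ u])
      have "(p0 \<cdot> i) \<cdot> u = p0 \<cdot> (i \<cdot> u)" "(q0 \<cdot> i) \<cdot> u = q0 \<cdot> (i \<cdot> u)"
        using u(1) t by (simp_all add: hom_iff ty)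
      then show "u \<in> hom C z P \<and> (p0 \<cdot> i) \<cdot> u = a \<and> (q0 \<cdot> i) \<cdot> u = b \<and> l \<star> \<iota> u = h"
        using u v by simp
    next
      fix u' assume u': "u' \<in> hom C z P \<and> (p0 \<cdot> i) \<cdot> u' = a \<and> (q0 \<cdot> i) \<cdot> u' = b \<and> l \<star> \<iota> u' = h"
      have "i \<cdot> u' \<in> hom C z P0" "p0 \<cdot> (i \<cdot> u') = (p0 \<cdot> i) \<cdot> u'" "q0 \<cdot> (i \<cdot> u') = (q0 \<cdot> i) \<cdot> u'"
        using t u'[THEN conjunct1] by (simp_all add: hom_iff ty)
      then have "i \<cdot> u' = v" using vv u' by simp
      then show "u' = u" using uu u' by blast
    qed
  qed
  moreover have "P \<in> Obj C" using t obj_ty(1)[of i] by simp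
  moreover have "p0 \<cdot> i \<in> hom C P x" "q0 \<cdot> i \<in> hom C P y" "l \<in> cells C (q0 \<cdot> i) (f \<cdot> (p0 \<cdot> i)) \<inter> UNIV"
    using t i(2) by (simp_all add: hom_iff ty)
  ultimately show "\<exists>P \<in> Obj C. \<exists>p \<in> hom C P x. \<exists>q \<in> hom C P y. \<exists>l \<in> cells C q (f \<cdot> p) \<inter> UNIV.
       \<forall>z \<in> Obj C. \<forall>a \<in> hom C z x. \<forall>b \<in> hom C z y. \<forall>h \<in> cells C b (f \<cdot> a) \<inter> UNIV.
         \<exists>!u. u \<in> hom C z P \<and> p \<cdot> u = a \<and> q \<cdot> u = b \<and> l \<star> \<iota> u = h"
    by blast
qed

lemma has_commas_co:
  assumes "has_binary_products" "has_plain_inserters"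
  shows "two_category.has_commas (co C) UNIV"
proof -
  interpret co: two_category "co C" by (rule co)
  have "co.has_binary_products"
    using assms(1) by (simp add: has_binary_products_def co.has_binary_products_def)
  moreover have "co.has_plain_inserters"
    using assms(2) by (auto simp: has_plain_inserters_def co.has_plain_inserters_def)
  ultimately show ?thesis by (rule co.has_commas_UNIV)
qed

text \<open>An iso-comma object is cut out of the comma object by inserting a candidate inverse of the
  universal cell and equifying both composites with identities.\<close>

lemma has_commas_iso2:
  assumes "has_commas UNIV" and ins: "has_plain_inserters" and eqf: "has_plain_equifiers"
  shows "has_commas (Collect (iso2 C))"
  unfolding has_commas_def
proof (intro allI ballI)
  fix x y f assume f: "f \<in> hom C x y"
  obtain P p q l where P: "p \<in> hom C P x" "q \<in> hom C P y" "l \<in> cells C q (f \<cdot> p)"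
    and u0: "\<forall>z \<in> Obj C. \<forall>a \<in> hom C z x. \<forall>b \<in> hom C z y. \<forall>h \<in> cells C b (f \<cdot> a) \<inter> UNIV.
        \<exists>!u. u \<in> hom C z P \<and> p \<cdot> u = a \<and> q \<cdot> u = b \<and> l \<star> \<iota> u = h"
    using assms(1)[unfolded has_commas_def, rule_format, OF f] by (elim bexE) auto
  have fp: "f \<cdot> p \<in> hom C P y" using f P by (simp add: hom_iff ty)
  obtain P1 j k where P1: "j \<in> hom C P1 P" "k \<in> cells C ((f \<cdot> p) \<cdot> j) (q \<cdot> j)"
    and u1: "\<forall>z. \<forall>v \<in> hom C z P. \<forall>\<phi> \<in> cells C ((f \<cdot> p) \<cdot> v) (q \<cdot> v).
       \<exists>!u. u \<in> hom C z P1 \<and> j \<cdot> u = v \<and> k \<star> \<iota> u = \<phi>"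
    using ins[unfolded has_plain_inserters_def, rule_format, OF fp P(2)] by blast
  note t = f[unfolded hom_iff] P[unfolded hom_iff cells_iff] P1[unfolded hom_iff cells_iff]
  define s1 s2 where s: "s1 = k \<bullet> (l \<star> \<iota> j)" "s2 = (l \<star> \<iota> j) \<bullet> k"
  have qj: "q \<cdot> j \<in> hom C P1 y" and s1: "s1 \<in> cells C (q \<cdot> j) (q \<cdot> j)" "\<iota> (q \<cdot> j) \<in> cells C (q \<cdot> j) (q \<cdot> j)"
    using t by (simp_all add: s hom_iff cells_iff ty)
  obtain P2 n where P2: "n \<in> hom C P2 P1" "s1 \<star> \<iota> n = \<iota> (q \<cdot> j) \<star> \<iota> n"
    and u2: "\<forall>z. \<forall>v \<in> hom C z P1. s1 \<star> \<iota> v = \<iota> (q \<cdot> j) \<star> \<iota> v \<longrightarrow> (\<exists>!u. u \<in> hom C z P2 \<and> n \<cdot> u = v)"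
    using eqf[unfolded has_plain_equifiers_def, rule_format, OF qj qj s1] by blast
  note t = t P2(1)[unfolded hom_iff]
  let ?fpj = "f \<cdot> p \<cdot> j \<cdot> n"
  have fpj: "?fpj \<in> hom C P2 y" and s2: "s2 \<star> \<iota> n \<in> cells C ?fpj ?fpj" "\<iota> ?fpj \<in> cells C ?fpj ?fpj"
    using t by (simp_all add: s hom_iff cells_iff ty)
  obtain P3 r where P3: "r \<in> hom C P3 P2" "(s2 \<star> \<iota> n) \<star> \<iota> r = \<iota> ?fpj \<star> \<iota> r"
    and u3: "\<forall>z. \<forall>v \<in> hom C z P2. (s2 \<star> \<iota> n) \<star> \<iota> v = \<iota> ?fpj \<star> \<iota> v \<longrightarrow> (\<exists>!u. u \<in> hom C z P3 \<and> r \<cdot> u = v)"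
    using eqf[unfolded has_plain_equifiers_def, rule_format, OF fpj fpj s2] by blast
  note t = t P3(1)[unfolded hom_iff]
  define w where "w = j \<cdot> n \<cdot> r"
  have wT: "w \<in> hom C P3 P" using t by (simp add: w_def hom_iff ty)
  have inv: "inverse2 C (l \<star> \<iota> w) (k \<star> \<iota> (n \<cdot> r))"
  proof -
    have "(k \<star> \<iota> (n \<cdot> r)) \<bullet> (l \<star> \<iota> w) = (s1 \<star> \<iota> n) \<star> \<iota> r" using t by (simp add: s w_def ty)
    also have "\<dots> = \<iota> (q \<cdot> w)" unfolding P2 using t by (simp add: w_def ty)
    finally have 1: "(k \<star> \<iota> (n \<cdot> r)) \<bullet> (l \<star> \<iota> w) = \<iota> (q \<cdot> w)" .
    have "(l \<star> \<iota> w) \<bullet> (k \<star> \<iota> (n \<cdot> r)) = (s2 \<star> \<iota> n) \<star> \<iota> r" using t by (simp add: s w_def ty)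
    also have "\<dots> = \<iota> (f \<cdot> p \<cdot> w)" unfolding P3 using t by (simp add: w_def ty)
    finally show ?thesis using 1 t by (simp add: inverse2_def cells_iff w_def ty)
  qed
  have "\<exists>!u. u \<in> hom C z P3 \<and> (p \<cdot> w) \<cdot> u = a \<and> (q \<cdot> w) \<cdot> u = b \<and> (l \<star> \<iota> w) \<star> \<iota> u = h"
    if a: "a \<in> hom C z x" and b: "b \<in> hom C z y" and h: "h \<in> cells C b (f \<cdot> a) \<inter> Collect (iso2 C)" for z a b h
  proof -
    obtain h' where h': "inverse2 C h h'" using h by (auto simp: iso2_def)
    have z: "z \<in> Obj C" using a by (auto simp: hom_iff ty)
    have hU: "h \<in> cells C b (f \<cdot> a) \<inter> UNIV" using h by simp
    obtain v where v: "v \<in> hom C z P" "p \<cdot> v = a" "q \<cdot> v = b" "l \<star> \<iota> v = h"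
      and vv: "\<And>v'. \<lbrakk>v' \<in> hom C z P; p \<cdot> v' = a; q \<cdot> v' = b; l \<star> \<iota> v' = h\<rbrakk> \<Longrightarrow> v' = v"
      using u0[rule_format, OF z a b hU] by blast
    note tv = t v(1)[unfolded hom_iff]
    have h'c: "h' \<in> cells C ((f \<cdot> p) \<cdot> v) (q \<cdot> v)"
      using h' h v tv by (auto simp: inverse2_def cells_iff ty)
    obtain v1 where v1: "v1 \<in> hom C z P1" "j \<cdot> v1 = v" "k \<star> \<iota> v1 = h'"
      and vv1: "\<And>v'. \<lbrakk>v' \<in> hom C z P1; j \<cdot> v' = v; k \<star> \<iota> v' = h'\<rbrakk> \<Longrightarrow> v' = v1"
      using u1[rule_format, OF v(1) h'c] by blast
    note tv1 = tv v1(1)[unfolded hom_iff]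
    have hh: "h' \<bullet> h = \<iota> b" "h \<bullet> h' = \<iota> (f \<cdot> a)" using h' h by (auto simp: inverse2_def cells_iff)
    have jv: "q \<cdot> j \<cdot> v1 = b" "f \<cdot> p \<cdot> j \<cdot> v1 = f \<cdot> a" using v v1 by simp_all
    have "s1 \<star> \<iota> v1 = (k \<star> \<iota> v1) \<bullet> (l \<star> \<iota> (j \<cdot> v1))" using tv1 by (simp add: s ty)
    also have "\<dots> = \<iota> (q \<cdot> j) \<star> \<iota> v1" unfolding v1 v hh using tv1 jv by (simp add: ty)
    finally obtain v2 where v2: "v2 \<in> hom C z P2" "n \<cdot> v2 = v1"
      and vv2: "\<And>v'. \<lbrakk>v' \<in> hom C z P2; n \<cdot> v' = v1\<rbrakk> \<Longrightarrow> v' = v2"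
      using u2[rule_format, OF v1(1)] by blast
    note tv2 = tv1 v2(1)[unfolded hom_iff]
    have "(s2 \<star> \<iota> n) \<star> \<iota> v2 = s2 \<star> \<iota> (n \<cdot> v2)"
      by (rule whisker_comp(1)) (use tv2 in \<open>simp_all add: s ty\<close>)
    also have "\<dots> = (l \<star> \<iota> (j \<cdot> v1)) \<bullet> (k \<star> \<iota> v1)" unfolding v2 using tv1 by (simp add: s ty)
    also have "\<dots> = \<iota> (f \<cdot> p \<cdot> j \<cdot> (n \<cdot> v2))" unfolding v2 v1 v hh ..
    also have "\<dots> = \<iota> ?fpj \<star> \<iota> v2" using tv2 by (simp add: ty)
    finally obtain u where u: "u \<in> hom C z P3" "r \<cdot> u = v2"
      and uu: "\<And>v'. \<lbrakk>v' \<in> hom C z P3; r \<cdot> v' = v2\<rbrakk> \<Longrightarrow> v' = u"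
      using u3[rule_format, OF v2(1)] by blast
    have wu: "(p \<cdot> w) \<cdot> u' = p \<cdot> (w \<cdot> u')" "(q \<cdot> w) \<cdot> u' = q \<cdot> (w \<cdot> u')" "(l \<star> \<iota> w) \<star> \<iota> u' = l \<star> \<iota> (w \<cdot> u')"
      "w \<cdot> u' = j \<cdot> n \<cdot> r \<cdot> u'" "k \<star> \<iota> (n \<cdot> r \<cdot> u') = (k \<star> \<iota> (n \<cdot> r)) \<star> \<iota> u'"
      "w \<cdot> u' \<in> hom C z P" "n \<cdot> r \<cdot> u' \<in> hom C z P1" "r \<cdot> u' \<in> hom C z P2"
      if "u' \<in> hom C z P3" for u'
      using that t by (simp_all add: w_def hom_iff ty)
    show ?thesis
    proof (rule ex1I[of _ u])
      show "u \<in> hom C z P3 \<and> (p \<cdot> w) \<cdot> u = a \<and> (q \<cdot> w) \<cdot> u = b \<and> (l \<star> \<iota> w) \<star> \<iota> u = h"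
        using wu(1-4)[OF u(1)] u v v1 v2 by simp
    next
      fix u' assume u': "u' \<in> hom C z P3 \<and> (p \<cdot> w) \<cdot> u' = a \<and> (q \<cdot> w) \<cdot> u' = b \<and> (l \<star> \<iota> w) \<star> \<iota> u' = h"
      note W = wu[OF u'[THEN conjunct1]]
      have "w \<cdot> u' = v" using vv[OF W(6)] u' W by simp
      then have j: "j \<cdot> n \<cdot> r \<cdot> u' = v" using W by simp
      have "inverse2 C ((l \<star> \<iota> w) \<star> \<iota> u') ((k \<star> \<iota> (n \<cdot> r)) \<star> \<iota> u')"
        using u' t wT by (intro inverse2_hcomp inv inverse2_id2) (simp_all add: hom_iff ty)
      then have "k \<star> \<iota> (n \<cdot> r \<cdot> u') = h'" using u' W h' inverse2_unique by metis
      then have "n \<cdot> r \<cdot> u' = v1" using vv1[OF W(7)] j by simp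
      then have "r \<cdot> u' = v2" using vv2[OF W(8)] by simp
      then show "u' = u" using uu u' by blast
    qed
  qed
  moreover have "P3 \<in> Obj C" using t obj_ty(1)[of r] by simp
  moreover have "p \<cdot> w \<in> hom C P3 x" "q \<cdot> w \<in> hom C P3 y"
    using t wT by (simp_all add: hom_iff ty)
  moreover have "l \<star> \<iota> w \<in> cells C (q \<cdot> w) (f \<cdot> (p \<cdot> w)) \<inter> Collect (iso2 C)"
    using t wT inv by (auto simp: hom_iff cells_iff iso2_def ty)
  ultimately show "\<exists>P \<in> Obj C. \<exists>p \<in> hom C P x. \<exists>q \<in> hom C P y. \<exists>l \<in> cells C q (f \<cdot> p) \<inter> Collect (iso2 C).
       \<forall>z \<in> Obj C. \<forall>a \<in> hom C z x. \<forall>b \<in> hom C z y. \<forall>h \<in> cells C b (f \<cdot> a) \<inter> Collect (iso2 C).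
         \<exists>!u. u \<in> hom C z P \<and> p \<cdot> u = a \<and> q \<cdot> u = b \<and> l \<star> \<iota> u = h"
    by blast
qed

end

section \<open>The free monoid adjunction\<close>

context monoidal_two_category
begin

lemma strict_hom_of_mor:
  assumes "is_mor Strict \<phi>"
  shows "strict_hom (mdom \<phi>) (mcod \<phi>) (mmap \<phi>)"
    "mbar \<phi> = \<iota> (mmap \<phi> \<cdot> mmult (mdom \<phi>))" "mzero \<phi> = \<iota> (munit (mcod \<phi>))"
proof -
  have P: "pre_lax \<phi>" using assms by (simp add: is_lax_mor_iff)
  obtain k l where k: "k \<in> Mor C" "mbar \<phi> = \<iota> k" and l: "l \<in> Mor C" "mzero \<phi> = \<iota> l"
    using assms by (auto simp: identity2_def)
  note T = lax_ty[OF P]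
  have "k = mmult (mcod \<phi>) \<cdot> (mmap \<phi> \<otimes> mmap \<phi>)" "k = mmap \<phi> \<cdot> mmult (mdom \<phi>)"
    "l = munit (mcod \<phi>)" "l = mmap \<phi> \<cdot> munit (mdom \<phi>)"
    using T(5,6,8,9) k l by (simp_all add: ty)
  then show "strict_hom (mdom \<phi>) (mcod \<phi>) (mmap \<phi>)"
    "mbar \<phi> = \<iota> (mmap \<phi> \<cdot> mmult (mdom \<phi>))" "mzero \<phi> = \<iota> (munit (mcod \<phi>))"
    using T k l by (auto simp: strict_hom_def hom_iff)
qed

text \<open>Naturality of the counit refers to the 1-cells of \<open>Mon Strict\<close>, so a strict homomorphism has
  to be completed to one by identity cells.\<close>

lemma mor_of_strict_hom:
  assumes u: "strict_hom X Y u"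
  shows "is_mor Strict \<lparr>mdom = X, mcod = Y, mmap = u, mbar = \<iota> (u \<cdot> mmult X), mzero = \<iota> (munit Y)\<rparr>"
proof -
  define x m i n j where d: "x = mcarr X" "m = mmult X" "i = munit X" "n = mmult Y" "j = munit Y"
  note U = strict_hom_ty[OF u]
  note T = U(1-3)[folded d] monoid_ty[OF U(4), folded d] monoid_ty[OF U(5), folded d]
  have h: "u \<cdot> m = n \<cdot> (u \<otimes> u)" "u \<cdot> i = j" using u by (simp_all add: strict_hom_def d)
  note laws = monoid_laws[OF U(4), folded d]
  have c: "n \<cdot> (u \<otimes> (u \<cdot> v)) = u \<cdot> (m \<cdot> (\<one> x \<otimes> v))" "n \<cdot> ((u \<cdot> v) \<otimes> u) = u \<cdot> (m \<cdot> (v \<otimes> \<one> x))"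
    if "v \<in> Mor C" "cod1 C v = x" for v
  proof -
    have "n \<cdot> (u \<otimes> (u \<cdot> v)) = (n \<cdot> (u \<otimes> u)) \<cdot> (\<one> x \<otimes> v)" "n \<cdot> ((u \<cdot> v) \<otimes> u) = (n \<cdot> (u \<otimes> u)) \<cdot> (v \<otimes> \<one> x)"
      using T that by (simp_all add: ty tensor_comp1)
    then show "n \<cdot> (u \<otimes> (u \<cdot> v)) = u \<cdot> (m \<cdot> (\<one> x \<otimes> v))" "n \<cdot> ((u \<cdot> v) \<otimes> u) = u \<cdot> (m \<cdot> (v \<otimes> \<one> x))"
      unfolding h(1)[symmetric] using T that by (simp_all add: ty)
  qed
  have cj: "n \<cdot> (u \<otimes> j) = u \<cdot> (m \<cdot> (\<one> x \<otimes> i))" "n \<cdot> (j \<otimes> u) = u \<cdot> (m \<cdot> (i \<otimes> \<one> x))"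
    using c[of i] T by (simp_all add: h)
  let ?\<phi> = "\<lparr>mdom = X, mcod = Y, mmap = u, mbar = \<iota> (u \<cdot> m), mzero = \<iota> j\<rparr>"
  have P: "pre_lax ?\<phi>"
    using T U h by (simp add: pre_lax_def d[symmetric] hom_iff cells_iff ty)
  have "is_lax_mor ?\<phi>"
    unfolding is_lax_mor_iff Let_def
  proof (intro conjI P, unfold mon_mor.simps d[symmetric])
    have "((\<iota> (u \<cdot> m) \<star> \<iota> (\<one> x \<otimes> m)) \<bullet> (\<iota> n \<star> (\<iota> u \<circledast> \<iota> (u \<cdot> m)))) \<star> \<iota> (\<a> x x x)
        = \<iota> (u \<cdot> (m \<cdot> (\<one> x \<otimes> m) \<cdot> \<a> x x x))"
      using T by (simp add: ty c)
    also have "\<dots> = \<iota> (u \<cdot> (m \<cdot> (m \<otimes> \<one> x)))" by (simp add: laws)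
    also have "\<dots> = (\<iota> (u \<cdot> m) \<star> \<iota> (m \<otimes> \<one> x)) \<bullet> (\<iota> n \<star> (\<iota> (u \<cdot> m) \<circledast> \<iota> u))"
      using T by (simp add: ty c)
    finally show "(\<iota> (u \<cdot> m) \<star> \<iota> (\<one> x \<otimes> m) \<bullet> \<iota> n \<star> \<iota> u \<circledast> \<iota> (u \<cdot> m)) \<star> \<iota> (\<a> x x x)
        = \<iota> (u \<cdot> m) \<star> \<iota> (m \<otimes> \<one> x) \<bullet> \<iota> n \<star> \<iota> (u \<cdot> m) \<circledast> \<iota> u" .
    show "\<iota> (u \<cdot> m) \<star> \<iota> (\<one> x \<otimes> i) \<bullet> \<iota> n \<star> \<iota> u \<circledast> \<iota> j = \<iota> (u \<cdot> \<r> x)"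
      "\<iota> (u \<cdot> m) \<star> \<iota> (i \<otimes> \<one> x) \<bullet> \<iota> n \<star> \<iota> j \<circledast> \<iota> u = \<iota> (u \<cdot> \<l> x)"
      using T by (simp_all add: ty cj laws)
  qed
  then show ?thesis using T by (auto simp: identity2_def d[symmetric] ty)
qed

lemma strict_cell:
  assumes "\<theta> \<in> cells (Mon Strict) \<phi> \<psi>"
  shows "mcell \<theta> \<in> cells C (mmap \<phi>) (mmap \<psi>)"
    "mcell \<theta> \<star> \<iota> (mmult (mdom \<phi>)) = \<iota> (mmult (mcod \<phi>)) \<star> (mcell \<theta> \<circledast> mcell \<theta>)"
    "mcell \<theta> \<star> \<iota> (munit (mdom \<phi>)) = \<iota> (munit (mcod \<phi>))"
proof -
  have S: "is_mor Strict \<phi>" "is_mor Strict \<psi>" and same: "mdom \<psi> = mdom \<phi>" "mcod \<psi> = mcod \<phi>"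
    and \<alpha>: "mcell \<theta> \<in> cells C (mmap \<phi>) (mmap \<psi>)"
    and law: "(mcell \<theta> \<star> \<iota> (mmult (mdom \<phi>))) \<bullet> mbar \<phi> = mbar \<psi> \<bullet> (\<iota> (mmult (mcod \<phi>)) \<star> (mcell \<theta> \<circledast> mcell \<theta>))"
      "(mcell \<theta> \<star> \<iota> (munit (mdom \<phi>))) \<bullet> mzero \<phi> = mzero \<psi>"
    using assms by (auto simp: Mon_def cells_def is_cell_def Let_def)
  have P: "pre_lax \<phi>" "pre_lax \<psi>" using S by (simp_all add: is_lax_mor_iff)
  note T = lax_ty[OF P(1)] lax_ty[OF P(2), unfolded same] \<alpha>[unfolded cells_iff]
  note H = strict_hom_of_mor[OF S(1)] strict_hom_of_mor[OF S(2), unfolded same]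
  have h: "mmap \<phi> \<cdot> mmult (mdom \<phi>) = mmult (mcod \<phi>) \<cdot> (mmap \<phi> \<otimes> mmap \<phi>)" "mmap \<phi> \<cdot> munit (mdom \<phi>) = munit (mcod \<phi>)"
    "mmap \<psi> \<cdot> mmult (mdom \<phi>) = mmult (mcod \<phi>) \<cdot> (mmap \<psi> \<otimes> mmap \<psi>)"
    using H(1,4) by (simp_all add: strict_hom_def)
  show "mcell \<theta> \<in> cells C (mmap \<phi>) (mmap \<psi>)" by (rule \<alpha>)
  show "mcell \<theta> \<star> \<iota> (mmult (mdom \<phi>)) = \<iota> (mmult (mcod \<phi>)) \<star> (mcell \<theta> \<circledast> mcell \<theta>)"
    using law(1) T unfolding H by (simp add: ty h)
  show "mcell \<theta> \<star> \<iota> (munit (mdom \<phi>)) = \<iota> (munit (mcod \<phi>))"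
    using law(2) T unfolding H by (simp add: ty h)
qed

lemma strict_hom_of_hom:
  assumes "\<phi> \<in> hom (Mon Strict) X Y"
  shows "strict_hom X Y (mmap \<phi>)"
  using strict_hom_of_mor(1)[of \<phi>] assms by (simp add: hom_def Mon_def)

text \<open>The monad laws are the images under the forgetful 2-functor of naturality of the counit at the
  counit and of the triangle identities.\<close>

lemma adjunction_monad:
  assumes "two_adjunction C (Mon Strict) F mon_forget \<eta> \<epsilon>"
  shows "two_monad C (induced_monad F mon_forget \<eta> \<epsilon>)"
proof -
  interpret two_adjunction C "Mon Strict" F mon_forget \<eta> \<epsilon> by fact
  let ?U = "mon_forget :: (('o, 'm) mon, ('o, 'm, 'c) mon_mor, ('o, 'm, 'c) mon_cell, 'o, 'm, 'c) two_fun"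
  let ?T = "comp_fun ?U F"
  let ?mu = "\<lambda>x. on_mor ?U (\<epsilon> (on_obj F x))"
  have e: "\<epsilon> a \<in> hom (Mon Strict) (on_obj F (on_obj ?U a)) a" if "a \<in> Obj (Mon Strict)" for a
    using counit.component[OF that] by (simp add: comp_fun_def id_fun_def)
  have en: "comp1 (Mon Strict) f (\<epsilon> a) = comp1 (Mon Strict) (\<epsilon> b) (on_mor F (on_mor ?U f))"
    if "f \<in> hom (Mon Strict) a b" for f a b
    using counit.natural1[OF that] by (simp add: comp_fun_def id_fun_def)
  have T2: "two_functor C C (comp_fun ?T ?T)"
    by (rule two_functor_comp[OF unit.G.two_functor_axioms unit.G.two_functor_axioms])
  interpret TT: two_functor C C "comp_fun ?T ?T" by (rule T2)
  have eF: "\<epsilon> (on_obj F x) \<in> hom (Mon Strict) (on_obj F (on_obj ?U (on_obj F x))) (on_obj F x)"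
    if "x \<in> Obj C" for x using e[OF F.obj[OF that]] .
  interpret mult: two_natural C C "comp_fun ?T ?T" ?T ?mu
  proof
    fix x assume x: "x \<in> Obj C"
    show "?mu x \<in> hom C (on_obj (comp_fun ?T ?T) x) (on_obj ?T x)"
      using mor[OF eF[OF x]] by (simp add: comp_fun_def)
  next
    fix f x y assume f: "f \<in> hom C x y"
    have xy: "x \<in> Obj C" "y \<in> Obj C" using f by (auto simp: hom_iff ty)
    have "on_mor ?U (comp1 (Mon Strict) (on_mor F f) (\<epsilon> (on_obj F x)))
        = on_mor ?U (comp1 (Mon Strict) (\<epsilon> (on_obj F y)) (on_mor F (on_mor ?U (on_mor F f))))"
      using en[OF F.mor[OF f]] by simp
    then show "on_mor ?T f \<cdot> ?mu x = ?mu y \<cdot> on_mor (comp_fun ?T ?T) f"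
      using pres_comp1[OF eF[OF xy(1)] F.mor[OF f]] pres_comp1[OF F.mor[OF mor[OF F.mor[OF f]]] eF[OF xy(2)]]
      by (simp add: comp_fun_def)
  next
    fix f x y \<alpha> g assume f: "f \<in> hom C x y" and \<alpha>: "\<alpha> \<in> cells C f g"
    have xy: "x \<in> Obj C" "y \<in> Obj C" using f by (auto simp: hom_iff ty)
    let ?A = "Mon Strict"
    have i: "id2 ?A (\<epsilon> (on_obj F z)) \<in> cells ?A (\<epsilon> (on_obj F z)) (\<epsilon> (on_obj F z))"
      "on_cell ?U (id2 ?A (\<epsilon> (on_obj F z))) = \<iota> (?mu z)" if "z \<in> Obj C" for z
      using A.id2_cells pres_id2 eF[OF that] by (auto simp: hom_def)
    have "on_cell ?U (hcomp ?A (on_cell F \<alpha>) (id2 ?A (\<epsilon> (on_obj F x))))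
        = on_cell ?U (hcomp ?A (id2 ?A (\<epsilon> (on_obj F y))) (on_cell F (on_cell ?U (on_cell F \<alpha>))))"
      using counit.natural2[OF F.mor[OF f] F.cell[OF \<alpha>]] by (simp add: comp_fun_def id_fun_def)
    then show "whisker_right C (on_cell ?T \<alpha>) (?mu x) = whisker_left C (?mu y) (on_cell (comp_fun ?T ?T) \<alpha>)"
      using pres_hcomp[OF eF[OF xy(1)] F.mor[OF f] i(1)[OF xy(1)] F.cell[OF \<alpha>]]
        pres_hcomp[OF F.mor[OF mor[OF F.mor[OF f]]] eF[OF xy(2)] F.cell[OF cell[OF F.cell[OF \<alpha>]]] i(1)[OF xy(2)]]
      by (simp add: comp_fun_def i xy)
  qed
  show ?thesis
  proof (intro two_monad.intro two_monad_axioms.intro)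
    show "two_category C" by unfold_locales
    show "two_natural C C (comp_fun (endo (induced_monad F ?U \<eta> \<epsilon>)) (endo (induced_monad F ?U \<eta> \<epsilon>)))
       (endo (induced_monad F ?U \<eta> \<epsilon>)) (monad_mult (induced_monad F ?U \<eta> \<epsilon>))"
      using mult.two_natural_axioms by (simp add: induced_monad_def)
    show "two_natural C C id_fun (endo (induced_monad F ?U \<eta> \<epsilon>)) (monad_unit (induced_monad F ?U \<eta> \<epsilon>))"
      using unit.two_natural_axioms by (simp add: induced_monad_def)
    fix x assume x: "x \<in> Obj C"
    have a: "on_obj F x \<in> Obj (Mon Strict)" using F.obj[OF x] .
    have TFx: "on_obj ?U (on_obj F x) \<in> Obj C" using obj[OF a] .
    let ?T' = "induced_monad F ?U \<eta> \<epsilon>"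
    show "monad_mult ?T' x \<cdot> on_mor (endo ?T') (monad_mult ?T' x) = monad_mult ?T' x \<cdot> monad_mult ?T' (on_obj (endo ?T') x)"
      using en[OF eF[OF x]] pres_comp1[OF eF[OF TFx] eF[OF x]]
        pres_comp1[OF F.mor[OF mor[OF eF[OF x]]] eF[OF x]]
      by (simp add: induced_monad_def comp_fun_def)
    have h: "\<eta> x \<in> hom C x (on_obj ?U (on_obj F x))"
      using unit.component[OF x] by (simp add: comp_fun_def id_fun_def)
    show "monad_mult ?T' x \<cdot> on_mor (endo ?T') (monad_unit ?T' x) = \<one> (on_obj (endo ?T') x)"
      using triangle_left[OF x] pres_comp1[OF F.mor[OF h] eF[OF x]] pres_id1[OF a]
      by (simp add: induced_monad_def comp_fun_def)
    show "monad_mult ?T' x \<cdot> monad_unit ?T' (on_obj (endo ?T') x) = \<one> (on_obj (endo ?T') x)"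
      using triangle_right[OF a] by (simp add: induced_monad_def comp_fun_def)
  qed
qed

lemma adjunction_free_monoids:
  assumes "two_adjunction C (Mon Strict) F mon_forget \<eta> \<epsilon>"
  shows "free_monoids C M (induced_monad F mon_forget \<eta> \<epsilon>) (on_obj F) (\<lambda>X. mmap (\<epsilon> X))"
proof -
  interpret adj: two_adjunction C "Mon Strict" F mon_forget \<eta> \<epsilon> by fact
  interpret alg: two_monad C "induced_monad F mon_forget \<eta> \<epsilon>" by (rule adjunction_monad) fact
  have U: "on_obj mon_forget = mcarr" "on_mor mon_forget = mmap" "on_cell mon_forget = mcell"
    by (simp_all add: mon_forget_def)
  have T: "on_obj (endo (induced_monad F mon_forget \<eta> \<epsilon>)) x = mcarr (on_obj F x)"
    "on_mor (endo (induced_monad F mon_forget \<eta> \<epsilon>)) f = mmap (on_mor F f)"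
    "on_cell (endo (induced_monad F mon_forget \<eta> \<epsilon>)) \<alpha> = mcell (on_cell F \<alpha>)"
    "monad_unit (induced_monad F mon_forget \<eta> \<epsilon>) = \<eta>"
    "monad_mult (induced_monad F mon_forget \<eta> \<epsilon>) x = mmap (\<epsilon> (on_obj F x))" for x f \<alpha>
    by (simp_all add: induced_monad_def comp_fun_def U)
  have monoid: "X \<in> Obj (Mon Strict) \<longleftrightarrow> is_monoid X" for X by (simp add: Mon_def)
  have e: "\<epsilon> X \<in> hom (Mon Strict) (on_obj F (mcarr X)) X" if "is_monoid X" for X
    using adj.counit.component[of X] that by (simp add: monoid comp_fun_def id_fun_def U)
  have ends: "mdom \<phi> = X \<and> mcod \<phi> = Y" if "\<phi> \<in> hom (Mon Strict) X Y" for \<phi> X Y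
    using that by (simp add: hom_def Mon_def)
  show ?thesis
  proof (intro free_monoids.intro free_monoids_axioms.intro)
    show "monoidal_two_category C M" "two_monad C (induced_monad F mon_forget \<eta> \<epsilon>)" by unfold_locales
  next
    fix x assume x: "x \<in> Obj C"
    show "is_monoid (on_obj F x)" using adj.F.obj[OF x] by (simp add: monoid)
    show "mcarr (on_obj F x) = on_obj (endo (induced_monad F mon_forget \<eta> \<epsilon>)) x" by (simp add: T)
    show "mmap (\<epsilon> (on_obj F x)) = monad_mult (induced_monad F mon_forget \<eta> \<epsilon>) x" by (simp add: T)
  next
    fix f x y assume f: "f \<in> hom C x y"
    show "strict_hom (on_obj F x) (on_obj F y) (on_mor (endo (induced_monad F mon_forget \<eta> \<epsilon>)) f)"
      unfolding T by (rule strict_hom_of_hom[OF adj.F.mor[OF f]])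
    fix \<alpha> g assume \<alpha>: "\<alpha> \<in> cells C f g"
    show "on_cell (endo (induced_monad F mon_forget \<eta> \<epsilon>)) \<alpha> \<star> \<iota> (mmult (on_obj F x)) =
        \<iota> (mmult (on_obj F y)) \<star> (on_cell (endo (induced_monad F mon_forget \<eta> \<epsilon>)) \<alpha> \<circledast> on_cell (endo (induced_monad F mon_forget \<eta> \<epsilon>)) \<alpha>)"
      "on_cell (endo (induced_monad F mon_forget \<eta> \<epsilon>)) \<alpha> \<star> \<iota> (munit (on_obj F x)) = \<iota> (munit (on_obj F y))"
      unfolding T using strict_cell(2,3)[OF adj.F.cell[OF \<alpha>]] ends[OF adj.F.mor[OF f]] by simp_all
  next
    fix X assume X: "is_monoid X"
    show "strict_hom (on_obj F (mcarr X)) X (mmap (\<epsilon> X))" by (rule strict_hom_of_hom[OF e[OF X]])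
    show "mmap (\<epsilon> X) \<cdot> monad_unit (induced_monad F mon_forget \<eta> \<epsilon>) (mcarr X) = \<one> (mcarr X)"
      using adj.triangle_right[of X] X by (simp add: monoid T U)
  next
    fix X Y u assume u: "strict_hom X Y u"
    let ?\<phi> = "\<lparr>mdom = X, mcod = Y, mmap = u, mbar = \<iota> (u \<cdot> mmult X), mzero = \<iota> (munit Y)\<rparr>"
    have h: "?\<phi> \<in> hom (Mon Strict) X Y"
      using mor_of_strict_hom[OF u] by (simp add: hom_def Mon_def)
    have XY: "is_monoid X" "is_monoid Y" using u by (simp_all add: strict_hom_def)
    have "comp1 (Mon Strict) ?\<phi> (\<epsilon> X) = comp1 (Mon Strict) (\<epsilon> Y) (on_mor F u)"
      using adj.counit.natural1[OF h] by (simp add: comp_fun_def id_fun_def U)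
    then have "mmap (comp1 (Mon Strict) ?\<phi> (\<epsilon> X)) = mmap (comp1 (Mon Strict) (\<epsilon> Y) (on_mor F u))" by simp
    then show "u \<cdot> mmap (\<epsilon> X) = mmap (\<epsilon> Y) \<cdot> on_mor (endo (induced_monad F mon_forget \<eta> \<epsilon>)) u"
      by (simp add: Mon_def mon_comp_def Let_def T)
  qed
qed

end

section \<open>Monoids as algebras for the free monoid 2-monad\<close>

theorem theorem27:
  fixes C :: "('o, 'm, 'c) two_cat"
    and M :: "('o, 'm, 'c) monoidal_structure"
    and T :: "('o, 'm, 'c) monad"
  assumes monoidal: "monoidal_two_category C M"
    and small_index: "infinite (UNIV :: 'i set)"
    and pie: "two_category.has_pie_limits C TYPE('i)"
    and adjunction: "two_adjunction C (monoidal_two_category.Mon C M Strict)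
          F monoidal_two_category.mon_forget \<eta> \<epsilon>"
    and T_def: "T = induced_monad F monoidal_two_category.mon_forget \<eta> \<epsilon>"
  shows "\<exists>E.
    (\<forall>w \<in> {Lax, Pseudo, Colax}.
       f_iso_over (all_tight C)
         (monoidal_two_category.MonF C M w) monoidal_two_category.mon_forget
         (two_monad.AlgF C T w) two_monad.alg_forget (E w)) \<and>
    (\<forall>w \<in> {Lax, Colax}.
       fun_eq_on (monoidal_two_category.Mon C M Pseudo)
         (comp_fun (E w) (monoidal_two_category.mon_incl C w))
         (comp_fun (two_monad.alg_incl C w) (E Pseudo)))"
proof -
  interpret monoidal_two_category C M by (rule monoidal)
  have lim: "has_binary_products" "has_plain_inserters" "has_plain_equifiers"
    using pie small_index has_binary_products_if_pie has_plain_inserters_if_pie has_plain_equifiers_if_pie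
    unfolding has_pie_limits_def by blast+
  interpret free_monoids_with_commas C M T "on_obj F" "\<lambda>X. mmap (\<epsilon> X)"
  proof (intro free_monoids_with_commas.intro free_monoids_with_commas_axioms.intro)
    show "free_monoids C M T (on_obj F) (\<lambda>X. mmap (\<epsilon> X))"
      unfolding T_def by (rule adjunction_free_monoids[OF adjunction])
    show "has_commas UNIV" by (rule has_commas_UNIV[OF lim(1,2)])
    then show "has_commas (Collect (iso2 C))" by (rule has_commas_iso2[OF _ lim(2,3)])
    show "two_category.has_commas (co C) UNIV" by (rule has_commas_co[OF lim(1,2)])
  qed
  show ?thesis
    using f_iso_to_alg to_alg_natural by (intro exI[of _ to_alg]) blast
qed

end
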